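(* Let $n\ge1$, let $\mathfrak p_0\in A=\mathbb F_q[T]$ be monic irreducible of degree $r$ with $\gcd(n,r)=1$, let $t\in\mathbb F_{q^r}$ be a root of $\mathfrak p_0$, let $\phi$ be the Drinfeld module with $\phi_T=t+\tau^n$, and let $\mathfrak p\neq\mathfrak p_0$ be a monic irreducible element of $A$. Put $\kappa=A/\mathfrak p$, $M=\phi[\mathfrak p]$, $E=\operatorname{End}_\kappa(M)$, $\pi=\tau^r$. Let $m\mid n$, $S=\kappa[\pi|_M]$, $R_0=\kappa[\pi^m|_M]$, $R=\operatorname{Cent}_E(R_0)$ (the centralizer of $R_0$ in $E$), and $L=\mathbb F_{q^m}$ viewed in $E$ by scalar multiplication on $M$. Then: (1) $R=\operatorname{End}_{R_0}(M)\cong\operatorname{Mat}_m(R_0)$. (2) $\operatorname{Cent}_E(R)=R_0$. (3) $R$ is the image in $E$ of the subring $B_m=\mathbb F_{q^m}[\phi_T,\pi]\subseteq\operatorname{End}(\phi)$, and $L$ is precisely the constant part of $R$: for $\zeta\in\mathbb F_{q^n}$, the operator $v\mapsto\zeta v$ on $M$ lies in $R$ if and only if $\zeta\in\mathbb F_{q^m}$. (4) The multiplication map $L\otimes_{\mathbb F_q}S\to R$ is bijective.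
   Context: $q$ is a prime power, $A=\mathbb F_q[T]$, and $\overline{\mathbb F}_q$ is a fixed algebraic closure containing all finite fields considered. For $i\ge0$ write $[i]=q^i$, so $\beta^{[i]}=\beta^{q^i}$. Twisted polynomials in $\tau$ satisfy $\tau a=a^q\tau$ and act on $\overline{\mathbb F}_q$ with $\tau$ acting as $x\mapsto x^q$ and constants by multiplication. The Drinfeld module $\phi$ is the $\mathbb F_q$-algebra homomorphism $A\to\mathbb F_{q^r}\{\tau\}$, $a\mapsto\phi_a$, determined by $\phi_T=t+\tau^n$. Its endomorphism ring $\operatorname{End}(\phi)$ is the centralizer of $\phi(A)$ in $\overline{\mathbb F}_q\{\tau\}$ (all endomorphisms are defined over $\mathbb F_{q^{nr}}$); it contains the constants $\mathbb F_{q^n}$ and $\pi=\tau^r$. The $\mathfrak p$-torsion is $M=\phi[\mathfrak p]=\{v\in\overline{\mathbb F}_q:\phi_{\mathfrak p}(v)=0\}$, on which $a\in A$ acts by $v\mapsto\phi_a(v)$; this makes $M$ a $\kappa$-vector space of dimension $n$. Every element of $\operatorname{End}(\phi)$ acts $\kappa$-linearly on $M$, giving the reduction map $\operatorname{End}(\phi)\to E$; in particular $\pi$ acts by $v\mapsto v^{[r]}$ and $\zeta\in\mathbb F_{q^n}$ acts by $v\mapsto\zeta v$. The field $\kappa$ is identified with the $\kappa$-scalars in $E$. *)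

theory Defs
  imports "HOL-Library.Cardinality" "HOL-Algebra.Algebra" "HOL-Algebra.Algebraic_Closure_Type"
begin

text \<open>
  Throughout, the finite field of \<open>q\<close> elements is a type \<open>'k :: {finite, field}\<close> with
  \<open>q = CARD('k)\<close>, its algebraic closure is the type \<open>'k alg_closure\<close> with embedding \<open>to_ac\<close>,
  and \<open>A\<close> is the type \<open>'k poly\<close>.
\<close>


section \<open>Twisted polynomials over the algebraic closure\<close>

text \<open>
  The twisted polynomial \<open>\<Sum>i. a i * \<tau>^i\<close> is represented by the ordinary polynomial with
  coefficients \<open>a i\<close>; only the multiplication differs, being governed by \<open>\<tau> * a = a^q * \<tau>\<close>.
\<close>

definition twisted_mult ::
  "('k :: {finite, field}) alg_closure poly \<Rightarrow> 'k alg_closure poly \<Rightarrow> 'k alg_closure poly" where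
  "twisted_mult f g =
     (\<Sum>i\<le>Polynomial.degree f. \<Sum>j\<le>Polynomial.degree g.
        Polynomial.monom
          (Polynomial.coeff f i * Polynomial.coeff g j ^ (CARD('k) ^ i)) (i + j))"

definition twisted_ring :: "('k :: {finite, field}) alg_closure poly ring" where
  "twisted_ring = \<lparr>carrier = UNIV, monoid.mult = twisted_mult, one = 1, ring.zero = 0, add = (+)\<rparr>"

definition twisted_const :: "('k :: {finite, field}) alg_closure \<Rightarrow> 'k alg_closure poly" where
  "twisted_const a = [:a:]"

definition twisted_tau :: "('k :: {finite, field}) alg_closure poly" where
  "twisted_tau = [:0, 1:]"

definition twisted_act ::
  "('k :: {finite, field}) alg_closure poly \<Rightarrow> 'k alg_closure \<Rightarrow> 'k alg_closure" where
  "twisted_act f v = (\<Sum>i\<le>Polynomial.degree f. Polynomial.coeff f i * v ^ (CARD('k) ^ i))"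

text \<open>The subfield with \<open>q^k\<close> elements of the algebraic closure, for \<open>k > 0\<close>.\<close>

definition subfield_GF :: "nat \<Rightarrow> ('k :: {finite, field}) alg_closure set" where
  "subfield_GF k = {x. x ^ (CARD('k) ^ k) = x}"


section \<open>Rings of endomorphisms, centralizers, matrices\<close>

definition centralizer :: "('a, 'm) ring_scheme \<Rightarrow> 'a set \<Rightarrow> 'a set" where
  "centralizer E H = {x \<in> carrier E. \<forall>h\<in>H. x \<otimes>\<^bsub>E\<^esub> h = h \<otimes>\<^bsub>E\<^esub> x}"

text \<open>
  Endomorphisms are normalised to be \<open>undefined\<close> outside the module, so that they are equal
  as soon as they agree on it.
\<close>

definition module_End ::
  "('c, 'd) ring_scheme \<Rightarrow> ('c, 'a, 'm) module_scheme \<Rightarrow> ('a \<Rightarrow> 'a) ring" where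
  "module_End K M =
     \<lparr>carrier = {f \<in> carrier M \<rightarrow>\<^sub>E carrier M.
         (\<forall>x\<in>carrier M. \<forall>y\<in>carrier M. f (x \<oplus>\<^bsub>M\<^esub> y) = f x \<oplus>\<^bsub>M\<^esub> f y) \<and>
         (\<forall>c\<in>carrier K. \<forall>x\<in>carrier M. f (c \<odot>\<^bsub>M\<^esub> x) = c \<odot>\<^bsub>M\<^esub> f x)},
      monoid.mult = (\<lambda>f g. compose (carrier M) f g),
      one = (\<lambda>x\<in>carrier M. x),
      ring.zero = (\<lambda>x\<in>carrier M. \<zero>\<^bsub>M\<^esub>),
      add = (\<lambda>f g. \<lambda>x\<in>carrier M. f x \<oplus>\<^bsub>M\<^esub> g x)\<rparr>"

text \<open>The operators by which the elements of \<open>K\<close> act on \<open>M\<close>.\<close>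

definition scalar_ops :: "('c, 'd) ring_scheme \<Rightarrow> ('c, 'a, 'm) module_scheme \<Rightarrow> ('a \<Rightarrow> 'a) set" where
  "scalar_ops K M = (\<lambda>c. \<lambda>x\<in>carrier M. c \<odot>\<^bsub>M\<^esub> x) ` carrier K"

text \<open>
  The additive group of \<open>M\<close> with operators acting on it by evaluation.  The multiplicative
  fields of a module record carry no information.
\<close>

definition evaluation_module :: "('c, 'a, 'm) module_scheme \<Rightarrow> ('a \<Rightarrow> 'a, 'a) module" where
  "evaluation_module M =
     \<lparr>carrier = carrier M, monoid.mult = undefined, one = undefined,
      ring.zero = \<zero>\<^bsub>M\<^esub>, add = add M, module.smult = (\<lambda>f x. f x)\<rparr>"

definition mat_ring :: "nat \<Rightarrow> ('a, 'm) ring_scheme \<Rightarrow> (nat \<times> nat \<Rightarrow> 'a) ring" where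
  "mat_ring d R =
     \<lparr>carrier = {..<d} \<times> {..<d} \<rightarrow>\<^sub>E carrier R,
      monoid.mult = (\<lambda>P Q. \<lambda>(i, j)\<in>{..<d} \<times> {..<d}. \<Oplus>\<^bsub>R\<^esub>k\<in>{..<d}. P (i, k) \<otimes>\<^bsub>R\<^esub> Q (k, j)),
      one = (\<lambda>(i, j)\<in>{..<d} \<times> {..<d}. if i = j then \<one>\<^bsub>R\<^esub> else \<zero>\<^bsub>R\<^esub>),
      ring.zero = (\<lambda>(i, j)\<in>{..<d} \<times> {..<d}. \<zero>\<^bsub>R\<^esub>),
      add = (\<lambda>P Q. \<lambda>(i, j)\<in>{..<d} \<times> {..<d}. P (i, j) \<oplus>\<^bsub>R\<^esub> Q (i, j))\<rparr>"

definition scalar_mat :: "nat \<Rightarrow> ('a, 'm) ring_scheme \<Rightarrow> 'a \<Rightarrow> nat \<times> nat \<Rightarrow> 'a" where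
  "scalar_mat d R c = (\<lambda>(i, j)\<in>{..<d} \<times> {..<d}. if i = j then c else \<zero>\<^bsub>R\<^esub>)"


section \<open>Tensor products\<close>

definition tensor_rels ::
  "('c, 'd) ring_scheme \<Rightarrow> ('c, 'a, 'm) module_scheme \<Rightarrow> ('c, 'b, 'n) module_scheme \<Rightarrow>
     ('a \<times> 'b \<Rightarrow>\<^sub>0 int) set" where
  "tensor_rels K M N =
     {frag_of (x \<oplus>\<^bsub>M\<^esub> x', y) - frag_of (x, y) - frag_of (x', y) | x x' y.
        x \<in> carrier M \<and> x' \<in> carrier M \<and> y \<in> carrier N} \<union>
     {frag_of (x, y \<oplus>\<^bsub>N\<^esub> y') - frag_of (x, y) - frag_of (x, y') | x y y'.
        x \<in> carrier M \<and> y \<in> carrier N \<and> y' \<in> carrier N} \<union>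
     {frag_of (c \<odot>\<^bsub>M\<^esub> x, y) - frag_of (x, c \<odot>\<^bsub>N\<^esub> y) | c x y.
        c \<in> carrier K \<and> x \<in> carrier M \<and> y \<in> carrier N}"

text \<open>The tensor product over \<open>K\<close>, as an abelian group written multiplicatively.\<close>

definition tensor_product ::
  "('c, 'd) ring_scheme \<Rightarrow> ('c, 'a, 'm) module_scheme \<Rightarrow> ('c, 'b, 'n) module_scheme \<Rightarrow>
     ('a \<times> 'b \<Rightarrow>\<^sub>0 int) set monoid" where
  "tensor_product K M N =
     free_Abelian_group (carrier M \<times> carrier N) Mod
       generate (free_Abelian_group (carrier M \<times> carrier N)) (tensor_rels K M N)"

text \<open>
  The map on the tensor product induced by a \<open>K\<close>-bilinear map \<open>g\<close> with values in \<open>G\<close>.  An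
  element \<open>C\<close> of the tensor product is a coset of formal integer combinations of pairs, and
  the combination of the values of \<open>g\<close> is the same for all members of \<open>C\<close>.
\<close>

definition tensor_lift ::
  "('e, 'm) ring_scheme \<Rightarrow> ('a \<Rightarrow> 'b \<Rightarrow> 'e) \<Rightarrow> ('a \<times> 'b \<Rightarrow>\<^sub>0 int) set \<Rightarrow> 'e" where
  "tensor_lift G g C =
     the_elem ((\<lambda>c. \<Oplus>\<^bsub>G\<^esub>z\<in>Poly_Mapping.keys c.
                      [Poly_Mapping.lookup c z] \<cdot>\<^bsub>G\<^esub> g (fst z) (snd z)) ` C)"


section \<open>Drinfeld modules and their torsion\<close>

abbreviation poly_A :: "('k :: {finite, field}) poly ring" where
  "poly_A \<equiv> ring_of_type_algebra"

definition drinfeld_End ::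
  "(('k :: {finite, field}) poly \<Rightarrow> 'k alg_closure poly) \<Rightarrow> 'k alg_closure poly set" where
  "drinfeld_End \<phi> = centralizer twisted_ring (range \<phi>)"

definition residue_field :: "('k :: {finite, field}) poly \<Rightarrow> 'k poly set ring" where
  "residue_field p = poly_A Quot (PIdl\<^bsub>poly_A\<^esub> p)"

text \<open>
  A residue class \<open>C\<close> modulo \<open>p\<close> acts on the \<open>p\<close>-torsion by \<open>\<phi> a\<close> for any representative
  \<open>a \<in> C\<close>; all representatives give the same result.
\<close>

definition torsion_module ::
  "(('k :: {finite, field}) poly \<Rightarrow> 'k alg_closure poly) \<Rightarrow> 'k poly \<Rightarrow>
     ('k poly set, 'k alg_closure) module" where
  "torsion_module \<phi> p =
     \<lparr>carrier = {v. twisted_act (\<phi> p) v = 0}, monoid.mult = undefined, one = undefined,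
      ring.zero = 0, add = (+),
      module.smult = (\<lambda>C v. the_elem ((\<lambda>a. twisted_act (\<phi> a) v) ` C))\<rparr>"

definition reduction ::
  "('c, ('k :: {finite, field}) alg_closure, 'm) module_scheme \<Rightarrow> 'k alg_closure poly \<Rightarrow>
     'k alg_closure \<Rightarrow> 'k alg_closure" where
  "reduction M f = (\<lambda>v\<in>carrier M. twisted_act f v)"

definition const_op ::
  "('c, ('k :: {finite, field}) alg_closure, 'm) module_scheme \<Rightarrow> 'k alg_closure \<Rightarrow>
     'k alg_closure \<Rightarrow> 'k alg_closure" where
  "const_op M z = (\<lambda>v\<in>carrier M. z * v)"

text \<open>
  A set \<open>U\<close> of additive operators on \<open>M\<close> as a module over the finite field \<open>'k\<close>, which acts
  through multiplication by constants.
\<close>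

definition ops_module ::
  "('c, ('k :: {finite, field}) alg_closure, 'm) module_scheme \<Rightarrow>
     ('k alg_closure \<Rightarrow> 'k alg_closure) set \<Rightarrow> ('k, 'k alg_closure \<Rightarrow> 'k alg_closure) module" where
  "ops_module M U =
     \<lparr>carrier = U, monoid.mult = undefined, one = undefined,
      ring.zero = (\<lambda>v\<in>carrier M. \<zero>\<^bsub>M\<^esub>),
      add = (\<lambda>f g. \<lambda>v\<in>carrier M. f v \<oplus>\<^bsub>M\<^esub> g v),
      module.smult = (\<lambda>c f. \<lambda>v\<in>carrier M. to_ac c * f v)\<rparr>"

end

theory Submission
  imports Defs
begin

text \<open>
  Write \<open>q\<close> for the cardinality of the ground field, \<open>d\<close> for the degree of \<open>p\<close> and \<open>K\<close> for the field
  of operators by which \<open>\<kappa>\<close> acts on \<open>M\<close>.  The proof finds a basis of \<open>M\<close> over \<open>R0\<close> and then counts.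

  The point \<open>t\<close> is a root of \<open>p0\<close>, hence not of \<open>p\<close>, so \<open>\<phi> p\<close> acts as a separable additive
  polynomial of degree \<open>q^(n * d)\<close>.  Therefore \<open>M\<close> has \<open>q^(n * d)\<close> elements (\<open>card_V\<close>).

  Let \<open>k\<close> divide \<open>n\<close> and let \<open>x 0, \<dots>, x (k - 1)\<close> be operators on \<open>M\<close> that commute with
  multiplication by elements \<open>\<zeta>\<close> of the field of \<open>q^k\<close> elements.  Evaluating
  \<open>\<Sum>i. x i * \<pi>^i\<close> at \<open>\<zeta> * v\<close> in place of \<open>v\<close> multiplies its \<open>i\<close>-th term by \<open>\<zeta>^(q^(r * i))\<close>, and as \<open>r\<close> is prime to \<open>k\<close> these are \<open>k\<close> different characters.  Hence
  such a sum is zero only if all \<open>x i\<close> are (\<open>lin_inj\<close>).  With \<open>k = n\<close> and coefficients in \<open>K\<close> this shows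
  that \<open>S\<close> has at least \<open>q^(n * d)\<close> elements; with \<open>k = m\<close> it shows that \<open>S\<close> is free over \<open>R0\<close> with
  basis \<open>1, \<pi>, \<dots>, \<pi>^(m - 1)\<close>.

  Being generated over the field \<open>K\<close> by one element, \<open>S\<close> is a finite principal ideal ring
  (\<open>generated_by_one_element_principal\<close>), and a finite principal ideal ring that acts faithfully on a
  module has a vector \<open>v\<close> with trivial annihilator (\<open>ex_faithful_vector\<close>).  The map \<open>s \<mapsto> s v\<close> from \<open>S\<close>
  to \<open>M\<close> is then injective and, by the two counts, bijective (\<open>ex_cyclic_vector\<close>).  So the vectors
  \<open>\<pi>^i v\<close> with \<open>i < m\<close> form a basis of \<open>M\<close> over \<open>R0\<close>.  This identifies \<open>R\<close> with a matrix ring over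
  \<open>R0\<close> (\<open>matrix_of_iso\<close>), whose centre consists of the scalars (\<open>centralizer_of_End\<close>); and it shows
  that \<open>R\<close> has as many elements as \<open>S^m\<close>.

  Finally let \<open>z j\<close> with \<open>j < m\<close> be a basis of the field \<open>L\<close>.  A relation \<open>\<Sum>j. z j * s j = 0\<close> with
  \<open>s j \<in> S\<close> gives a whole family of relations when it is evaluated at the vectors \<open>\<pi>^i v\<close>, because
  \<open>s j\<close> commutes with \<open>\<pi>\<close>, and together they force all \<open>s j\<close> to vanish
  (\<open>independence_over_frobenius_orbit\<close>).  So the sums \<open>\<Sum>j. z j * s j\<close> are \<open>|S|^m = |R|\<close> different
  elements of \<open>R\<close>, hence all of them (\<open>R_eq_LS\<close>).  This is the bijectivity of the map on the tensor
  product, and it shows that the reduction of \<open>B\<close>, which contains \<open>L\<close> and \<open>S\<close>, is \<open>R\<close>.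
\<close>

section \<open>Rings generated by one element over a field\<close>

text \<open>
  The values at \<open>x\<close> of the polynomials over \<open>K\<close> of degree below \<open>k\<close>.
\<close>

primrec poly_exprs :: "('a, 'm) ring_scheme \<Rightarrow> 'a set \<Rightarrow> 'a \<Rightarrow> nat \<Rightarrow> 'a set" where
  "poly_exprs R K x 0 = {\<zero>\<^bsub>R\<^esub>}"
| "poly_exprs R K x (Suc k) =
     {w \<oplus>\<^bsub>R\<^esub> c \<otimes>\<^bsub>R\<^esub> x [^]\<^bsub>R\<^esub> k | w c. w \<in> poly_exprs R K x k \<and> c \<in> K}"

context cring
begin

lemma poly_exprs_closed:
  assumes "K \<subseteq> carrier R" "x \<in> carrier R" "w \<in> poly_exprs R K x k"
  shows "w \<in> carrier R"
  using assms(3)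
proof (induction k arbitrary: w)
  case (Suc k)
  then obtain u c where "u \<in> poly_exprs R K x k" "c \<in> K" "w = u \<oplus> c \<otimes> x [^] k" by auto
  with Suc.IH[of u] assms show ?case by auto
qed simp

lemma poly_exprs_add:
  assumes K: "subring K R" and x: "x \<in> carrier R"
    and "v \<in> poly_exprs R K x k" "w \<in> poly_exprs R K x k"
  shows "v \<oplus> w \<in> poly_exprs R K x k"
  using assms(3,4)
proof (induction k arbitrary: v w)
  case (Suc k)
  from Suc.prems obtain v' a w' b where
    v: "v' \<in> poly_exprs R K x k" "a \<in> K" "v = v' \<oplus> a \<otimes> x [^] k" and
    w: "w' \<in> poly_exprs R K x k" "b \<in> K" "w = w' \<oplus> b \<otimes> x [^] k" by auto
  have KR: "K \<subseteq> carrier R" using subringE(1)[OF K] .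
  have c: "v' \<in> carrier R" "w' \<in> carrier R" "a \<in> carrier R" "b \<in> carrier R" "x [^] k \<in> carrier R"
    using poly_exprs_closed[OF KR x] v w KR x by auto
  have "v \<oplus> w = (v' \<oplus> w') \<oplus> (a \<oplus> b) \<otimes> x [^] k"
    unfolding v(3) w(3) using c by algebra
  moreover have "a \<oplus> b \<in> K" using subringE(7)[OF K] v w by blast
  ultimately show ?case using Suc.IH[OF v(1) w(1)] by auto
qed simp

lemma poly_exprs_scale:
  assumes K: "subring K R" and x: "x \<in> carrier R"
    and a: "a \<in> K" and "w \<in> poly_exprs R K x k"
  shows "a \<otimes> w \<in> poly_exprs R K x k"
  using assms(4)
proof (induction k arbitrary: w)
  case 0
  then show ?case using a subringE(1)[OF K] by auto
next
  case (Suc k)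
  then obtain u c where u: "u \<in> poly_exprs R K x k" "c \<in> K" "w = u \<oplus> c \<otimes> x [^] k" by auto
  have KR: "K \<subseteq> carrier R" using subringE(1)[OF K] .
  have c: "u \<in> carrier R" "a \<in> carrier R" "c \<in> carrier R" "x [^] k \<in> carrier R"
    using poly_exprs_closed[OF KR x] u a KR x by auto
  have "a \<otimes> w = a \<otimes> u \<oplus> (a \<otimes> c) \<otimes> x [^] k"
    unfolding u(3) using c by algebra
  moreover have "a \<otimes> c \<in> K" using subringE(6)[OF K] a u by blast
  ultimately show ?case using Suc.IH[OF u(1)] by auto
qed

lemma poly_exprs_Suc:
  assumes K: "subring K R" and x: "x \<in> carrier R" and "w \<in> poly_exprs R K x k"
  shows "w \<in> poly_exprs R K x (Suc k)"
proof -
  have "w \<in> carrier R" using poly_exprs_closed[OF subringE(1)[OF K] x assms(3)] .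
  then have "w = w \<oplus> \<zero> \<otimes> x [^] k" using x by simp
  then show ?thesis using assms(3) subringE(2)[OF K] by auto
qed

lemma poly_exprs_mono:
  assumes K: "subring K R" and x: "x \<in> carrier R" and "w \<in> poly_exprs R K x k" "k \<le> l"
  shows "w \<in> poly_exprs R K x l"
  using assms(4,3) poly_exprs_Suc[OF K x]
  by (induction rule: dec_induct) blast+

lemma poly_exprs_shift:
  assumes K: "subring K R" and x: "x \<in> carrier R" and "w \<in> poly_exprs R K x k"
  shows "x \<otimes> w \<in> poly_exprs R K x (Suc k)"
  using assms(3)
proof (induction k arbitrary: w)
  case 0
  then have "x \<otimes> w = \<zero> \<oplus> \<zero> \<otimes> x [^] (0::nat)" using x by simp
  moreover have "\<zero> \<in> poly_exprs R K x 0" by simp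
  ultimately show ?case using subringE(2)[OF K] by (subst poly_exprs.simps) blast
next
  case (Suc k)
  then obtain u c where u: "u \<in> poly_exprs R K x k" "c \<in> K" "w = u \<oplus> c \<otimes> x [^] k" by auto
  have KR: "K \<subseteq> carrier R" using subringE(1)[OF K] .
  have c: "u \<in> carrier R" "c \<in> carrier R" "x [^] k \<in> carrier R"
    using poly_exprs_closed[OF KR x] u KR x by auto
  have "x \<otimes> w = x \<otimes> u \<oplus> c \<otimes> (x \<otimes> x [^] k)"
    unfolding u(3) using c x by algebra
  moreover have "x \<otimes> x [^] k = x [^] Suc k" using x by (simp add: m_comm)
  ultimately have "x \<otimes> w = x \<otimes> u \<oplus> c \<otimes> x [^] Suc k" by simp
  then show ?case
    using Suc.IH[OF u(1)] u(2) by (subst poly_exprs.simps) blast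
qed

lemma poly_exprs_shift_power:
  assumes K: "subring K R" and x: "x \<in> carrier R" and w: "w \<in> poly_exprs R K x k"
  shows "x [^] j \<otimes> w \<in> poly_exprs R K x (j + k)"
proof (induction j)
  case 0
  then show ?case using w poly_exprs_closed[OF subringE(1)[OF K] x w] by simp
next
  case (Suc j)
  have "x [^] Suc j \<otimes> w = x \<otimes> (x [^] j \<otimes> w)"
    using x poly_exprs_closed[OF subringE(1)[OF K] x w] by (simp add: m_assoc m_comm m_lcomm)
  then show ?case using poly_exprs_shift[OF K x Suc.IH] by simp
qed

lemma poly_exprs_mult:
  assumes K: "subring K R" and x: "x \<in> carrier R"
    and "v \<in> poly_exprs R K x j" "w \<in> poly_exprs R K x k"
  shows "v \<otimes> w \<in> poly_exprs R K x (j + k)"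
  using assms(3)
proof (induction j arbitrary: v)
  case 0
  have "w \<in> carrier R" using poly_exprs_closed[OF subringE(1)[OF K] x assms(4)] .
  with 0 have "v \<otimes> w = \<zero>" by simp
  moreover have "\<zero> \<in> poly_exprs R K x k"
    using poly_exprs_mono[OF K x, of \<zero> 0 k] by simp
  ultimately show ?case by simp
next
  case (Suc j)
  then obtain u c where u: "u \<in> poly_exprs R K x j" "c \<in> K" "v = u \<oplus> c \<otimes> x [^] j" by auto
  have KR: "K \<subseteq> carrier R" using subringE(1)[OF K] .
  have c: "u \<in> carrier R" "c \<in> carrier R" "x [^] j \<in> carrier R" "w \<in> carrier R"
    using poly_exprs_closed[OF KR x] u KR x assms(4) by auto
  have "v \<otimes> w = u \<otimes> w \<oplus> c \<otimes> (x [^] j \<otimes> w)"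
    unfolding u(3) using c by algebra
  moreover have "u \<otimes> w \<in> poly_exprs R K x (Suc j + k)"
    using poly_exprs_Suc[OF K x Suc.IH[OF u(1)]] by simp
  moreover have "c \<otimes> (x [^] j \<otimes> w) \<in> poly_exprs R K x (Suc j + k)"
    using poly_exprs_Suc[OF K x poly_exprs_scale[OF K x u(2)
          poly_exprs_shift_power[OF K x assms(4), of j]]] by simp
  ultimately show ?case by (simp only: poly_exprs_add[OF K x])
qed

lemma generate_ring_imp_poly_exprs:
  assumes K: "subring K R" and x: "x \<in> carrier R" and y: "y \<in> generate_ring R (insert x K)"
  shows "\<exists>k. y \<in> poly_exprs R K x k"
proof -
  have KR: "K \<subseteq> carrier R" using subringE(1)[OF K] .
  have const: "c \<in> poly_exprs R K x (Suc 0)" if "c \<in> K" for c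
  proof -
    have "c = \<zero> \<oplus> c \<otimes> x [^] (0::nat)" using that KR by auto
    then show ?thesis using that by auto
  qed
  have neg: "\<ominus> w = (\<ominus> \<one>) \<otimes> w" if "w \<in> carrier R" for w
    using that by (simp add: l_minus)
  show ?thesis using y
  proof (induction rule: generate_ring.induct)
    case one
    then show ?case using const[OF subringE(3)[OF K]] by blast
  next
    case (incl h)
    have "x = \<zero> \<otimes> x \<oplus> \<one> \<otimes> x [^] (1::nat)" using x by simp
    moreover have "\<zero> \<otimes> x \<in> poly_exprs R K x 1"
      using const[OF subringE(2)[OF K]] x by simp
    ultimately have "x \<in> poly_exprs R K x (Suc 1)"
      using subringE(3)[OF K] by (subst poly_exprs.simps) blast
    then show ?case using incl const by blast
  next
    case (a_inv h)
    then obtain k where k: "h \<in> poly_exprs R K x k" by blast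
    have "\<ominus> \<one> \<in> K" using subringE(3,5)[OF K] by blast
    then have "\<ominus> h \<in> poly_exprs R K x k"
      using poly_exprs_scale[OF K x _ k] neg poly_exprs_closed[OF KR x k] by metis
    then show ?case ..
  next
    case (eng_add h1 h2)
    then obtain j k where "h1 \<in> poly_exprs R K x j" "h2 \<in> poly_exprs R K x k" by blast
    then have "h1 \<in> poly_exprs R K x (max j k)" "h2 \<in> poly_exprs R K x (max j k)"
      using poly_exprs_mono[OF K x] by (meson max.cobounded1 max.cobounded2)+
    then show ?case using poly_exprs_add[OF K x] by blast
  next
    case (eng_mult h1 h2)
    then show ?case using poly_exprs_mult[OF K x] by blast
  qed
qed

text \<open>
  This is division with remainder.  Since \<open>x\<close> may satisfy algebraic relations, it is carried out on
  polynomial expressions rather than on ring elements: a generator of \<open>I\<close> is an element that can be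
  written as \<open>x^k\<close> plus lower terms, with \<open>k\<close> as small as possible.
\<close>

lemma generated_by_one_element_principal:
  assumes K: "subring K R" and inv: "\<And>c. c \<in> K \<Longrightarrow> c \<noteq> \<zero> \<Longrightarrow> \<exists>d\<in>K. d \<otimes> c = \<one>"
    and x: "x \<in> carrier R" and gen: "carrier R = generate_ring R (insert x K)"
    and I: "ideal I R"
  shows "\<exists>a\<in>I. I = PIdl a"
proof -
  interpret I: ideal I R by (rule I)
  have KR: "K \<subseteq> carrier R" using subringE(1)[OF K] .
  have expr: "\<exists>k. y \<in> poly_exprs R K x k" if "y \<in> carrier R" for y
    using generate_ring_imp_poly_exprs[OF K x] that gen by blast
  define monic where "monic k a \<longleftrightarrow> a \<in> I \<and> (\<exists>w\<in>poly_exprs R K x k. a = w \<oplus> x [^] k)" for k a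
  have normalise: "\<exists>a. monic k a"
    if w: "w \<in> poly_exprs R K x k" "c \<in> K" "c \<noteq> \<zero>" "w \<oplus> c \<otimes> x [^] k \<in> I" for w c k
  proof -
    obtain d where d: "d \<in> K" "d \<otimes> c = \<one>" using inv w(2,3) by blast
    have car: "w \<in> carrier R" "c \<in> carrier R" "d \<in> carrier R" "x [^] k \<in> carrier R"
      using w d KR x poly_exprs_closed[OF KR x] by auto
    have "d \<otimes> (w \<oplus> c \<otimes> x [^] k) = d \<otimes> w \<oplus> (d \<otimes> c) \<otimes> x [^] k" using car by algebra
    also have "\<dots> = d \<otimes> w \<oplus> x [^] k" using d car by simp
    finally have "monic k (d \<otimes> w \<oplus> x [^] k)"
      using I.I_l_closed[OF w(4), of d] car poly_exprs_scale[OF K x d(1) w(1)]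
      unfolding monic_def by auto
    then show ?thesis ..
  qed
  \<comment> \<open>without monic expressions all leading coefficients of elements of \<open>I\<close> vanish, so \<open>I\<close> is zero\<close>
  show ?thesis
  proof (cases "\<exists>k a. monic k a")
    case False
    have "y = \<zero>" if "y \<in> I" "y \<in> poly_exprs R K x k" for y k
      using that
    proof (induction k arbitrary: y)
      case (Suc k)
      then obtain u c where u: "u \<in> poly_exprs R K x k" "c \<in> K" "y = u \<oplus> c \<otimes> x [^] k" by auto
      then have "c = \<zero>" using normalise[OF u(1,2)] Suc.prems(1) False by blast
      then have "y = u" using u x poly_exprs_closed[OF KR x u(1)] by simp
      then show ?case using Suc u(1) by blast
    qed simp
    then have "I = {\<zero>}" using expr I.Icarr I.zero_closed by blast
    moreover have "PIdl \<zero> = {\<zero>}" unfolding cgenideal_def by (auto intro!: exI[of _ \<zero>])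
    ultimately show ?thesis by auto
  next
    case True
    define k where "k = (LEAST k. \<exists>a. monic k a)"
    from True have "\<exists>a. monic k a" unfolding k_def by (rule LeastI_ex)
    then obtain a u where a: "a \<in> I" "u \<in> poly_exprs R K x k" "a = u \<oplus> x [^] k"
      unfolding monic_def by blast
    have least: "\<not> monic j b" if "j < k" for j b
      using that not_less_Least unfolding k_def by blast
    have ac: "a \<in> carrier R" using a I.Icarr by blast
    have uc: "u \<in> carrier R" using poly_exprs_closed[OF KR x a(2)] .
    have "y \<in> PIdl a" if "y \<in> I" "y \<in> poly_exprs R K x j" for y j
      using that
    proof (induction j arbitrary: y)
      case 0
      then have "y = \<zero> \<otimes> a" using ac by simp
      then show ?case unfolding cgenideal_def by blast
    next
      case (Suc j)
      then obtain w c where w: "w \<in> poly_exprs R K x j" "c \<in> K" "y = w \<oplus> c \<otimes> x [^] j" by auto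
      have wc: "w \<in> carrier R" "c \<in> carrier R" using w KR poly_exprs_closed[OF KR x] by auto
      show ?case
      proof (cases "j < k")
        case True
        then have "c = \<zero>" using normalise[OF w(1,2)] w(3) Suc.prems(1) least by blast
        then have "y = w" using w x wc by simp
        then show ?thesis using Suc w(1) by blast
      next
        case False
        \<comment> \<open>the multiple of \<open>a\<close> that has the leading term of \<open>y\<close>\<close>
        define b where "b = (c \<otimes> x [^] (j - k)) \<otimes> a"
        have xj: "x [^] j = x [^] (j - k) \<otimes> x [^] k" using False x by (simp add: nat_pow_mult)
        have cc: "x [^] (j - k) \<in> carrier R" "x [^] k \<in> carrier R" using x by auto
        have "y \<ominus> b = w \<oplus> (\<ominus> c) \<otimes> (x [^] (j - k) \<otimes> u)"
          unfolding w(3) b_def a(3) xj using wc uc cc by algebra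
        moreover have "x [^] (j - k) \<otimes> u \<in> poly_exprs R K x j"
          using poly_exprs_shift_power[OF K x a(2), of "j - k"] False by simp
        moreover have "\<ominus> c \<in> K" using subringE(5)[OF K w(2)] .
        ultimately have "y \<ominus> b \<in> poly_exprs R K x j"
          using poly_exprs_add[OF K x w(1) poly_exprs_scale[OF K x]] by simp
        moreover have bI: "b \<in> I" unfolding b_def using I.I_l_closed[OF a(1)] wc cc by simp
        moreover have "y \<ominus> b \<in> I"
          using Suc.prems(1) bI by (simp add: a_minus_def)
        ultimately have "y \<ominus> b \<in> PIdl a" using Suc.IH by blast
        then obtain z where z: "z \<in> carrier R" "y \<ominus> b = z \<otimes> a" unfolding cgenideal_def by blast
        have bc: "b \<in> carrier R" "y \<in> carrier R" using bI Suc.prems(1) I.Icarr by auto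
        have "y = (y \<ominus> b) \<oplus> b" using bc by algebra
        also have "\<dots> = (z \<oplus> c \<otimes> x [^] (j - k)) \<otimes> a"
          unfolding z(2) unfolding b_def using z(1) wc cc ac by algebra
        finally show ?thesis unfolding cgenideal_def using z(1) wc cc by auto
      qed
    qed
    then have "I \<subseteq> PIdl a" using expr I.Icarr by blast
    moreover have "PIdl a \<subseteq> I" unfolding cgenideal_def using I.I_l_closed[OF a(1)] by auto
    ultimately show ?thesis using a(1) by blast
  qed
qed

section \<open>Vectors with trivial annihilator\<close>

text \<open>
  Multiplication by \<open>x\<close> has image \<open>PIdl x\<close>, and its fibres are translates of the annihilator.
\<close>

lemma card_annihilator:
  assumes fin: "finite (carrier R)" and x: "x \<in> carrier R"
  shows "card (carrier R) = card (PIdl x) * card {s \<in> carrier R. s \<otimes> x = \<zero>}"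
proof -
  let ?A = "{s \<in> carrier R. s \<otimes> x = \<zero>}"
  have fiber: "card {s \<in> carrier R. s \<otimes> x = y} = card ?A" if y: "y \<in> (\<lambda>s. s \<otimes> x) ` carrier R" for y
  proof -
    obtain u where u: "u \<in> carrier R" "y = u \<otimes> x" using y by blast
    have "bij_betw (\<lambda>s. s \<oplus> u) ?A {s \<in> carrier R. s \<otimes> x = y}"
    proof (rule bij_betw_byWitness[where f' = "\<lambda>s. s \<ominus> u"])
      show "\<forall>s\<in>?A. s \<oplus> u \<ominus> u = s" "\<forall>s\<in>{s \<in> carrier R. s \<otimes> x = y}. s \<ominus> u \<oplus> u = s"
        using u(1) by (simp_all add: a_minus_def a_assoc r_neg l_neg)
      show "(\<lambda>s. s \<oplus> u) ` ?A \<subseteq> {s \<in> carrier R. s \<otimes> x = y}"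
        using u x by (intro image_subsetI) (simp add: l_distr)
      show "(\<lambda>s. s \<ominus> u) ` {s \<in> carrier R. s \<otimes> x = y} \<subseteq> ?A"
      proof (rule image_subsetI)
        fix s assume s: "s \<in> {s \<in> carrier R. s \<otimes> x = y}"
        then have "(s \<ominus> u) \<otimes> x = s \<otimes> x \<ominus> u \<otimes> x" using u(1) x by (simp add: a_minus_def l_distr l_minus)
        also have "\<dots> = \<zero>" using s u x by (simp add: a_minus_def r_neg)
        finally show "s \<ominus> u \<in> ?A" using s u(1) by simp
      qed
    qed
    then show ?thesis by (rule bij_betw_same_card[symmetric])
  qed
  have "card (carrier R) = (\<Sum>y\<in>(\<lambda>s. s \<otimes> x) ` carrier R. card {s \<in> carrier R. s \<otimes> x = y})"
    unfolding card_eq_sum by (rule sum.image_gen[OF fin, of "\<lambda>_. 1::nat" "\<lambda>s. s \<otimes> x"])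
  also have "\<dots> = (\<Sum>y\<in>(\<lambda>s. s \<otimes> x) ` carrier R. card ?A)" by (rule sum.cong[OF refl fiber])
  also have "\<dots> = card ((\<lambda>s. s \<otimes> x) ` carrier R) * card ?A" by simp
  also have "(\<lambda>s. s \<otimes> x) ` carrier R = PIdl x"
    unfolding cgenideal_def by (rule Setcompr_eq_image[symmetric])
  finally show ?thesis .
qed

text \<open>
  Let \<open>x\<close> generate the annihilator of \<open>a\<close>.  Then the ideal of \<open>a\<close> is contained in the annihilator of
  \<open>x\<close>, and counting with multiplication by \<open>a\<close> and by \<open>x\<close> shows that the two have equally many
  elements.  So the ideal of \<open>a\<close> is its own double annihilator.
\<close>

lemma double_annihilator:
  assumes fin: "finite (carrier R)" and pid: "\<And>I. ideal I R \<Longrightarrow> \<exists>a\<in>I. I = PIdl a"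
    and a: "a \<in> carrier R" and b: "b \<in> carrier R"
    and ann: "\<And>s. s \<in> carrier R \<Longrightarrow> s \<otimes> a = \<zero> \<Longrightarrow> s \<otimes> b = \<zero>"
  shows "b \<in> PIdl a"
proof -
  let ?A = "{s \<in> carrier R. s \<otimes> a = \<zero>}"
  have "ideal ?A R"
  proof (rule idealI[OF ring_axioms])
    show "subgroup ?A (add_monoid R)"
    proof (rule add.subgroupI)
      show "?A \<noteq> {}" using a l_null by blast
    qed (use a in \<open>auto simp: l_distr l_minus\<close>)
    fix s x assume s: "s \<in> ?A" and x: "x \<in> carrier R"
    then have "x \<otimes> s \<otimes> a = \<zero>" using a by (simp add: m_assoc)
    then show "x \<otimes> s \<in> ?A" "s \<otimes> x \<in> ?A" using s x m_comm[of s x] by simp_all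
  qed
  then obtain x where x: "x \<in> ?A" "?A = PIdl x" using pid by blast
  let ?T = "{s \<in> carrier R. s \<otimes> x = \<zero>}"
  have xc: "x \<in> carrier R" using x(1) by blast
  have finA: "finite ?A" and finT: "finite ?T" using fin by auto
  have "card (PIdl a) * card (PIdl x) = card (PIdl x) * card ?T"
    using card_annihilator[OF fin a, unfolded x(2)] by (rule trans[OF sym card_annihilator[OF fin xc]])
  moreover have "card (PIdl x) > 0" using finA x card_gt_0_iff[of ?A] by auto
  ultimately have "card (PIdl a) = card ?T" by (simp add: mult.commute[of "card (PIdl a)"])
  moreover have "PIdl a \<subseteq> ?T"
    using x(1) a unfolding cgenideal_def by (auto simp: m_ac)
  ultimately have "PIdl a = ?T" using card_subset_eq[OF finT] by blast
  moreover have "b \<in> ?T" using ann[OF xc] x(1) b xc m_comm[of b x] by simp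
  ultimately show ?thesis by simp
qed

text \<open>
  The generators of the minimal nonzero ideals.
\<close>

definition minimal_gen :: "'a \<Rightarrow> bool" where
  "minimal_gen a \<longleftrightarrow> a \<in> carrier R \<and> a \<noteq> \<zero> \<and>
    (\<forall>s\<in>carrier R. s \<otimes> a \<noteq> \<zero> \<longrightarrow> (\<exists>u\<in>carrier R. u \<otimes> (s \<otimes> a) = a))"

lemma ex_minimal_multiple:
  assumes fin: "finite (carrier R)" and s: "s \<in> carrier R" "s \<noteq> \<zero>"
  shows "\<exists>u\<in>carrier R. minimal_gen (u \<otimes> s)"
proof -
  have "\<one> \<in> carrier R \<and> \<one> \<otimes> s \<noteq> \<zero>" using s by simp
  from ex_has_least_nat[of "\<lambda>u. u \<in> carrier R \<and> u \<otimes> s \<noteq> \<zero>", OF this, of "\<lambda>u. card (PIdl (u \<otimes> s))"]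
  obtain u where u: "u \<in> carrier R" "u \<otimes> s \<noteq> \<zero>"
    and least: "\<And>t. t \<in> carrier R \<Longrightarrow> t \<otimes> s \<noteq> \<zero> \<Longrightarrow> card (PIdl (u \<otimes> s)) \<le> card (PIdl (t \<otimes> s))"
    by blast
  have "\<exists>y\<in>carrier R. y \<otimes> (t \<otimes> (u \<otimes> s)) = u \<otimes> s" if t: "t \<in> carrier R" "t \<otimes> (u \<otimes> s) \<noteq> \<zero>" for t
  proof -
    have "PIdl (u \<otimes> s) \<subseteq> carrier R" unfolding cgenideal_def using u s by auto
    then have "finite (PIdl (u \<otimes> s))" by (rule finite_subset[OF _ fin])
    moreover have "PIdl (t \<otimes> (u \<otimes> s)) \<subseteq> PIdl (u \<otimes> s)"
    proof
      fix y assume "y \<in> PIdl (t \<otimes> (u \<otimes> s))"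
      then obtain z where "z \<in> carrier R" "y = z \<otimes> (t \<otimes> (u \<otimes> s))" unfolding cgenideal_def by blast
      then have "z \<otimes> t \<in> carrier R" "y = (z \<otimes> t) \<otimes> (u \<otimes> s)" using t u s by (auto simp: m_assoc)
      then show "y \<in> PIdl (u \<otimes> s)" unfolding cgenideal_def by blast
    qed
    moreover have "card (PIdl (u \<otimes> s)) \<le> card (PIdl (t \<otimes> (u \<otimes> s)))"
      using least[of "t \<otimes> u"] t u s by (simp add: m_assoc)
    ultimately have "PIdl (t \<otimes> (u \<otimes> s)) = PIdl (u \<otimes> s)" by (rule card_seteq)
    moreover have "u \<otimes> s \<in> PIdl (u \<otimes> s)" by (rule cgenideal_self) (use u s in simp)
    ultimately have "u \<otimes> s \<in> PIdl (t \<otimes> (u \<otimes> s))" by simp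
    then obtain y where "y \<in> carrier R" "u \<otimes> s = y \<otimes> (t \<otimes> (u \<otimes> s))" unfolding cgenideal_def by blast
    then show ?thesis by (intro bexI[of _ y]) (rule sym)
  qed
  then have "minimal_gen (u \<otimes> s)" using u s(1) unfolding minimal_gen_def by simp
  then show ?thesis using u(1) by blast
qed

text \<open>
  By the double annihilator property the annihilator of \<open>b\<close> contains some \<open>d\<close> that does not kill \<open>a\<close>.
  Because the ideal of \<open>a\<close> is minimal, a product of such elements \<open>d\<close> for the various \<open>b \<in> T\<close> still does
  not kill \<open>a\<close>.
\<close>

lemma separate_minimal:
  assumes fin: "finite (carrier R)" and pid: "\<And>I. ideal I R \<Longrightarrow> \<exists>a\<in>I. I = PIdl a"
    and a: "minimal_gen a" and "finite T" "\<And>b. b \<in> T \<Longrightarrow> minimal_gen b \<and> b \<notin> PIdl a"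
  shows "\<exists>c\<in>carrier R. c \<otimes> a \<noteq> \<zero> \<and> (\<forall>b\<in>T. c \<otimes> b = \<zero>)"
  using assms(4,5)
proof (induction T)
  case empty
  then show ?case using a unfolding minimal_gen_def by (intro bexI[of _ \<one>]) auto
next
  case (insert b T)
  then obtain c where c: "c \<in> carrier R" "c \<otimes> a \<noteq> \<zero>" "\<forall>b\<in>T. c \<otimes> b = \<zero>" by auto
  have b: "minimal_gen b" "b \<notin> PIdl a" using insert.prems by auto
  have ab: "a \<in> carrier R" "b \<in> carrier R" "a \<noteq> \<zero>" using a b unfolding minimal_gen_def by auto
  have "\<exists>d\<in>carrier R. d \<otimes> b = \<zero> \<and> d \<otimes> a \<noteq> \<zero>"
  proof (rule ccontr)
    assume "\<not> ?thesis"
    then have "a \<in> PIdl b" by (intro double_annihilator[OF fin pid ab(2,1)]) auto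
    then obtain s where s: "s \<in> carrier R" "a = s \<otimes> b" unfolding cgenideal_def by blast
    then obtain u where "u \<in> carrier R" "u \<otimes> a = b" using b(1) ab(3) unfolding minimal_gen_def by auto
    then show False using b(2) unfolding cgenideal_def by blast
  qed
  then obtain d where d: "d \<in> carrier R" "d \<otimes> b = \<zero>" "d \<otimes> a \<noteq> \<zero>" by blast
  obtain u where u: "u \<in> carrier R" "u \<otimes> (d \<otimes> a) = a" using a d unfolding minimal_gen_def by blast
  have "(c \<otimes> d) \<otimes> a \<noteq> \<zero>"
  proof
    assume z: "(c \<otimes> d) \<otimes> a = \<zero>"
    have "c \<otimes> a = c \<otimes> (u \<otimes> (d \<otimes> a))" using u(2) by simp
    also have "\<dots> = u \<otimes> ((c \<otimes> d) \<otimes> a)" using c(1) d(1) u(1) ab by (simp add: m_ac)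
    finally show False using z u(1) c(2) by simp
  qed
  moreover have "(c \<otimes> d) \<otimes> e = \<zero>" if "e \<in> insert b T" for e
  proof (cases "e = b")
    case False
    then have e: "e \<in> carrier R" "c \<otimes> e = \<zero>" using that insert.prems c unfolding minimal_gen_def by auto
    have "(c \<otimes> d) \<otimes> e = d \<otimes> (c \<otimes> e)" using c(1) d(1) e(1) by (simp add: m_ac)
    also have "\<dots> = \<zero>" unfolding e(2) using d(1) by simp
    finally show ?thesis .
  qed (use c(1) d ab in \<open>simp add: m_assoc\<close>)
  ultimately show ?case using c(1) d(1) by (intro bexI[of _ "c \<otimes> d"]) auto
qed

end

context module
begin

text \<open>
  Every nonzero ideal contains a minimal one, so it suffices that no minimal ideal kills the vector.
  The minimal ideals are dealt with one after the other: if the ideal of \<open>a\<close> kills \<open>v\<close>, the vector is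
  corrected by some \<open>c \<odot> w\<close> where \<open>c\<close> annihilates the generators treated before, so that they do not
  notice the change.
\<close>

lemma ex_faithful_vector:
  assumes fin: "finite (carrier R)"
    and pid: "\<And>I. ideal I R \<Longrightarrow> \<exists>a\<in>I. I = PIdl a"
    and faithful: "\<And>s. s \<in> carrier R \<Longrightarrow> \<forall>v\<in>carrier M. s \<odot>\<^bsub>M\<^esub> v = \<zero>\<^bsub>M\<^esub> \<Longrightarrow> s = \<zero>"
  shows "\<exists>v\<in>carrier M. \<forall>s\<in>carrier R. s \<odot>\<^bsub>M\<^esub> v = \<zero>\<^bsub>M\<^esub> \<longrightarrow> s = \<zero>"
proof -
  have avoid: "\<exists>v\<in>carrier M. \<forall>a\<in>T. a \<odot>\<^bsub>M\<^esub> v \<noteq> \<zero>\<^bsub>M\<^esub>"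
    if "finite T" "\<And>a. a \<in> T \<Longrightarrow> minimal_gen a" for T
    using that
  proof (induction T)
    case (insert a T)
    then obtain v where v: "v \<in> carrier M" "\<forall>b\<in>T. b \<odot>\<^bsub>M\<^esub> v \<noteq> \<zero>\<^bsub>M\<^esub>" by auto
    have a: "minimal_gen a" using insert.prems by simp
    have ac: "a \<in> carrier R" using a unfolding minimal_gen_def by blast
    have Tc: "b \<in> carrier R" if "b \<in> T" for b using insert.prems that unfolding minimal_gen_def by blast
    show ?case
    proof (cases "a \<odot>\<^bsub>M\<^esub> v = \<zero>\<^bsub>M\<^esub>")
      case True
      have "b \<notin> PIdl a" if "b \<in> T" for b
      proof
        assume "b \<in> PIdl a"
        then obtain s where "s \<in> carrier R" "b = s \<otimes> a" unfolding cgenideal_def by blast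
        then have "b \<odot>\<^bsub>M\<^esub> v = \<zero>\<^bsub>M\<^esub>" using True ac v(1) by (simp add: smult_assoc1)
        then show False using v(2) that by blast
      qed
      then obtain c where c: "c \<in> carrier R" "c \<otimes> a \<noteq> \<zero>" "\<forall>b\<in>T. c \<otimes> b = \<zero>"
        using separate_minimal[OF fin pid a insert.hyps(1)] insert.prems by blast
      have "\<not> (\<forall>w\<in>carrier M. (c \<otimes> a) \<odot>\<^bsub>M\<^esub> w = \<zero>\<^bsub>M\<^esub>)" using faithful[of "c \<otimes> a"] c ac by blast
      then obtain w where w: "w \<in> carrier M" "(c \<otimes> a) \<odot>\<^bsub>M\<^esub> w \<noteq> \<zero>\<^bsub>M\<^esub>" by blast
      define u where "u = v \<oplus>\<^bsub>M\<^esub> c \<odot>\<^bsub>M\<^esub> w"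
      have u: "b \<odot>\<^bsub>M\<^esub> u = b \<odot>\<^bsub>M\<^esub> v \<oplus>\<^bsub>M\<^esub> (c \<otimes> b) \<odot>\<^bsub>M\<^esub> w" if "b \<in> carrier R" for b
        unfolding u_def using that c(1) v(1) w(1) m_comm[of c b]
        by (simp add: smult_r_distr smult_assoc1)
      have "a \<odot>\<^bsub>M\<^esub> u \<noteq> \<zero>\<^bsub>M\<^esub>" using u[OF ac] True w c(1) ac by simp
      moreover have "b \<odot>\<^bsub>M\<^esub> u \<noteq> \<zero>\<^bsub>M\<^esub>" if "b \<in> T" for b
        using u[OF Tc[OF that]] c(3) that v w(1) Tc[OF that] by simp
      moreover have "u \<in> carrier M" unfolding u_def using v c w by simp
      ultimately show ?thesis by blast
    qed (use v in blast)
  qed auto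
  have "finite {a. minimal_gen a}" by (rule finite_subset[OF _ fin]) (auto simp: minimal_gen_def)
  then obtain v where v: "v \<in> carrier M" "\<And>a. minimal_gen a \<Longrightarrow> a \<odot>\<^bsub>M\<^esub> v \<noteq> \<zero>\<^bsub>M\<^esub>"
    using avoid[of "{a. minimal_gen a}"] by blast
  have "s = \<zero>" if s: "s \<in> carrier R" "s \<odot>\<^bsub>M\<^esub> v = \<zero>\<^bsub>M\<^esub>" for s
  proof (rule ccontr)
    assume "s \<noteq> \<zero>"
    then obtain u where u: "u \<in> carrier R" "minimal_gen (u \<otimes> s)"
      using ex_minimal_multiple[OF fin s(1)] by blast
    have "(u \<otimes> s) \<odot>\<^bsub>M\<^esub> v = \<zero>\<^bsub>M\<^esub>" using u(1) s v(1) by (simp add: smult_assoc1)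
    then show False using v(2)[OF u(2)] by blast
  qed
  then show ?thesis using v(1) by blast
qed

end

section \<open>Endomorphisms of free modules and matrices\<close>

context module
begin

abbreviation End_ring ("\<E>") where "\<E> \<equiv> module_End R M"

lemma End_memI:
  assumes "f \<in> carrier M \<rightarrow>\<^sub>E carrier M"
    "\<And>x y. x \<in> carrier M \<Longrightarrow> y \<in> carrier M \<Longrightarrow> f (x \<oplus>\<^bsub>M\<^esub> y) = f x \<oplus>\<^bsub>M\<^esub> f y"
    "\<And>c x. c \<in> carrier R \<Longrightarrow> x \<in> carrier M \<Longrightarrow> f (c \<odot>\<^bsub>M\<^esub> x) = c \<odot>\<^bsub>M\<^esub> f x"
  shows "f \<in> carrier \<E>"
  using assms unfolding module_End_def by simp

lemma End_memD:
  assumes "f \<in> carrier \<E>"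
  shows "f \<in> carrier M \<rightarrow>\<^sub>E carrier M"
    "\<And>x. x \<in> carrier M \<Longrightarrow> f x \<in> carrier M"
    "\<And>x y. x \<in> carrier M \<Longrightarrow> y \<in> carrier M \<Longrightarrow> f (x \<oplus>\<^bsub>M\<^esub> y) = f x \<oplus>\<^bsub>M\<^esub> f y"
    "\<And>c x. c \<in> carrier R \<Longrightarrow> x \<in> carrier M \<Longrightarrow> f (c \<odot>\<^bsub>M\<^esub> x) = c \<odot>\<^bsub>M\<^esub> f x"
  using assms unfolding module_End_def by auto

lemma End_apply:
  assumes "x \<in> carrier M"
  shows "(f \<otimes>\<^bsub>\<E>\<^esub> g) x = f (g x)" "(f \<oplus>\<^bsub>\<E>\<^esub> g) x = f x \<oplus>\<^bsub>M\<^esub> g x" "\<one>\<^bsub>\<E>\<^esub> x = x" "\<zero>\<^bsub>\<E>\<^esub> x = \<zero>\<^bsub>M\<^esub>"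
  using assms unfolding module_End_def by (auto simp: compose_def)

lemma End_eqI:
  assumes "f \<in> carrier \<E>" "g \<in> carrier \<E>" "\<And>x. x \<in> carrier M \<Longrightarrow> f x = g x"
  shows "f = g"
  using PiE_ext[OF End_memD(1)[OF assms(1)] End_memD(1)[OF assms(2)]] assms(3) by blast

lemma End_closed:
  shows "f \<in> carrier \<E> \<Longrightarrow> g \<in> carrier \<E> \<Longrightarrow> f \<otimes>\<^bsub>\<E>\<^esub> g \<in> carrier \<E>"
    "f \<in> carrier \<E> \<Longrightarrow> g \<in> carrier \<E> \<Longrightarrow> f \<oplus>\<^bsub>\<E>\<^esub> g \<in> carrier \<E>"
    "\<one>\<^bsub>\<E>\<^esub> \<in> carrier \<E>" "\<zero>\<^bsub>\<E>\<^esub> \<in> carrier \<E>"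
    "f \<in> carrier \<E> \<Longrightarrow> (\<lambda>x\<in>carrier M. \<ominus>\<^bsub>M\<^esub> f x) \<in> carrier \<E>"
proof -
  assume f: "f \<in> carrier \<E>"
  show "(\<lambda>x\<in>carrier M. \<ominus>\<^bsub>M\<^esub> f x) \<in> carrier \<E>"
    by (rule End_memI) (use End_memD[OF f] in \<open>auto simp: M.minus_add M.a_comm smult_r_minus\<close>)
  assume g: "g \<in> carrier \<E>"
  show "f \<otimes>\<^bsub>\<E>\<^esub> g \<in> carrier \<E>"
    by (rule End_memI) (use End_memD[OF f] End_memD[OF g] in \<open>auto simp: module_End_def compose_def\<close>)
  show "f \<oplus>\<^bsub>\<E>\<^esub> g \<in> carrier \<E>"
    by (rule End_memI)
      (use End_memD[OF f] End_memD[OF g] in \<open>auto simp: module_End_def smult_r_distr M.a_ac\<close>)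
qed (auto simp: module_End_def)

lemma End_ring_is_ring: "ring \<E>"
proof (rule ringI)
  show "abelian_group \<E>"
  proof (rule abelian_groupI)
    fix f g h assume f: "f \<in> carrier \<E>" and g: "g \<in> carrier \<E>" and h: "h \<in> carrier \<E>"
    show "f \<oplus>\<^bsub>\<E>\<^esub> g \<oplus>\<^bsub>\<E>\<^esub> h = f \<oplus>\<^bsub>\<E>\<^esub> (g \<oplus>\<^bsub>\<E>\<^esub> h)"
      by (rule End_eqI) (use f g h End_memD(2) in \<open>auto simp: End_closed End_apply M.a_assoc\<close>)
  next
    fix f g assume f: "f \<in> carrier \<E>" and g: "g \<in> carrier \<E>"
    show "f \<oplus>\<^bsub>\<E>\<^esub> g = g \<oplus>\<^bsub>\<E>\<^esub> f"
      by (rule End_eqI) (use f g End_memD(2) in \<open>auto simp: End_closed End_apply M.a_comm\<close>)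
  next
    fix f assume f: "f \<in> carrier \<E>"
    show "\<zero>\<^bsub>\<E>\<^esub> \<oplus>\<^bsub>\<E>\<^esub> f = f"
      by (rule End_eqI) (use f End_memD(2) in \<open>auto simp: End_closed End_apply\<close>)
    show "\<exists>g\<in>carrier \<E>. g \<oplus>\<^bsub>\<E>\<^esub> f = \<zero>\<^bsub>\<E>\<^esub>"
    proof
      show "(\<lambda>x\<in>carrier M. \<ominus>\<^bsub>M\<^esub> f x) \<oplus>\<^bsub>\<E>\<^esub> f = \<zero>\<^bsub>\<E>\<^esub>"
        by (rule End_eqI) (use f End_memD(2) in \<open>auto simp: End_closed End_apply M.l_neg\<close>)
    qed (use f End_closed in blast)
  qed (auto simp: End_closed)
  show "monoid \<E>"
  proof (rule monoidI)
    fix f g h assume f: "f \<in> carrier \<E>" and g: "g \<in> carrier \<E>" and h: "h \<in> carrier \<E>"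
    show "f \<otimes>\<^bsub>\<E>\<^esub> g \<otimes>\<^bsub>\<E>\<^esub> h = f \<otimes>\<^bsub>\<E>\<^esub> (g \<otimes>\<^bsub>\<E>\<^esub> h)"
      by (rule End_eqI) (use f g h End_memD(2) in \<open>auto simp: End_closed End_apply\<close>)
  next
    fix f assume f: "f \<in> carrier \<E>"
    show "\<one>\<^bsub>\<E>\<^esub> \<otimes>\<^bsub>\<E>\<^esub> f = f" "f \<otimes>\<^bsub>\<E>\<^esub> \<one>\<^bsub>\<E>\<^esub> = f"
      by (rule End_eqI; use f End_memD(2) in \<open>auto simp: End_closed End_apply\<close>)+
  qed (auto simp: End_closed)
  fix f g h assume f: "f \<in> carrier \<E>" and g: "g \<in> carrier \<E>" and h: "h \<in> carrier \<E>"
  show "(f \<oplus>\<^bsub>\<E>\<^esub> g) \<otimes>\<^bsub>\<E>\<^esub> h = f \<otimes>\<^bsub>\<E>\<^esub> h \<oplus>\<^bsub>\<E>\<^esub> g \<otimes>\<^bsub>\<E>\<^esub> h"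
    by (rule End_eqI) (use f g h End_memD(2) in \<open>auto simp: End_closed End_apply\<close>)
  show "h \<otimes>\<^bsub>\<E>\<^esub> (f \<oplus>\<^bsub>\<E>\<^esub> g) = h \<otimes>\<^bsub>\<E>\<^esub> f \<oplus>\<^bsub>\<E>\<^esub> h \<otimes>\<^bsub>\<E>\<^esub> g"
    by (rule End_eqI) (use f g h End_memD(2,3) in \<open>auto simp: End_closed End_apply\<close>)
qed

lemma scalar_op_in_End: "c \<in> carrier R \<Longrightarrow> (\<lambda>x\<in>carrier M. c \<odot>\<^bsub>M\<^esub> x) \<in> carrier \<E>"
  by (rule End_memI) (auto simp: smult_r_distr smult_assoc1[symmetric] m_comm)

end

text \<open>
  Coordinates are functions on \<open>{..<m}\<close> extended by \<open>undefined\<close>, so that the basis property is a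
  bijection between coordinate functions and vectors.
\<close>

locale free_module = module +
  fixes m :: nat and w :: "nat \<Rightarrow> 'c"
  assumes basis_closed: "w \<in> {..<m} \<rightarrow> carrier M"
    and basis: "bij_betw (\<lambda>a. \<Oplus>\<^bsub>M\<^esub>j\<in>{..<m}. a j \<odot>\<^bsub>M\<^esub> w j) ({..<m} \<rightarrow>\<^sub>E carrier R) (carrier M)"
begin

definition comb :: "(nat \<Rightarrow> 'a) \<Rightarrow> 'c" where
  "comb a = (\<Oplus>\<^bsub>M\<^esub>j\<in>{..<m}. a j \<odot>\<^bsub>M\<^esub> w j)"

definition coord :: "'c \<Rightarrow> nat \<Rightarrow> 'a" where
  "coord = inv_into ({..<m} \<rightarrow>\<^sub>E carrier R) comb"

lemma comb_bij: "bij_betw comb ({..<m} \<rightarrow>\<^sub>E carrier R) (carrier M)"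
  using basis unfolding comb_def .

lemma w_closed: "j < m \<Longrightarrow> w j \<in> carrier M" using basis_closed by auto

lemma comb_closed: "a \<in> {..<m} \<rightarrow> carrier R \<Longrightarrow> comb a \<in> carrier M"
  unfolding comb_def by (rule M.finsum_closed) (use w_closed in auto)

lemma comb_cong: "(\<And>j. j < m \<Longrightarrow> a j = b j) \<Longrightarrow> b \<in> {..<m} \<rightarrow> carrier R \<Longrightarrow> comb a = comb b"
  unfolding comb_def by (rule M.finsum_cong') (use w_closed in auto)

lemma coord_mem: "x \<in> carrier M \<Longrightarrow> coord x \<in> {..<m} \<rightarrow>\<^sub>E carrier R"
  unfolding coord_def using comb_bij by (metis bij_betw_def inv_into_into)

lemma comb_coord: "x \<in> carrier M \<Longrightarrow> comb (coord x) = x"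
  unfolding coord_def using comb_bij by (metis bij_betw_inv_into_right)

lemma coord_comb:
  assumes "a \<in> {..<m} \<rightarrow> carrier R"
  shows "coord (comb a) = (\<lambda>j\<in>{..<m}. a j)"
proof -
  have "comb a = comb (\<lambda>j\<in>{..<m}. a j)" by (rule comb_cong) (use assms in auto)
  then show ?thesis using bij_betw_inv_into_left[OF comb_bij, of "\<lambda>j\<in>{..<m}. a j"] assms
    unfolding coord_def by auto
qed

lemma comb_add:
  assumes "a \<in> {..<m} \<rightarrow> carrier R" "b \<in> {..<m} \<rightarrow> carrier R"
  shows "comb (\<lambda>j. a j \<oplus> b j) = comb a \<oplus>\<^bsub>M\<^esub> comb b"
proof -
  have "comb (\<lambda>j. a j \<oplus> b j) = (\<Oplus>\<^bsub>M\<^esub>j\<in>{..<m}. a j \<odot>\<^bsub>M\<^esub> w j \<oplus>\<^bsub>M\<^esub> b j \<odot>\<^bsub>M\<^esub> w j)"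
    unfolding comb_def
    by (rule M.finsum_cong') (use assms w_closed in \<open>auto simp: smult_l_distr Pi_def\<close>)
  also have "\<dots> = comb a \<oplus>\<^bsub>M\<^esub> comb b"
    unfolding comb_def by (rule M.finsum_addf) (use assms w_closed in auto)
  finally show ?thesis .
qed

lemma comb_smult:
  assumes "a \<in> {..<m} \<rightarrow> carrier R" "c \<in> carrier R"
  shows "comb (\<lambda>j. c \<otimes> a j) = c \<odot>\<^bsub>M\<^esub> comb a"
proof -
  have "comb (\<lambda>j. c \<otimes> a j) = (\<Oplus>\<^bsub>M\<^esub>j\<in>{..<m}. c \<odot>\<^bsub>M\<^esub> (a j \<odot>\<^bsub>M\<^esub> w j))"
    unfolding comb_def
    by (rule M.finsum_cong') (use assms w_closed in \<open>auto simp: smult_assoc1 Pi_def\<close>)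
  also have "\<dots> = c \<odot>\<^bsub>M\<^esub> comb a"
    unfolding comb_def by (rule finsum_smult_ldistr[symmetric]) (use assms w_closed in auto)
  finally show ?thesis .
qed

lemma comb_zero: "comb (\<lambda>j. \<zero>) = \<zero>\<^bsub>M\<^esub>"
proof -
  have "comb (\<lambda>j. \<zero>) = (\<Oplus>\<^bsub>M\<^esub>j\<in>{..<m}. \<zero>\<^bsub>M\<^esub>)"
    unfolding comb_def by (rule M.finsum_cong') (use w_closed in auto)
  then show ?thesis by simp
qed

lemma comb_sum:
  assumes "finite A" "\<And>k. k \<in> A \<Longrightarrow> H k \<in> {..<m} \<rightarrow> carrier R"
  shows "comb (\<lambda>j. \<Oplus>k\<in>A. H k j) = (\<Oplus>\<^bsub>M\<^esub>k\<in>A. comb (H k))"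
  using assms
proof (induction A)
  case empty
  then show ?case by (simp add: comb_zero)
next
  case (insert k A)
  have 1: "comb (\<lambda>j. \<Oplus>k\<in>insert k A. H k j) = comb (\<lambda>j. H k j \<oplus> (\<Oplus>k\<in>A. H k j))"
  proof (rule comb_cong)
    show "(\<Oplus>k\<in>insert k A. H k j) = H k j \<oplus> (\<Oplus>k\<in>A. H k j)" if "j < m" for j
      by (rule R.finsum_insert) (use insert that in auto)
    show "(\<lambda>j. H k j \<oplus> (\<Oplus>k\<in>A. H k j)) \<in> {..<m} \<rightarrow> carrier R"
    proof
      fix j assume "j \<in> {..<m}"
      then have "(\<lambda>k. H k j) \<in> A \<rightarrow> carrier R" "H k j \<in> carrier R" using insert by auto
      then show "H k j \<oplus> (\<Oplus>k\<in>A. H k j) \<in> carrier R" using R.finsum_closed by simp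
    qed
  qed
  have 2: "comb (\<lambda>j. H k j \<oplus> (\<Oplus>k\<in>A. H k j)) = comb (H k) \<oplus>\<^bsub>M\<^esub> comb (\<lambda>j. \<Oplus>k\<in>A. H k j)"
  proof (rule comb_add)
    show "(\<lambda>j. \<Oplus>k\<in>A. H k j) \<in> {..<m} \<rightarrow> carrier R"
    proof
      fix j assume "j \<in> {..<m}"
      then have "(\<lambda>k. H k j) \<in> A \<rightarrow> carrier R" using insert by auto
      then show "(\<Oplus>k\<in>A. H k j) \<in> carrier R" using R.finsum_closed by simp
    qed
  qed (use insert in auto)
  have "(\<Oplus>\<^bsub>M\<^esub>k\<in>insert k A. comb (H k)) = comb (H k) \<oplus>\<^bsub>M\<^esub> (\<Oplus>\<^bsub>M\<^esub>k\<in>A. comb (H k))"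
    by (rule M.finsum_insert) (use insert comb_closed in auto)
  then show ?case using 1 2 insert by simp
qed

lemma comb_unit:
  assumes "j < m" "c \<in> carrier R"
  shows "comb (\<lambda>i. if i = j then c else \<zero>) = c \<odot>\<^bsub>M\<^esub> w j"
proof -
  have "comb (\<lambda>i. if i = j then c else \<zero>) = (\<Oplus>\<^bsub>M\<^esub>i\<in>{..<m}. if j = i then (c \<odot>\<^bsub>M\<^esub> w i) else \<zero>\<^bsub>M\<^esub>)"
    unfolding comb_def by (rule M.finsum_cong') (use assms w_closed in auto)
  also have "\<dots> = c \<odot>\<^bsub>M\<^esub> w j"
    by (rule M.finsum_singleton) (use assms w_closed in auto)
  finally show ?thesis .
qed

lemma End_comb:
  assumes f: "f \<in> carrier \<E>" and a: "a \<in> {..<m} \<rightarrow> carrier R"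
  shows "f (comb a) = (\<Oplus>\<^bsub>M\<^esub>j\<in>{..<m}. a j \<odot>\<^bsub>M\<^esub> f (w j))"
proof -
  have f0: "f \<zero>\<^bsub>M\<^esub> = \<zero>\<^bsub>M\<^esub>"
    using End_memD(3)[OF f M.zero_closed M.zero_closed] End_memD(2)[OF f M.zero_closed]
    by (metis M.add.l_cancel_one M.l_zero M.zero_closed)
  have "f (\<Oplus>\<^bsub>M\<^esub>j\<in>A. a j \<odot>\<^bsub>M\<^esub> w j) = (\<Oplus>\<^bsub>M\<^esub>j\<in>A. a j \<odot>\<^bsub>M\<^esub> f (w j))" if "A \<subseteq> {..<m}" for A
    using finite_subset[OF that finite_lessThan] that
  proof (induction A)
    case (insert j A)
    have c: "\<And>i. i \<in> insert j A \<Longrightarrow> a i \<in> carrier R \<and> w i \<in> carrier M"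
      using insert a w_closed by auto
    have 1: "(\<Oplus>\<^bsub>M\<^esub>j\<in>insert j A. a j \<odot>\<^bsub>M\<^esub> w j) = a j \<odot>\<^bsub>M\<^esub> w j \<oplus>\<^bsub>M\<^esub> (\<Oplus>\<^bsub>M\<^esub>j\<in>A. a j \<odot>\<^bsub>M\<^esub> w j)"
      by (rule M.finsum_insert) (use insert c in auto)
    have 2: "(\<Oplus>\<^bsub>M\<^esub>j\<in>insert j A. a j \<odot>\<^bsub>M\<^esub> f (w j))
        = a j \<odot>\<^bsub>M\<^esub> f (w j) \<oplus>\<^bsub>M\<^esub> (\<Oplus>\<^bsub>M\<^esub>j\<in>A. a j \<odot>\<^bsub>M\<^esub> f (w j))"
      by (rule M.finsum_insert) (use insert c End_memD(2)[OF f] in auto)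
    have 3: "(\<Oplus>\<^bsub>M\<^esub>j\<in>A. a j \<odot>\<^bsub>M\<^esub> w j) \<in> carrier M"
      by (rule M.finsum_closed) (use c in auto)
    show ?case unfolding 1 2 using insert c 3 End_memD(3,4)[OF f] by simp
  qed (simp add: f0)
  then show ?thesis unfolding comb_def by blast
qed

lemma ex_End_on_basis:
  assumes u: "u \<in> {..<m} \<rightarrow> carrier M"
  shows "\<exists>f\<in>carrier \<E>. \<forall>j<m. f (w j) = u j"
proof -
  define g where "g a = (\<Oplus>\<^bsub>M\<^esub>j\<in>{..<m}. a j \<odot>\<^bsub>M\<^esub> u j)" for a
  define f where "f = (\<lambda>x\<in>carrier M. g (coord x))"
  have uc: "j < m \<Longrightarrow> u j \<in> carrier M" for j using u by auto
  have cg: "g a \<in> carrier M" if "a \<in> {..<m} \<rightarrow> carrier R" for a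
    unfolding g_def by (rule M.finsum_closed) (use that uc in auto)
  have cmem: "x \<in> carrier M \<Longrightarrow> coord x \<in> {..<m} \<rightarrow> carrier R" for x using coord_mem by blast
  have f_comb: "f (comb a) = g a" if "a \<in> {..<m} \<rightarrow> carrier R" for a
  proof -
    have "f (comb a) = g (\<lambda>j\<in>{..<m}. a j)"
      unfolding f_def using comb_closed[OF that] coord_comb[OF that] by simp
    also have "\<dots> = g a"
      unfolding g_def by (rule M.finsum_cong') (use that uc in auto)
    finally show ?thesis .
  qed
  have "f \<in> carrier \<E>"
  proof (rule End_memI)
    show "f \<in> carrier M \<rightarrow>\<^sub>E carrier M" unfolding f_def using cg cmem by auto
  next
    fix x y assume xy: "x \<in> carrier M" "y \<in> carrier M"
    have ab: "coord x \<in> {..<m} \<rightarrow> carrier R" "coord y \<in> {..<m} \<rightarrow> carrier R" using cmem xy by auto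
    have "f (x \<oplus>\<^bsub>M\<^esub> y) = f (comb (\<lambda>j. coord x j \<oplus> coord y j))"
      unfolding comb_add[OF ab] comb_coord[OF xy(1)] comb_coord[OF xy(2)] ..
    also have "\<dots> = g (\<lambda>j. coord x j \<oplus> coord y j)"
      by (rule f_comb) (use ab in auto)    also have "\<dots> = (\<Oplus>\<^bsub>M\<^esub>j\<in>{..<m}. coord x j \<odot>\<^bsub>M\<^esub> u j \<oplus>\<^bsub>M\<^esub> coord y j \<odot>\<^bsub>M\<^esub> u j)"
      unfolding g_def by (rule M.finsum_cong') (use ab uc in \<open>auto simp: smult_l_distr Pi_def\<close>)
    also have "\<dots> = g (coord x) \<oplus>\<^bsub>M\<^esub> g (coord y)"
      unfolding g_def by (rule M.finsum_addf) (use ab uc in auto)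
    finally show "f (x \<oplus>\<^bsub>M\<^esub> y) = f x \<oplus>\<^bsub>M\<^esub> f y" unfolding f_def using xy by simp
  next
    fix c x assume c: "c \<in> carrier R" "x \<in> carrier M"
    have a: "coord x \<in> {..<m} \<rightarrow> carrier R" using cmem c by auto
    have "f (c \<odot>\<^bsub>M\<^esub> x) = f (comb (\<lambda>j. c \<otimes> coord x j))"
      unfolding comb_smult[OF a c(1)] comb_coord[OF c(2)] ..
    also have "\<dots> = g (\<lambda>j. c \<otimes> coord x j)"
      by (rule f_comb) (use a c in auto)
    also have "\<dots> = (\<Oplus>\<^bsub>M\<^esub>j\<in>{..<m}. c \<odot>\<^bsub>M\<^esub> (coord x j \<odot>\<^bsub>M\<^esub> u j))"
      unfolding g_def by (rule M.finsum_cong') (use a uc c in \<open>auto simp: smult_assoc1 Pi_def\<close>)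
    also have "\<dots> = c \<odot>\<^bsub>M\<^esub> g (coord x)"
      unfolding g_def by (rule finsum_smult_ldistr[symmetric]) (use a uc c in auto)
    finally show "f (c \<odot>\<^bsub>M\<^esub> x) = c \<odot>\<^bsub>M\<^esub> f x" unfolding f_def using c by simp
  qed
  moreover have "f (w j) = u j" if j: "j < m" for j
  proof -
    have "comb (\<lambda>i. if i = j then \<one> else \<zero>) = w j" using comb_unit[OF j, of \<one>] w_closed[OF j] by simp
    then have "f (w j) = f (comb (\<lambda>i. if i = j then \<one> else \<zero>))" by (rule arg_cong[OF sym])
    also have "\<dots> = g (\<lambda>i. if i = j then \<one> else \<zero>)" by (rule f_comb) auto
    also have "\<dots> = (\<Oplus>\<^bsub>M\<^esub>i\<in>{..<m}. if j = i then u i else \<zero>\<^bsub>M\<^esub>)"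
      unfolding g_def by (rule M.finsum_cong') (use uc in auto)
    also have "\<dots> = u j" by (rule M.finsum_singleton) (use uc j in auto)
    finally show ?thesis .
  qed
  ultimately show ?thesis by blast
qed

lemma End_eq_on_basis:
  assumes "f \<in> carrier \<E>" "g \<in> carrier \<E>" "\<And>j. j < m \<Longrightarrow> f (w j) = g (w j)"
  shows "f = g"
proof (rule End_eqI[OF assms(1,2)])
  fix x assume x: "x \<in> carrier M"
  have a: "coord x \<in> {..<m} \<rightarrow> carrier R" using coord_mem[OF x] by auto
  have "f (comb (coord x)) = g (comb (coord x))"
    unfolding End_comb[OF assms(1) a] End_comb[OF assms(2) a]
    by (rule M.finsum_cong') (use assms(3) a End_memD(2)[OF assms(2)] w_closed in auto)
  then show "f x = g x" using comb_coord[OF x] by simp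
qed

text \<open>
  Column \<open>j\<close> holds the coordinates of \<open>f (w j)\<close>.
\<close>

definition matrix_of :: "('c \<Rightarrow> 'c) \<Rightarrow> nat \<times> nat \<Rightarrow> 'a" where
  "matrix_of f = (\<lambda>(i, j)\<in>{..<m} \<times> {..<m}. coord (f (w j)) i)"

lemma matrix_of_mem: "f \<in> carrier \<E> \<Longrightarrow> matrix_of f \<in> {..<m} \<times> {..<m} \<rightarrow>\<^sub>E carrier R"
  unfolding matrix_of_def
proof (intro restrict_PiE_iff[THEN iffD2] ballI)
  fix z assume f: "f \<in> carrier \<E>" and "z \<in> {..<m} \<times> {..<m}"
  then obtain i j where z: "z = (i, j)" "i < m" "j < m" by auto
  have "coord (f (w j)) \<in> {..<m} \<rightarrow>\<^sub>E carrier R"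
    using coord_mem[OF End_memD(2)[OF f w_closed[OF z(3)]]] .
  then show "(case z of (i, j) \<Rightarrow> coord (f (w j)) i) \<in> carrier R" using z by auto
qed

lemma comb_matrix_of:
  assumes "f \<in> carrier \<E>" "j < m"
  shows "comb (\<lambda>i. matrix_of f (i, j)) = f (w j)"
proof -
  have c: "f (w j) \<in> carrier M" using assms End_memD(2) w_closed by blast
  have "comb (\<lambda>i. matrix_of f (i, j)) = comb (coord (f (w j)))"
  proof (rule comb_cong)
    show "coord (f (w j)) \<in> {..<m} \<rightarrow> carrier R" using coord_mem[OF c] by blast
  qed (simp add: matrix_of_def assms(2))
  then show ?thesis using comb_coord[OF c] by simp
qed

lemma matrix_of_eqI:
  assumes "f \<in> carrier \<E>" "P \<in> {..<m} \<times> {..<m} \<rightarrow>\<^sub>E carrier R"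
    and "\<And>j. j < m \<Longrightarrow> f (w j) = comb (\<lambda>i. P (i, j))"
  shows "matrix_of f = P"
proof (rule PiE_ext[OF matrix_of_mem[OF assms(1)] assms(2)])
  fix z assume "z \<in> {..<m} \<times> {..<m}"
  then obtain i j where z: "z = (i, j)" "i < m" "j < m" by auto
  have "(\<lambda>i. P (i, j)) \<in> {..<m} \<rightarrow> carrier R" using assms(2) z by auto
  then have "coord (f (w j)) = (\<lambda>i\<in>{..<m}. P (i, j))" unfolding assms(3)[OF z(3)] by (rule coord_comb)
  then show "matrix_of f z = P z" using z unfolding matrix_of_def by simp
qed

theorem matrix_of_iso: "matrix_of \<in> ring_iso \<E> (mat_ring m R)"
proof (rule ring_iso_memI)
  have mat_mem: "matrix_of f (i, j) \<in> carrier R" if "f \<in> carrier \<E>" "i < m" "j < m" for f i j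
    using matrix_of_mem[OF that(1)] that by auto
  show "matrix_of f \<in> carrier (mat_ring m R)" if "f \<in> carrier \<E>" for f
    using matrix_of_mem[OF that] by (simp add: mat_ring_def)
  show "matrix_of (f \<otimes>\<^bsub>\<E>\<^esub> g) = matrix_of f \<otimes>\<^bsub>mat_ring m R\<^esub> matrix_of g"
    if f: "f \<in> carrier \<E>" and g: "g \<in> carrier \<E>" for f g
  proof (rule matrix_of_eqI)
    show "f \<otimes>\<^bsub>\<E>\<^esub> g \<in> carrier \<E>" using f g End_closed by blast
    show "matrix_of f \<otimes>\<^bsub>mat_ring m R\<^esub> matrix_of g \<in> {..<m} \<times> {..<m} \<rightarrow>\<^sub>E carrier R"
      unfolding mat_ring_def by (auto intro!: R.finsum_closed mat_mem[OF f] mat_mem[OF g] m_closed)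
    fix j assume j: "j < m"
    have col: "(\<lambda>k. matrix_of g (k, j)) \<in> {..<m} \<rightarrow> carrier R" using mat_mem[OF g] j by auto
    have "(f \<otimes>\<^bsub>\<E>\<^esub> g) (w j) = f (comb (\<lambda>k. matrix_of g (k, j)))"
      using End_apply(1)[OF w_closed[OF j]] comb_matrix_of[OF g j] by simp
    also have "\<dots> = (\<Oplus>\<^bsub>M\<^esub>k\<in>{..<m}. matrix_of g (k, j) \<odot>\<^bsub>M\<^esub> f (w k))"
      by (rule End_comb[OF f col])
    also have "\<dots> = (\<Oplus>\<^bsub>M\<^esub>k\<in>{..<m}. comb (\<lambda>i. matrix_of f (i, k) \<otimes> matrix_of g (k, j)))"
    proof (rule M.finsum_cong')
      fix k assume "k \<in> {..<m}"
      then have k: "k < m" by simp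
      have "comb (\<lambda>i. matrix_of f (i, k) \<otimes> matrix_of g (k, j))
          = comb (\<lambda>i. matrix_of g (k, j) \<otimes> matrix_of f (i, k))"
        by (rule comb_cong) (use mat_mem[OF f] mat_mem[OF g] k j m_comm in auto)
      also have "\<dots> = matrix_of g (k, j) \<odot>\<^bsub>M\<^esub> comb (\<lambda>i. matrix_of f (i, k))"
        by (rule comb_smult) (use mat_mem[OF f] mat_mem[OF g] k j in auto)
      also have "\<dots> = matrix_of g (k, j) \<odot>\<^bsub>M\<^esub> f (w k)" using comb_matrix_of[OF f k] by simp
      finally show "matrix_of g (k, j) \<odot>\<^bsub>M\<^esub> f (w k)
          = comb (\<lambda>i. matrix_of f (i, k) \<otimes> matrix_of g (k, j))" by simp
    qed (auto intro!: comb_closed mat_mem[OF f] mat_mem[OF g] j)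
    also have "\<dots> = comb (\<lambda>i. \<Oplus>k\<in>{..<m}. matrix_of f (i, k) \<otimes> matrix_of g (k, j))"
      by (rule comb_sum[symmetric]) (auto intro!: mat_mem[OF f] mat_mem[OF g] j)
    also have "\<dots> = comb (\<lambda>i. (matrix_of f \<otimes>\<^bsub>mat_ring m R\<^esub> matrix_of g) (i, j))"
    proof (rule comb_cong)
      show "(\<lambda>i. (matrix_of f \<otimes>\<^bsub>mat_ring m R\<^esub> matrix_of g) (i, j)) \<in> {..<m} \<rightarrow> carrier R"
        unfolding mat_ring_def using j
        by (auto intro!: R.finsum_closed mat_mem[OF f] mat_mem[OF g] m_closed)
    qed (use j in \<open>simp add: mat_ring_def\<close>)
    finally show "(f \<otimes>\<^bsub>\<E>\<^esub> g) (w j) = comb (\<lambda>i. (matrix_of f \<otimes>\<^bsub>mat_ring m R\<^esub> matrix_of g) (i, j))" .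
  qed
  show "matrix_of (f \<oplus>\<^bsub>\<E>\<^esub> g) = matrix_of f \<oplus>\<^bsub>mat_ring m R\<^esub> matrix_of g"
    if f: "f \<in> carrier \<E>" and g: "g \<in> carrier \<E>" for f g
  proof (rule matrix_of_eqI)
    show "f \<oplus>\<^bsub>\<E>\<^esub> g \<in> carrier \<E>" using f g End_closed by blast
    show "matrix_of f \<oplus>\<^bsub>mat_ring m R\<^esub> matrix_of g \<in> {..<m} \<times> {..<m} \<rightarrow>\<^sub>E carrier R"
      unfolding mat_ring_def by (auto intro!: mat_mem[OF f] mat_mem[OF g])
    fix j assume j: "j < m"
    have "(f \<oplus>\<^bsub>\<E>\<^esub> g) (w j) = comb (\<lambda>i. matrix_of f (i, j)) \<oplus>\<^bsub>M\<^esub> comb (\<lambda>i. matrix_of g (i, j))"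
      using End_apply(2)[OF w_closed[OF j]] comb_matrix_of[OF _ j] f g by simp
    also have "\<dots> = comb (\<lambda>i. matrix_of f (i, j) \<oplus> matrix_of g (i, j))"
      by (rule comb_add[symmetric]) (auto intro!: mat_mem[OF f] mat_mem[OF g] j)
    also have "\<dots> = comb (\<lambda>i. (matrix_of f \<oplus>\<^bsub>mat_ring m R\<^esub> matrix_of g) (i, j))"
      by (rule comb_cong)
        (use j in \<open>auto intro!: mat_mem[OF f] mat_mem[OF g] simp: mat_ring_def\<close>)
    finally show "(f \<oplus>\<^bsub>\<E>\<^esub> g) (w j) = comb (\<lambda>i. (matrix_of f \<oplus>\<^bsub>mat_ring m R\<^esub> matrix_of g) (i, j))" .
  qed
  show "matrix_of \<one>\<^bsub>\<E>\<^esub> = \<one>\<^bsub>mat_ring m R\<^esub>"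
  proof (rule matrix_of_eqI)
    show "\<one>\<^bsub>mat_ring m R\<^esub> \<in> {..<m} \<times> {..<m} \<rightarrow>\<^sub>E carrier R" unfolding mat_ring_def by auto
    fix j assume j: "j < m"
    have "comb (\<lambda>i. \<one>\<^bsub>mat_ring m R\<^esub> (i, j)) = comb (\<lambda>i. if i = j then \<one> else \<zero>)"
      by (rule comb_cong) (use j in \<open>auto simp: mat_ring_def\<close>)
    then show "\<one>\<^bsub>\<E>\<^esub> (w j) = comb (\<lambda>i. \<one>\<^bsub>mat_ring m R\<^esub> (i, j))"
      using comb_unit[OF j, of \<one>] w_closed[OF j] End_apply(3) by simp
  qed (rule End_closed)
  show "bij_betw matrix_of (carrier \<E>) (carrier (mat_ring m R))"
  proof (rule bij_betw_imageI)
    show "inj_on matrix_of (carrier \<E>)"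
    proof (rule inj_onI)
      fix f g assume fg: "f \<in> carrier \<E>" "g \<in> carrier \<E>" "matrix_of f = matrix_of g"
      have "f (w j) = g (w j)" if "j < m" for j
        using comb_matrix_of[OF fg(1) that] comb_matrix_of[OF fg(2) that] unfolding fg(3) by simp
      then show "f = g" by (rule End_eq_on_basis[OF fg(1,2)])
    qed
    show "matrix_of ` carrier \<E> = carrier (mat_ring m R)"
    proof
      show "matrix_of ` carrier \<E> \<subseteq> carrier (mat_ring m R)"
        using matrix_of_mem by (auto simp: mat_ring_def)
      show "carrier (mat_ring m R) \<subseteq> matrix_of ` carrier \<E>"
      proof
        fix P assume "P \<in> carrier (mat_ring m R)"
        then have P: "P \<in> {..<m} \<times> {..<m} \<rightarrow>\<^sub>E carrier R" by (simp add: mat_ring_def)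
        have "(\<lambda>j. comb (\<lambda>i. P (i, j))) \<in> {..<m} \<rightarrow> carrier M"
        proof
          fix j assume "j \<in> {..<m}"
          then have "(\<lambda>i. P (i, j)) \<in> {..<m} \<rightarrow> carrier R" using P by auto
          then show "comb (\<lambda>i. P (i, j)) \<in> carrier M" by (rule comb_closed)
        qed
        from ex_End_on_basis[OF this]
        obtain f where f: "f \<in> carrier \<E>" "\<And>j. j < m \<Longrightarrow> f (w j) = comb (\<lambda>i. P (i, j))"
          by blast
        have "matrix_of f = P" by (rule matrix_of_eqI[OF f(1) P f(2)])
        then show "P \<in> matrix_of ` carrier \<E>" using f(1) by blast
      qed
    qed
  qed
qed

lemma matrix_of_scalar:
  assumes "c \<in> carrier R"
  shows "matrix_of (\<lambda>x\<in>carrier M. c \<odot>\<^bsub>M\<^esub> x) = scalar_mat m R c"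
proof (rule matrix_of_eqI[OF scalar_op_in_End[OF assms]])
  show "scalar_mat m R c \<in> {..<m} \<times> {..<m} \<rightarrow>\<^sub>E carrier R" using assms unfolding scalar_mat_def by auto
  fix j assume j: "j < m"
  have "comb (\<lambda>i. scalar_mat m R c (i, j)) = comb (\<lambda>i. if i = j then c else \<zero>)"
    by (rule comb_cong) (use j assms in \<open>auto simp: scalar_mat_def\<close>)
  then show "(\<lambda>x\<in>carrier M. c \<odot>\<^bsub>M\<^esub> x) (w j) = comb (\<lambda>i. scalar_mat m R c (i, j))"
    using comb_unit[OF j assms] w_closed[OF j] by simp
qed

text \<open>
  The projection to the line of \<open>w 0\<close> commutes with \<open>x\<close>, so \<open>x\<close> multiplies \<open>w 0\<close> by a scalar.  Any
  vector is the image of \<open>w 0\<close> under an endomorphism, which also commutes with \<open>x\<close>; so \<open>x\<close> multiplies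
  every vector by the same scalar.
\<close>

lemma centralizer_of_End:
  assumes m: "m > 0" and x: "x \<in> carrier \<E>"
    and comm: "\<And>f. f \<in> carrier \<E> \<Longrightarrow> x \<otimes>\<^bsub>\<E>\<^esub> f = f \<otimes>\<^bsub>\<E>\<^esub> x"
  shows "\<exists>c\<in>carrier R. \<forall>u\<in>carrier M. x u = c \<odot>\<^bsub>M\<^esub> u"
proof -
  have w0: "w 0 \<in> carrier M" by (rule w_closed[OF m])
  have commv: "x (f v) = f (x v)" if "f \<in> carrier \<E>" "v \<in> carrier M" for f v
    using fun_cong[OF comm[OF that(1)], of v] that(2) by (simp add: End_apply)
  have to_w0: "\<exists>f\<in>carrier \<E>. f (w 0) = u \<and> (\<forall>j<m. j \<noteq> 0 \<longrightarrow> f (w j) = \<zero>\<^bsub>M\<^esub>)" if u: "u \<in> carrier M" for u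
  proof -
    have "(\<lambda>j. if j = 0 then u else \<zero>\<^bsub>M\<^esub>) \<in> {..<m} \<rightarrow> carrier M" using u by auto
    from ex_End_on_basis[OF this] obtain f where "f \<in> carrier \<E>"
      "\<forall>j<m. f (w j) = (if j = 0 then u else \<zero>\<^bsub>M\<^esub>)" by blast
    then show ?thesis using m by (intro bexI[of _ f]) auto
  qed
  obtain e where e: "e \<in> carrier \<E>" "e (w 0) = w 0" "\<forall>j<m. j \<noteq> 0 \<longrightarrow> e (w j) = \<zero>\<^bsub>M\<^esub>"
    using to_w0[OF w0] by blast
  have xw: "x (w 0) \<in> carrier M" by (rule End_memD(2)[OF x w0])
  define a where "a = coord (x (w 0))"
  have a: "a \<in> {..<m} \<rightarrow> carrier R" unfolding a_def using coord_mem[OF xw] by blast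
  have ai: "a i \<in> carrier R" if "i < m" for i using a that by auto
  have "x (w 0) = e (x (w 0))" using commv[OF e(1) w0] e(2) by simp
  also have "\<dots> = e (comb a)" unfolding a_def comb_coord[OF xw] ..
  also have "\<dots> = (\<Oplus>\<^bsub>M\<^esub>j\<in>{..<m}. a j \<odot>\<^bsub>M\<^esub> e (w j))" by (rule End_comb[OF e(1) a])
  also have "\<dots> = (\<Oplus>\<^bsub>M\<^esub>j\<in>{..<m}. if 0 = j then a j \<odot>\<^bsub>M\<^esub> w 0 else \<zero>\<^bsub>M\<^esub>)"
    by (rule M.finsum_cong') (use ai e w0 in \<open>auto simp: smult_r_null\<close>)
  also have "\<dots> = a 0 \<odot>\<^bsub>M\<^esub> w 0" by (rule M.finsum_singleton) (use m a w0 in auto)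
  finally have x0: "x (w 0) = a 0 \<odot>\<^bsub>M\<^esub> w 0" .
  have a0: "a 0 \<in> carrier R" using a m by auto
  have "x u = a 0 \<odot>\<^bsub>M\<^esub> u" if u: "u \<in> carrier M" for u
  proof -
    obtain f where f: "f \<in> carrier \<E>" "f (w 0) = u" using to_w0[OF u] by blast
    have "x u = f (x (w 0))" using commv[OF f(1) w0] f(2) by simp
    then show ?thesis unfolding x0 End_memD(4)[OF f(1) a0 w0] f(2) .
  qed
  then show ?thesis using a0 by blast
qed

lemma card_End: "card (carrier \<E>) = card (carrier R) ^ (m * m)"
proof -
  have "bij_betw matrix_of (carrier \<E>) (carrier (mat_ring m R))"
    using matrix_of_iso unfolding ring_iso_def by blast
  then have "card (carrier \<E>) = card ({..<m} \<times> {..<m} \<rightarrow>\<^sub>E carrier R)"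
    using bij_betw_same_card by (simp add: mat_ring_def)
  then show ?thesis by (simp add: card_PiE card_cartesian_product)
qed

end

lemma keys_diff_subset:
  fixes a b :: "'z \<Rightarrow>\<^sub>0 'i :: cancel_comm_monoid_add"
  assumes "Poly_Mapping.keys a \<subseteq> U" "Poly_Mapping.keys b \<subseteq> U"
  shows "Poly_Mapping.keys (a - b) \<subseteq> U"
  using keys_diff[of a b] assms by blast

lemma (in abelian_group)
  assumes "x \<in> carrier G"
  shows int_mult_closed: "[(i::int)] \<cdot> x \<in> carrier G"
    and int_mult_add: "[(i + j :: int)] \<cdot> x = [i] \<cdot> x \<oplus> [j] \<cdot> x"
    and int_mult_0: "[(0::int)] \<cdot> x = \<zero>"
    and int_mult_1: "[(1::int)] \<cdot> x = x"
  using assms group.int_pow_closed[OF a_group, of x i] group.int_pow_mult[OF a_group, of x i j]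
    group.int_pow_1[OF a_group, of x] int_pow_0[of "add_monoid G" x]
  by (simp_all add: add_pow_def)

lemma (in abelian_group) add_minus_both:
  assumes "x \<in> carrier G" "y \<in> carrier G"
  shows "(x \<oplus> y) \<ominus> x \<ominus> y = \<zero>"
proof -
  have "(x \<oplus> y) \<ominus> x \<ominus> y = (y \<oplus> x) \<oplus> \<ominus> x \<oplus> \<ominus> y"
    using assms a_comm[of x y] by (simp add: a_minus_def)
  also have "\<dots> = y \<oplus> (x \<oplus> \<ominus> x) \<oplus> \<ominus> y" using assms by (simp only: a_assoc add.inv_closed)
  finally show ?thesis using assms by (simp add: r_neg)
qed

section \<open>Maps on tensor products\<close>

lemma tensor_rels_intros:
  "x \<in> carrier M \<Longrightarrow> x' \<in> carrier M \<Longrightarrow> y \<in> carrier N \<Longrightarrow>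
    frag_of (x \<oplus>\<^bsub>M\<^esub> x', y) - frag_of (x, y) - frag_of (x', y) \<in> tensor_rels K M N"
  "x \<in> carrier M \<Longrightarrow> y \<in> carrier N \<Longrightarrow> y' \<in> carrier N \<Longrightarrow>
    frag_of (x, y \<oplus>\<^bsub>N\<^esub> y') - frag_of (x, y) - frag_of (x, y') \<in> tensor_rels K M N"
  "c \<in> carrier K \<Longrightarrow> x \<in> carrier M \<Longrightarrow> y \<in> carrier N \<Longrightarrow>
    frag_of (c \<odot>\<^bsub>M\<^esub> x, y) - frag_of (x, c \<odot>\<^bsub>N\<^esub> y) \<in> tensor_rels K M N"
  unfolding tensor_rels_def Un_iff mem_Collect_eq by blast+

lemma tensor_rels_cases [consumes 1, case_names add_left add_right smult]:
  assumes "r \<in> tensor_rels K M N"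
  obtains x x' y where "x \<in> carrier M" "x' \<in> carrier M" "y \<in> carrier N"
      "r = frag_of (x \<oplus>\<^bsub>M\<^esub> x', y) - frag_of (x, y) - frag_of (x', y)"
    | x y y' where "x \<in> carrier M" "y \<in> carrier N" "y' \<in> carrier N"
      "r = frag_of (x, y \<oplus>\<^bsub>N\<^esub> y') - frag_of (x, y) - frag_of (x, y')"
    | c x y where "c \<in> carrier K" "x \<in> carrier M" "y \<in> carrier N"
      "r = frag_of (c \<odot>\<^bsub>M\<^esub> x, y) - frag_of (x, c \<odot>\<^bsub>N\<^esub> y)"
  using assms unfolding tensor_rels_def
  by (elim UnE CollectE exE conjE) (rule that; assumption)+

locale balanced_map = M: module K M + N: module K N + G: abelian_group G
  for K (structure) and M and N and G +
  fixes g
  assumes g_closed: "x \<in> carrier M \<Longrightarrow> y \<in> carrier N \<Longrightarrow> g x y \<in> carrier G"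
    and g_add_left: "x \<in> carrier M \<Longrightarrow> x' \<in> carrier M \<Longrightarrow> y \<in> carrier N \<Longrightarrow>
      g (x \<oplus>\<^bsub>M\<^esub> x') y = g x y \<oplus>\<^bsub>G\<^esub> g x' y"
    and g_add_right: "x \<in> carrier M \<Longrightarrow> y \<in> carrier N \<Longrightarrow> y' \<in> carrier N \<Longrightarrow>
      g x (y \<oplus>\<^bsub>N\<^esub> y') = g x y \<oplus>\<^bsub>G\<^esub> g x y'"
    and g_smult: "c \<in> carrier K \<Longrightarrow> x \<in> carrier M \<Longrightarrow> y \<in> carrier N \<Longrightarrow>
      g (c \<odot>\<^bsub>M\<^esub> x) y = g x (c \<odot>\<^bsub>N\<^esub> y)"
begin

abbreviation "FG \<equiv> free_Abelian_group (carrier M \<times> carrier N)"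
abbreviation "rels \<equiv> generate FG (tensor_rels K M N)"

text \<open>
  It vanishes on the tensor relations, and \<open>tensor_lift\<close> is the map that it induces on the quotient.
\<close>

definition ev where
  "ev c = (\<Oplus>\<^bsub>G\<^esub>z\<in>Poly_Mapping.keys c. [(Poly_Mapping.lookup c z :: int)] \<cdot>\<^bsub>G\<^esub> g (fst z) (snd z))"

lemma tensor_rels_carrier: "tensor_rels K M N \<subseteq> carrier FG"
proof
  fix r assume "r \<in> tensor_rels K M N"
  then show "r \<in> carrier FG" by (cases rule: tensor_rels_cases) (simp_all add: keys_diff_subset)
qed

lemma rels_subgroup: "subgroup rels FG"
  by (rule group.generate_is_subgroup[OF group_free_Abelian_group tensor_rels_carrier])

lemma rels_keys: "c \<in> rels \<Longrightarrow> Poly_Mapping.keys c \<subseteq> carrier M \<times> carrier N"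
  using subsetD[OF subgroup.subset[OF rels_subgroup], of c] by simp

lemma rels_zero: "0 \<in> rels" using subgroup.one_closed[OF rels_subgroup] by simp

lemma rels_add: "c \<in> rels \<Longrightarrow> d \<in> rels \<Longrightarrow> c + d \<in> rels"
  using subgroup.m_closed[OF rels_subgroup, of c d] by simp

lemma rels_uminus: "c \<in> rels \<Longrightarrow> - c \<in> rels"
  using subgroup.m_inv_closed[OF rels_subgroup, of c] inv_free_Abelian_group[OF rels_keys, of c] by simp

lemma rels_diff: "c \<in> rels \<Longrightarrow> d \<in> rels \<Longrightarrow> c - d \<in> rels"
  using rels_add[OF _ rels_uminus, of c d] by simp

lemma rels_sum: "(\<And>j. j \<in> A \<Longrightarrow> f j \<in> rels) \<Longrightarrow> sum f A \<in> rels"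
  by (induction A rule: infinite_finite_induct) (auto simp: rels_zero rels_add)

lemma rels_add_left: "x \<in> carrier M \<Longrightarrow> x' \<in> carrier M \<Longrightarrow> y \<in> carrier N \<Longrightarrow>
    frag_of (x \<oplus>\<^bsub>M\<^esub> x', y) - frag_of (x, y) - frag_of (x', y) \<in> rels"
  by (intro generate.incl tensor_rels_intros)

lemma rels_add_right: "x \<in> carrier M \<Longrightarrow> y \<in> carrier N \<Longrightarrow> y' \<in> carrier N \<Longrightarrow>
    frag_of (x, y \<oplus>\<^bsub>N\<^esub> y') - frag_of (x, y) - frag_of (x, y') \<in> rels"
  by (intro generate.incl tensor_rels_intros)

lemma rels_smult: "c \<in> carrier K \<Longrightarrow> x \<in> carrier M \<Longrightarrow> y \<in> carrier N \<Longrightarrow>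
    frag_of (c \<odot>\<^bsub>M\<^esub> x, y) - frag_of (x, c \<odot>\<^bsub>N\<^esub> y) \<in> rels"
  by (intro generate.incl tensor_rels_intros)

lemma rels_zero_left: assumes "y \<in> carrier N" shows "frag_of (\<zero>\<^bsub>M\<^esub>, y) \<in> rels"
proof -
  have "frag_of (\<zero>\<^bsub>M\<^esub> \<oplus>\<^bsub>M\<^esub> \<zero>\<^bsub>M\<^esub>, y) - frag_of (\<zero>\<^bsub>M\<^esub>, y) - frag_of (\<zero>\<^bsub>M\<^esub>, y) \<in> rels"
    by (rule rels_add_left[OF M.M.zero_closed M.M.zero_closed assms])
  then have "- frag_of (\<zero>\<^bsub>M\<^esub>, y) \<in> rels" by simp
  from rels_uminus[OF this] show ?thesis by simp
qed

lemma rels_zero_right: assumes "x \<in> carrier M" shows "frag_of (x, \<zero>\<^bsub>N\<^esub>) \<in> rels"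
proof -
  have "frag_of (x, \<zero>\<^bsub>N\<^esub> \<oplus>\<^bsub>N\<^esub> \<zero>\<^bsub>N\<^esub>) - frag_of (x, \<zero>\<^bsub>N\<^esub>) - frag_of (x, \<zero>\<^bsub>N\<^esub>) \<in> rels"
    by (rule rels_add_right[OF assms N.M.zero_closed N.M.zero_closed])
  then have "- frag_of (x, \<zero>\<^bsub>N\<^esub>) \<in> rels" by simp
  from rels_uminus[OF this] show ?thesis by simp
qed

lemma g_closed': "z \<in> carrier M \<times> carrier N \<Longrightarrow> g (fst z) (snd z) \<in> carrier G"
  using g_closed by auto

lemma term_closed: "z \<in> carrier M \<times> carrier N \<Longrightarrow> [(i::int)] \<cdot>\<^bsub>G\<^esub> g (fst z) (snd z) \<in> carrier G"
  using g_closed' G.int_mult_closed by blast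

text \<open>
  Additivity of \<open>ev\<close> needs both arguments to be summed over a common finite set.
\<close>

lemma ev_superset:
  assumes "finite A" "Poly_Mapping.keys c \<subseteq> A" "A \<subseteq> carrier M \<times> carrier N"
  shows "ev c = (\<Oplus>\<^bsub>G\<^esub>z\<in>A. [Poly_Mapping.lookup c z] \<cdot>\<^bsub>G\<^esub> g (fst z) (snd z))"
  unfolding ev_def
proof (rule G.add.finprod_mono_neutral_cong_left)
  fix z assume "z \<in> A - Poly_Mapping.keys c"
  then have "Poly_Mapping.lookup c z = 0" "z \<in> carrier M \<times> carrier N"
    using assms(3) by (auto simp: in_keys_iff)
  then show "[Poly_Mapping.lookup c z] \<cdot>\<^bsub>G\<^esub> g (fst z) (snd z) = \<zero>\<^bsub>G\<^esub>"
    using G.int_mult_0[OF g_closed'[of z]] by metis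
qed (use assms term_closed in auto)

lemma ev_closed: "Poly_Mapping.keys c \<subseteq> carrier M \<times> carrier N \<Longrightarrow> ev c \<in> carrier G"
  unfolding ev_def by (rule G.finsum_closed) (use term_closed in blast)

lemma ev_add:
  assumes c: "Poly_Mapping.keys c \<subseteq> carrier M \<times> carrier N"
    and d: "Poly_Mapping.keys d \<subseteq> carrier M \<times> carrier N"
  shows "ev (c + d) = ev c \<oplus>\<^bsub>G\<^esub> ev d"
proof -
  define A where "A = Poly_Mapping.keys c \<union> Poly_Mapping.keys d"
  have A: "finite A" "A \<subseteq> carrier M \<times> carrier N" "Poly_Mapping.keys (c + d) \<subseteq> A"
    using c d keys_add[of c d] unfolding A_def by auto
  have "ev (c + d) = (\<Oplus>\<^bsub>G\<^esub>z\<in>A. [Poly_Mapping.lookup (c + d) z] \<cdot>\<^bsub>G\<^esub> g (fst z) (snd z))"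
    by (rule ev_superset[OF A(1,3,2)])
  also have "\<dots> = (\<Oplus>\<^bsub>G\<^esub>z\<in>A. [Poly_Mapping.lookup c z] \<cdot>\<^bsub>G\<^esub> g (fst z) (snd z) \<oplus>\<^bsub>G\<^esub>
      [Poly_Mapping.lookup d z] \<cdot>\<^bsub>G\<^esub> g (fst z) (snd z))"
  proof (rule G.finsum_cong'[OF refl])
    fix z assume "z \<in> A"
    then have "g (fst z) (snd z) \<in> carrier G" using A(2) g_closed' by blast
    then show "[Poly_Mapping.lookup (c + d) z] \<cdot>\<^bsub>G\<^esub> g (fst z) (snd z) =
        [Poly_Mapping.lookup c z] \<cdot>\<^bsub>G\<^esub> g (fst z) (snd z) \<oplus>\<^bsub>G\<^esub>
        [Poly_Mapping.lookup d z] \<cdot>\<^bsub>G\<^esub> g (fst z) (snd z)"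
      unfolding lookup_add by (rule G.int_mult_add)
  qed (use A(2) term_closed in auto)
  also have "\<dots> = ev c \<oplus>\<^bsub>G\<^esub> ev d"
    unfolding ev_superset[OF A(1) Un_upper1[of "Poly_Mapping.keys c" "Poly_Mapping.keys d", folded A_def] A(2)]
      ev_superset[OF A(1) Un_upper2[of "Poly_Mapping.keys d" "Poly_Mapping.keys c", folded A_def] A(2)]
    by (rule G.finsum_addf) (use A(2) term_closed in blast)+
  finally show ?thesis .
qed

lemma ev_frag_of:
  assumes "x \<in> carrier M" "y \<in> carrier N"
  shows "ev (frag_of (x, y)) = g x y"
  using g_closed[OF assms] unfolding ev_def
  by (simp add: G.finsum_insert G.int_mult_1)

lemma ev_hom: "ev \<in> hom FG (add_monoid G)"
  by (rule homI) (simp_all add: ev_closed ev_add)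

lemma ev_diff:
  assumes c: "Poly_Mapping.keys c \<subseteq> carrier M \<times> carrier N"
    and d: "Poly_Mapping.keys d \<subseteq> carrier M \<times> carrier N"
  shows "ev (c - d) = ev c \<ominus>\<^bsub>G\<^esub> ev d"
proof -
  have cd: "Poly_Mapping.keys (c - d) \<subseteq> carrier M \<times> carrier N" by (rule keys_diff_subset[OF c d])
  have "ev c = ev (c - d) \<oplus>\<^bsub>G\<^esub> ev d" using ev_add[OF cd d] by simp
  then show ?thesis using ev_closed[OF c] ev_closed[OF d] ev_closed[OF cd]
    by (simp add: a_minus_def G.a_assoc G.r_neg)
qed

lemma ev_rels:
  assumes "c \<in> rels" shows "ev c = \<zero>\<^bsub>G\<^esub>"
proof -
  interpret group_hom FG "add_monoid G" ev
    using ev_hom G.add.is_group by (intro group_hom.intro group_hom_axioms.intro) auto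
  have fr: "Poly_Mapping.keys (frag_of (x, y)) \<subseteq> carrier M \<times> carrier N"
    if "x \<in> carrier M" "y \<in> carrier N" for x y using that by simp
  have "tensor_rels K M N \<subseteq> kernel FG (add_monoid G) ev"
  proof
    fix r assume r: "r \<in> tensor_rels K M N"
    then have "ev r = \<zero>\<^bsub>G\<^esub>"
    proof (cases rule: tensor_rels_cases)
      case (add_left x x' y)
      then show ?thesis
        by (simp add: ev_diff keys_diff_subset ev_frag_of g_closed g_add_left G.add_minus_both)
    next
      case (add_right x y y')
      then show ?thesis
        by (simp add: ev_diff keys_diff_subset ev_frag_of g_closed g_add_right G.add_minus_both)
    next
      case (smult c x y)
      then show ?thesis
        by (simp add: ev_diff ev_frag_of g_closed g_smult a_minus_def G.r_neg)
    qed
    then show "r \<in> kernel FG (add_monoid G) ev"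
      using subsetD[OF tensor_rels_carrier r] unfolding kernel_def by simp
  qed
  then have "rels \<subseteq> kernel FG (add_monoid G) ev"
    by (rule G.generate_subgroup_incl[OF _ subgroup_kernel])
  then show ?thesis using assms unfolding kernel_def by auto
qed

lemma tensor_product_carrier:
  "carrier (tensor_product K M N) = (\<lambda>c. rels #>\<^bsub>FG\<^esub> c) ` carrier FG"
  unfolding tensor_product_def FactGroup_def RCOSETS_def by auto

lemma rcoset_mem: "d \<in> rels #>\<^bsub>FG\<^esub> c \<longleftrightarrow> d - c \<in> rels"
  unfolding r_coset_def by (auto intro: bexI[of _ "d - c"])

lemma tensor_lift_rcoset:
  assumes c: "c \<in> carrier FG"
  shows "tensor_lift G g (rels #>\<^bsub>FG\<^esub> c) = ev c"
proof -
  have "ev d = ev c" if "d \<in> rels #>\<^bsub>FG\<^esub> c" for d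
  proof -
    have r: "d - c \<in> rels" using that rcoset_mem by blast
    have ck: "Poly_Mapping.keys c \<subseteq> carrier M \<times> carrier N" using c by simp
    have "ev d = ev ((d - c) + c)" by simp
    also have "\<dots> = ev (d - c) \<oplus>\<^bsub>G\<^esub> ev c" by (rule ev_add[OF rels_keys[OF r] ck])
    also have "\<dots> = ev c" using ev_rels[OF r] ev_closed[OF ck] by simp
    finally show ?thesis .
  qed
  moreover have "c \<in> rels #>\<^bsub>FG\<^esub> c" using rcoset_mem rels_zero by simp
  ultimately have "ev ` (rels #>\<^bsub>FG\<^esub> c) = {ev c}" by blast
  then show ?thesis unfolding tensor_lift_def ev_def by simp
qed

lemma frag_of_finsum_left:
  assumes "finite A" "x \<in> A \<rightarrow> carrier M" "y \<in> carrier N"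
  shows "frag_of (\<Oplus>\<^bsub>M\<^esub>j\<in>A. x j, y) - (\<Sum>j\<in>A. frag_of (x j, y)) \<in> rels"
  using assms(1,2)
proof (induction A)
  case empty
  then show ?case using rels_zero_left[OF assms(3)] by simp
next
  case (insert k A)
  then have c: "x k \<in> carrier M" "(\<Oplus>\<^bsub>M\<^esub>j\<in>A. x j) \<in> carrier M" by auto
  have "(\<Oplus>\<^bsub>M\<^esub>j\<in>insert k A. x j) = x k \<oplus>\<^bsub>M\<^esub> (\<Oplus>\<^bsub>M\<^esub>j\<in>A. x j)"
    by (rule M.M.finsum_insert) (use insert in auto)
  then have "frag_of (\<Oplus>\<^bsub>M\<^esub>j\<in>insert k A. x j, y) - (\<Sum>j\<in>insert k A. frag_of (x j, y)) =
      (frag_of (x k \<oplus>\<^bsub>M\<^esub> (\<Oplus>\<^bsub>M\<^esub>j\<in>A. x j), y) - frag_of (x k, y) - frag_of (\<Oplus>\<^bsub>M\<^esub>j\<in>A. x j, y)) +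
      (frag_of (\<Oplus>\<^bsub>M\<^esub>j\<in>A. x j, y) - (\<Sum>j\<in>A. frag_of (x j, y)))"
    using insert by (simp add: algebra_simps)
  moreover have "frag_of (\<Oplus>\<^bsub>M\<^esub>j\<in>A. x j, y) - (\<Sum>j\<in>A. frag_of (x j, y)) \<in> rels"
    using insert by auto
  ultimately show ?case using rels_add[OF rels_add_left[OF c assms(3)]] by metis
qed

text \<open>
  Modulo the relations, \<open>x \<otimes> y\<close> with \<open>x = \<Sum>j. a j * b j\<close> is the sum of the \<open>b j \<otimes> (a j * y)\<close>, and
  terms with the same \<open>b j\<close> can be collected.
\<close>

lemma tensor_normal_form:
  fixes b and m :: nat
  assumes b: "b \<in> {..<m} \<rightarrow> carrier M"
    and span: "\<And>x. x \<in> carrier M \<Longrightarrow> \<exists>a\<in>{..<m} \<rightarrow> carrier K. x = (\<Oplus>\<^bsub>M\<^esub>j\<in>{..<m}. a j \<odot>\<^bsub>M\<^esub> b j)"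
    and c: "c \<in> carrier FG"
  shows "\<exists>s\<in>{..<m} \<rightarrow> carrier N. c - (\<Sum>j<m. frag_of (b j, s j)) \<in> rels"
proof -
  have bc: "b j \<in> carrier M" if "j < m" for j using b that by auto
  from c have "Poly_Mapping.keys c \<subseteq> carrier M \<times> carrier N" by simp
  then show ?thesis
  proof (induction c rule: free_Abelian_group_induct[consumes 1, case_names zero diff gen])
    case zero
    have "(\<Sum>j<m. frag_of (b j, \<zero>\<^bsub>N\<^esub>)) \<in> rels" by (rule rels_sum) (use bc rels_zero_right in auto)
    then show ?case using rels_uminus by (intro bexI[of _ "\<lambda>j. \<zero>\<^bsub>N\<^esub>"]) auto
  next
    case (diff x y)
    then obtain s u where s: "s \<in> {..<m} \<rightarrow> carrier N" "x - (\<Sum>j<m. frag_of (b j, s j)) \<in> rels"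
      and u: "u \<in> {..<m} \<rightarrow> carrier N" "y - (\<Sum>j<m. frag_of (b j, u j)) \<in> rels" by blast
    define v where "v j = s j \<ominus>\<^bsub>N\<^esub> u j" for j
    have "(\<Sum>j<m. frag_of (b j, s j) - frag_of (b j, v j) - frag_of (b j, u j)) \<in> rels"
    proof (rule rels_sum)
      fix j assume "j \<in> {..<m}"
      then have j: "b j \<in> carrier M" "s j \<in> carrier N" "u j \<in> carrier N" using bc s u by auto
      have "v j \<oplus>\<^bsub>N\<^esub> u j = s j" unfolding v_def a_minus_def using j by (simp add: N.M.a_assoc N.M.l_neg)
      then show "frag_of (b j, s j) - frag_of (b j, v j) - frag_of (b j, u j) \<in> rels"
        using rels_add_right[OF j(1), of "v j" "u j"] j unfolding v_def by auto
    qed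
    then have "(x - (\<Sum>j<m. frag_of (b j, s j))) - (y - (\<Sum>j<m. frag_of (b j, u j)))
        + (\<Sum>j<m. frag_of (b j, s j) - frag_of (b j, v j) - frag_of (b j, u j)) \<in> rels"
      by (intro rels_add rels_diff s(2) u(2))
    then have "(x - y) - (\<Sum>j<m. frag_of (b j, v j)) \<in> rels"
      by (simp add: sum_subtractf sum.distrib algebra_simps)
    moreover have "v \<in> {..<m} \<rightarrow> carrier N" unfolding v_def using s u by auto
    ultimately show ?case by (intro bexI[of _ v])
  next
    case (gen z)
    then obtain x y where z: "z = (x, y)" "x \<in> carrier M" "y \<in> carrier N" by auto
    obtain a where a: "a \<in> {..<m} \<rightarrow> carrier K" "x = (\<Oplus>\<^bsub>M\<^esub>j\<in>{..<m}. a j \<odot>\<^bsub>M\<^esub> b j)"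
      using span[OF z(2)] by blast
    have "frag_of (x, y) - (\<Sum>j<m. frag_of (a j \<odot>\<^bsub>M\<^esub> b j, y)) \<in> rels"
      unfolding a(2) by (rule frag_of_finsum_left) (use a(1) bc z in auto)
    moreover have "(\<Sum>j<m. frag_of (a j \<odot>\<^bsub>M\<^esub> b j, y) - frag_of (b j, a j \<odot>\<^bsub>N\<^esub> y)) \<in> rels"
      by (rule rels_sum, rule rels_smult) (use a(1) bc z in auto)
    ultimately have "(frag_of (x, y) - (\<Sum>j<m. frag_of (a j \<odot>\<^bsub>M\<^esub> b j, y))) +
      (\<Sum>j<m. frag_of (a j \<odot>\<^bsub>M\<^esub> b j, y) - frag_of (b j, a j \<odot>\<^bsub>N\<^esub> y)) \<in> rels"
      by (rule rels_add)
    then have "frag_of (x, y) - (\<Sum>j<m. frag_of (b j, a j \<odot>\<^bsub>N\<^esub> y)) \<in> rels"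
      by (simp add: sum_subtractf)
    moreover have "(\<lambda>j. a j \<odot>\<^bsub>N\<^esub> y) \<in> {..<m} \<rightarrow> carrier N" using a(1) z by auto
    ultimately show ?case unfolding z(1) by (intro bexI[of _ "\<lambda>j. a j \<odot>\<^bsub>N\<^esub> y"])
  qed
qed

lemma ev_sum:
  assumes "finite A" "x \<in> A \<rightarrow> carrier M" "s \<in> A \<rightarrow> carrier N"
  shows "(\<Sum>j\<in>A. frag_of (x j, s j)) \<in> carrier FG"
    "ev (\<Sum>j\<in>A. frag_of (x j, s j)) = (\<Oplus>\<^bsub>G\<^esub>j\<in>A. g (x j) (s j))"
proof -
  have "(\<Sum>j\<in>A. frag_of (x j, s j)) \<in> carrier FG \<and>
    ev (\<Sum>j\<in>A. frag_of (x j, s j)) = (\<Oplus>\<^bsub>G\<^esub>j\<in>A. g (x j) (s j))"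
    using assms
  proof (induction A)
    case empty
    then show ?case by (simp add: ev_def)
  next
    case (insert k A)
    then have c: "x k \<in> carrier M" "s k \<in> carrier N" by auto
    have IH: "(\<Sum>j\<in>A. frag_of (x j, s j)) \<in> carrier FG"
      "ev (\<Sum>j\<in>A. frag_of (x j, s j)) = (\<Oplus>\<^bsub>G\<^esub>j\<in>A. g (x j) (s j))" using insert by auto
    have fk: "Poly_Mapping.keys (frag_of (x k, s k)) \<subseteq> carrier M \<times> carrier N" using c by simp
    have "(\<Oplus>\<^bsub>G\<^esub>j\<in>insert k A. g (x j) (s j)) = g (x k) (s k) \<oplus>\<^bsub>G\<^esub> (\<Oplus>\<^bsub>G\<^esub>j\<in>A. g (x j) (s j))"
      by (rule G.finsum_insert) (use insert g_closed in \<open>auto simp: Pi_def\<close>)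
    moreover have "ev (frag_of (x k, s k) + (\<Sum>j\<in>A. frag_of (x j, s j))) =
        g (x k) (s k) \<oplus>\<^bsub>G\<^esub> (\<Oplus>\<^bsub>G\<^esub>j\<in>A. g (x j) (s j))"
      using ev_add[OF fk] IH ev_frag_of[OF c] by simp
    moreover have "frag_of (x k, s k) + (\<Sum>j\<in>A. frag_of (x j, s j)) \<in> carrier FG"
      using IH(1) fk keys_add[of "frag_of (x k, s k)" "\<Sum>j\<in>A. frag_of (x j, s j)"] by auto
    ultimately show ?case using insert(1,2) by simp
  qed
  then show "(\<Sum>j\<in>A. frag_of (x j, s j)) \<in> carrier FG"
    "ev (\<Sum>j\<in>A. frag_of (x j, s j)) = (\<Oplus>\<^bsub>G\<^esub>j\<in>A. g (x j) (s j))" by auto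
qed

text \<open>
  An element in the kernel has a normal form \<open>\<Sum>j. b j \<otimes> s j\<close> whose image vanishes, so all \<open>s j\<close> are
  zero by independence.
\<close>

theorem tensor_lift_bij:
  fixes b and m :: nat
  assumes b: "b \<in> {..<m} \<rightarrow> carrier M"
    and span: "\<And>x. x \<in> carrier M \<Longrightarrow> \<exists>a\<in>{..<m} \<rightarrow> carrier K. x = (\<Oplus>\<^bsub>M\<^esub>j\<in>{..<m}. a j \<odot>\<^bsub>M\<^esub> b j)"
    and indep: "\<And>s. s \<in> {..<m} \<rightarrow> carrier N \<Longrightarrow> (\<Oplus>\<^bsub>G\<^esub>j\<in>{..<m}. g (b j) (s j)) = \<zero>\<^bsub>G\<^esub> \<Longrightarrow>
      \<forall>j<m. s j = \<zero>\<^bsub>N\<^esub>"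
  shows "bij_betw (tensor_lift G g) (carrier (tensor_product K M N))
    ((\<lambda>s. \<Oplus>\<^bsub>G\<^esub>j\<in>{..<m}. g (b j) (s j)) ` ({..<m} \<rightarrow> carrier N))"
proof (rule bij_betw_imageI)
  have norm: "\<exists>s\<in>{..<m} \<rightarrow> carrier N. c - (\<Sum>j<m. frag_of (b j, s j)) \<in> rels \<and>
      ev c = (\<Oplus>\<^bsub>G\<^esub>j\<in>{..<m}. g (b j) (s j))" if c: "c \<in> carrier FG" for c
  proof -
    obtain s where s: "s \<in> {..<m} \<rightarrow> carrier N" "c - (\<Sum>j<m. frag_of (b j, s j)) \<in> rels"
      using tensor_normal_form[OF b span c] by blast
    note es = ev_sum[OF finite_lessThan b s(1)]
    have sk: "Poly_Mapping.keys (\<Sum>j<m. frag_of (b j, s j)) \<subseteq> carrier M \<times> carrier N"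
      using es(1) by simp
    have "ev c = ev ((c - (\<Sum>j<m. frag_of (b j, s j))) + (\<Sum>j<m. frag_of (b j, s j)))" by simp
    also have "\<dots> = ev (c - (\<Sum>j<m. frag_of (b j, s j))) \<oplus>\<^bsub>G\<^esub> ev (\<Sum>j<m. frag_of (b j, s j))"
      by (rule ev_add[OF rels_keys[OF s(2)] sk])
    also have "\<dots> = ev (\<Sum>j<m. frag_of (b j, s j))"
      using ev_rels[OF s(2)] ev_closed[OF sk] by simp
    finally show ?thesis using s es(2) by auto
  qed
  have ker: "c \<in> rels" if c: "c \<in> carrier FG" and "ev c = \<zero>\<^bsub>G\<^esub>" for c
  proof -
    obtain s where s: "s \<in> {..<m} \<rightarrow> carrier N" "c - (\<Sum>j<m. frag_of (b j, s j)) \<in> rels"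
      "ev c = (\<Oplus>\<^bsub>G\<^esub>j\<in>{..<m}. g (b j) (s j))"
      using norm[OF c] by blast
    have "(\<Oplus>\<^bsub>G\<^esub>j\<in>{..<m}. g (b j) (s j)) = \<zero>\<^bsub>G\<^esub>" using that(2) unfolding s(3) .
    from indep[OF s(1) this] have "(\<Sum>j<m. frag_of (b j, s j)) \<in> rels"
      using rels_zero_right b by (intro rels_sum) auto
    from rels_add[OF s(2) this] show ?thesis by simp
  qed
  show "inj_on (tensor_lift G g) (carrier (tensor_product K M N))"
  proof (rule inj_onI)
    fix C D assume "C \<in> carrier (tensor_product K M N)" "D \<in> carrier (tensor_product K M N)"
      and eq: "tensor_lift G g C = tensor_lift G g D"
    then obtain c d where c: "c \<in> carrier FG" "C = rels #>\<^bsub>FG\<^esub> c"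
      and d: "d \<in> carrier FG" "D = rels #>\<^bsub>FG\<^esub> d" unfolding tensor_product_carrier by blast
    have ck: "Poly_Mapping.keys c \<subseteq> carrier M \<times> carrier N" "Poly_Mapping.keys d \<subseteq> carrier M \<times> carrier N"
      using c d by auto
    have "ev c = ev d" using eq c d tensor_lift_rcoset by simp
    then have "ev (c - d) = \<zero>\<^bsub>G\<^esub>"
      using ev_diff[OF ck] ev_closed[OF ck(2)] by (simp add: a_minus_def G.r_neg)
    then have "c - d \<in> rels" using ker keys_diff_subset[OF ck] by simp
    then have "e - c \<in> rels \<longleftrightarrow> e - d \<in> rels" for e
      using rels_add[of "e - c" "c - d"] rels_diff[of "e - d" "c - d"] by auto
    then show "C = D" unfolding c(2) d(2) set_eq_iff rcoset_mem by blast
  qed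
  show "tensor_lift G g ` carrier (tensor_product K M N) =
    (\<lambda>s. \<Oplus>\<^bsub>G\<^esub>j\<in>{..<m}. g (b j) (s j)) ` ({..<m} \<rightarrow> carrier N)"
  proof
    show "tensor_lift G g ` carrier (tensor_product K M N) \<subseteq>
      (\<lambda>s. \<Oplus>\<^bsub>G\<^esub>j\<in>{..<m}. g (b j) (s j)) ` ({..<m} \<rightarrow> carrier N)"
    proof
      fix e assume "e \<in> tensor_lift G g ` carrier (tensor_product K M N)"
      then obtain c where c: "c \<in> carrier FG" "e = tensor_lift G g (rels #>\<^bsub>FG\<^esub> c)"
        unfolding tensor_product_carrier by blast
      obtain s where "s \<in> {..<m} \<rightarrow> carrier N" "ev c = (\<Oplus>\<^bsub>G\<^esub>j\<in>{..<m}. g (b j) (s j))"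
        using norm[OF c(1)] by blast
      then show "e \<in> (\<lambda>s. \<Oplus>\<^bsub>G\<^esub>j\<in>{..<m}. g (b j) (s j)) ` ({..<m} \<rightarrow> carrier N)"
        unfolding c(2) tensor_lift_rcoset[OF c(1)] by (intro image_eqI[of _ _ s])
    qed
    show "(\<lambda>s. \<Oplus>\<^bsub>G\<^esub>j\<in>{..<m}. g (b j) (s j)) ` ({..<m} \<rightarrow> carrier N) \<subseteq>
      tensor_lift G g ` carrier (tensor_product K M N)"
    proof clarify
      fix s assume s: "s \<in> {..<m} \<rightarrow> carrier N"
      note es = ev_sum[OF finite_lessThan b s]
      show "(\<Oplus>\<^bsub>G\<^esub>j\<in>{..<m}. g (b j) (s j)) \<in> tensor_lift G g ` carrier (tensor_product K M N)"
        unfolding tensor_product_carrier es(2)[symmetric] tensor_lift_rcoset[OF es(1), symmetric]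
        by (intro imageI es(1))
    qed
  qed
qed

end

section \<open>The Frobenius map of the algebraic closure\<close>

lemma card_gt_1: "CARD('k :: {finite, field}) > 1"
proof -
  have "card {0, 1 :: 'k} \<le> CARD('k)" by (rule card_mono) auto
  then show ?thesis by simp
qed

lemma finite_field_power_card:
  fixes c :: "'k :: {finite, field}"
  shows "c ^ CARD('k) = c"
proof (cases "c = 0")
  case False
  have "(\<Prod>y\<in>UNIV - {0}. c * y) = (\<Prod>y\<in>UNIV - {0}. y)"
    by (rule prod.reindex_bij_witness[of _ "\<lambda>y. y / c" "\<lambda>y. c * y"]) (use False in auto)
  moreover have "(\<Prod>y\<in>UNIV - {0}. c * y) = c ^ (CARD('k) - 1) * (\<Prod>y\<in>UNIV - {0}. y)"
    by (simp add: prod.distrib)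
  moreover have "(\<Prod>y\<in>UNIV - {0 :: 'k}. y) \<noteq> 0" by simp
  ultimately have "c ^ (CARD('k) - 1) = 1" by simp
  moreover have "c ^ CARD('k) = c ^ (CARD('k) - 1) * c"
    using card_gt_1[where 'k = 'k] by (metis One_nat_def Suc_diff_Suc less_imp_Suc_add
        power_Suc2 diff_Suc_1 Suc_lessD zero_less_card_finite Suc_pred)
  ultimately show ?thesis by simp
qed simp

text \<open>
  The polynomial \<open>(X + 1)^q - X^q - 1\<close> has degree below \<open>q\<close> and vanishes at the \<open>q\<close> elements of the
  ground field, so it is zero.
\<close>

lemma power_card_add:
  fixes x y :: "('k :: {finite, field}) alg_closure"
  shows "(x + y) ^ CARD('k) = x ^ CARD('k) + y ^ CARD('k)"
proof (cases "y = 0")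
  case False
  define q where "q = CARD('k)"
  have q1: "q > 1" unfolding q_def by (rule card_gt_1)
  define P :: "'k alg_closure poly" where "P = [:1, 1:] ^ q - Polynomial.monom 1 q - 1"
  have "Polynomial.degree P < q"
  proof (rule degree_lessI)
    show "P \<noteq> 0 \<or> 0 < q" using q1 by simp
    have deg: "Polynomial.degree ([:1, 1 :: 'k alg_closure:] ^ q) = q" by (simp add: degree_linear_power)
    have "Polynomial.coeff P q = 0"
      using lead_coeff_power[of "[:1, 1 :: 'k alg_closure:]" q] q1 unfolding deg P_def
      by (simp add: coeff_pCons split: nat.splits)
    moreover have "Polynomial.coeff P i = 0" if "i > q" for i
      unfolding P_def using that q1 deg
      by (simp add: coeff_eq_0[of "[:1, 1:] ^ q"] coeff_eq_0[of 1])
    ultimately show "\<forall>i\<ge>q. Polynomial.coeff P i = 0" by (metis le_neq_implies_less)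
  qed
  moreover have "range (to_ac :: 'k \<Rightarrow> _) \<subseteq> {z. poly P z = 0}"
  proof (rule image_subsetI)
    fix c :: 'k
    have "poly P (to_ac c) = to_ac ((1 + c) ^ q - c ^ q - 1)"
      unfolding P_def by (simp add: poly_monom)
    then show "to_ac c \<in> {z. poly P z = 0}" unfolding q_def finite_field_power_card by simp
  qed
  moreover have "card (range (to_ac :: 'k \<Rightarrow> _)) = q" unfolding q_def by (rule card_image[OF inj_to_ac])
  ultimately have "P = 0"
    using card_poly_roots_bound[of P] card_mono[OF poly_roots_finite[of P], of "range to_ac"] by fastforce
  then have "poly P (x / y) = 0" by simp
  then have "(1 + x / y) ^ q = (x / y) ^ q + 1"
    unfolding P_def by (simp add: poly_monom diff_eq_eq add.commute)
  then have "(y * (1 + x / y)) ^ q = y ^ q * ((x / y) ^ q + 1)" by (simp add: power_mult_distrib)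
  then show ?thesis using False unfolding q_def
    by (simp add: distrib_left power_divide add.commute)
qed simp

lemma frob_add:
  fixes x y :: "('k :: {finite, field}) alg_closure"
  shows "(x + y) ^ (CARD('k) ^ i) = x ^ (CARD('k) ^ i) + y ^ (CARD('k) ^ i)"
  by (induction i arbitrary: x y) (simp_all add: power_mult power_card_add)

text \<open>
  Adding \<open>1\<close> permutes the ground field, so it does not change the sum of all elements.
\<close>

lemma of_nat_card_eq_0: "(of_nat CARD('k) :: ('k :: {finite, field}) alg_closure) = 0"
proof -
  have "(\<Sum>y\<in>UNIV. y + 1 :: 'k) = (\<Sum>y\<in>UNIV. y)"
    by (rule sum.reindex_bij_witness[of _ "\<lambda>y. y - 1" "\<lambda>y. y + 1"]) auto
  then have "(of_nat CARD('k) :: 'k) = 0" by (simp add: sum.distrib)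
  then show ?thesis by (metis to_ac_0 to_ac_of_nat)
qed

lemma frob_sum:
  fixes f :: "'b \<Rightarrow> ('k :: {finite, field}) alg_closure"
  shows "sum f A ^ (CARD('k) ^ i) = (\<Sum>x\<in>A. f x ^ (CARD('k) ^ i))"
  by (induction A rule: infinite_finite_induct) (auto simp: frob_add)

lemma frob_minus:
  fixes x :: "('k :: {finite, field}) alg_closure"
  shows "(- x) ^ (CARD('k) ^ i) = - (x ^ (CARD('k) ^ i))"
  using frob_add[of x "- x" i] by (simp add: eq_neg_iff_add_eq_0 add.commute power_0_left)

lemma frob_diff:
  fixes x y :: "('k :: {finite, field}) alg_closure"
  shows "(x - y) ^ (CARD('k) ^ i) = x ^ (CARD('k) ^ i) - y ^ (CARD('k) ^ i)"
  using frob_add[of x "- y" i] by (simp add: frob_minus)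

lemma to_ac_frob: "to_ac (c :: 'k :: {finite, field}) ^ (CARD('k) ^ i) = to_ac c"
proof (induction i)
  case (Suc i)
  have "to_ac c ^ (CARD('k) ^ Suc i) = (to_ac c ^ (CARD('k) ^ i)) ^ CARD('k)"
    by (simp only: power_mult[symmetric] power_Suc2)
  also have "\<dots> = to_ac (c ^ CARD('k))" using Suc by simp
  finally show ?case by (simp add: finite_field_power_card)
qed simp

lemma frob_fixed_imp_to_ac:
  fixes x :: "('k :: {finite, field}) alg_closure"
  assumes "x ^ CARD('k) = x"
  shows "\<exists>c. x = to_ac c"
proof (rule ccontr)
  assume not: "\<nexists>c. x = to_ac c"
  define P :: "'k alg_closure poly" where "P = Polynomial.monom 1 (CARD('k)) - [:0, 1:]"
  have q1: "CARD('k) > 1" by (rule card_gt_1)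
  have cP: "Polynomial.coeff P (CARD('k)) = 1"
    unfolding P_def using q1 by (simp add: coeff_pCons split: nat.splits)
  then have P0: "P \<noteq> 0" by auto
  have dP: "Polynomial.degree P \<le> CARD('k)"
    unfolding P_def by (rule degree_diff_le) (use q1 in \<open>auto simp: degree_monom_le\<close>)
  have "insert x (range to_ac) \<subseteq> {z. poly P z = 0}"
    using assms to_ac_frob[of _ 1] unfolding P_def by (auto simp: poly_monom)
  then have "card (insert x (range to_ac)) \<le> card {z. poly P z = 0}"
    using poly_roots_finite[OF P0] by (rule card_mono[rotated])
  also have "\<dots> \<le> CARD('k)" using card_poly_roots_bound[OF P0] dP by simp
  finally have "card (insert x (range (to_ac :: 'k \<Rightarrow> _))) \<le> CARD('k)" .
  moreover have "card (range (to_ac :: 'k \<Rightarrow> _)) = CARD('k)" by (rule card_image[OF inj_to_ac])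
  moreover have "x \<notin> range (to_ac :: 'k \<Rightarrow> _)" using not by auto
  ultimately show False by simp
qed

lemma frob_mult_exp:
  fixes x :: "('k :: {finite, field}) alg_closure"
  shows "x ^ (CARD('k) ^ (i + j)) = (x ^ (CARD('k) ^ i)) ^ (CARD('k) ^ j)"
  by (simp add: power_add power_mult)

lemma frob_inj:
  fixes x y :: "('k :: {finite, field}) alg_closure"
  assumes "x ^ (CARD('k) ^ i) = y ^ (CARD('k) ^ i)"
  shows "x = y"
proof -
  have "(x - y) ^ (CARD('k) ^ i) = 0" using assms by (simp add: frob_diff)
  then show ?thesis by simp
qed

section \<open>Additive polynomials\<close>

text \<open>
  A multiple root would be a root of the derivative.
\<close>

lemma card_roots_of_constant_derivative:
  fixes P :: "'a :: alg_closed_field poly"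
  assumes "pderiv P = [:c:]" "c \<noteq> 0"
  shows "card {x. poly P x = 0} = Polynomial.degree P"
proof -
  have P0: "P \<noteq> 0" using assms by auto
  then obtain A where A: "size A = Polynomial.degree P"
    "P = Polynomial.smult (lead_coeff P) (\<Prod>x\<in>#A. [:-x, 1:])"
    using alg_closed_imp_factorization by blast
  have pA: "proots (\<Prod>x\<in>#A. [:-x, 1:]) = A"
  proof (induction A)
    case (add x A)
    have "(\<Prod>x\<in>#A. [:-x, 1:]) \<noteq> 0" by auto
    then show ?case using add by (simp add: proots_mult del: mult_pCons_left)
  qed simp
  have "proots P = A" using pA P0 by (subst A(2)) simp
  have ord: "Polynomial.order x P = 1" if x: "poly P x = 0" for x
  proof (rule ccontr)
    assume "Polynomial.order x P \<noteq> 1"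
    moreover have "Polynomial.order x P \<noteq> 0" using x P0 order_root by blast
    ultimately have "[:-x, 1:] ^ 2 dvd P" unfolding order_divides by linarith
    then obtain Q where "P = [:-x, 1:] ^ 2 * Q" by (elim dvdE)
    then have "P = [:-x, 1:] * ([:-x, 1:] * Q)" by (simp only: power2_eq_square mult.assoc)
    then have "poly (pderiv P) x = 0" by (simp add: pderiv_mult del: mult_pCons_left)
    then show False using assms by simp
  qed
  have "size (proots P) = (\<Sum>x\<in>set_mset (proots P). count (proots P) x)"
    by (simp add: size_multiset_overloaded_eq)
  also have "\<dots> = (\<Sum>x\<in>{x. poly P x = 0}. 1)"
    by (rule sum.cong) (use P0 ord in auto)
  finally show ?thesis using A(1) \<open>proots P = A\<close> by simp
qed

text \<open>
  The ordinary polynomial that induces the action of a twisted polynomial.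
\<close>

definition add_poly :: "('k :: {finite, field}) alg_closure poly \<Rightarrow> 'k alg_closure poly" where
  "add_poly f = (\<Sum>i\<le>Polynomial.degree f. Polynomial.monom (Polynomial.coeff f i) (CARD('k) ^ i))"

lemma poly_add_poly: "poly (add_poly f) v = twisted_act f v"
  by (simp add: add_poly_def twisted_act_def poly_sum poly_monom)

lemma coeff_add_poly:
  fixes f :: "('k :: {finite, field}) alg_closure poly"
  shows "Polynomial.coeff (add_poly f) (CARD('k) ^ i) = Polynomial.coeff f i"
proof -
  have inj: "CARD('k) ^ j = CARD('k) ^ i \<longleftrightarrow> j = i" for j
    using card_gt_1[where 'k = 'k] by (simp add: power_inject_exp)
  have "Polynomial.coeff (add_poly f) (CARD('k) ^ i) =
    (\<Sum>j\<le>Polynomial.degree f. if j = i then Polynomial.coeff f j else 0)"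
    unfolding add_poly_def coeff_sum coeff_monom inj ..
  also have "\<dots> = Polynomial.coeff f i" by (simp add: sum.delta coeff_eq_0)
  finally show ?thesis .
qed

lemma degree_add_poly:
  fixes f :: "('k :: {finite, field}) alg_closure poly"
  assumes "f \<noteq> 0"
  shows "Polynomial.degree (add_poly f) = CARD('k) ^ Polynomial.degree f"
proof (rule antisym)
  show "Polynomial.degree (add_poly f) \<le> CARD('k) ^ Polynomial.degree f"
    unfolding add_poly_def
  proof (rule degree_sum_le)
    fix i assume "i \<in> {..Polynomial.degree f}"
    then have "CARD('k) ^ i \<le> CARD('k) ^ Polynomial.degree f" by (intro power_increasing) auto
    then show "Polynomial.degree (Polynomial.monom (Polynomial.coeff f i) (CARD('k) ^ i))
        \<le> CARD('k) ^ Polynomial.degree f"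
      using degree_monom_le order_trans by blast
  qed simp
  show "CARD('k) ^ Polynomial.degree f \<le> Polynomial.degree (add_poly f)"
    by (rule le_degree) (use assms in \<open>simp add: coeff_add_poly\<close>)
qed

lemma pderiv_sum: "pderiv (sum f A) = (\<Sum>x\<in>A. pderiv (f x))"
  using higher_pderiv_sum[of 1 f A] by simp

text \<open>
  The derivative of \<open>\<Sum>i. a i * X^(q^i)\<close> is the constant \<open>a 0\<close>, as \<open>q\<close> is zero in the field.
\<close>

lemma card_kernel_twisted:
  fixes f :: "('k :: {finite, field}) alg_closure poly"
  assumes "Polynomial.coeff f 0 \<noteq> 0"
  shows "card {v. twisted_act f v = 0} = CARD('k) ^ Polynomial.degree f"
proof -
  have f0: "f \<noteq> 0" using assms by auto
  have "pderiv (Polynomial.monom a (CARD('k) ^ i)) = (if i = 0 then [:a:] else 0)"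
    for a :: "'k alg_closure" and i
  proof (cases i)
    case (Suc j)
    then have "(of_nat (CARD('k) ^ i) :: 'k alg_closure) = 0" by (simp add: of_nat_card_eq_0)
    then show ?thesis using Suc by (simp add: pderiv_monom)
  qed (simp add: pderiv_monom monom_0)
  then have "pderiv (add_poly f) = (\<Sum>i\<le>Polynomial.degree f. if i = 0 then [:Polynomial.coeff f i:] else 0)"
    unfolding add_poly_def pderiv_sum by simp
  also have "\<dots> = [:Polynomial.coeff f 0:]" by (simp add: sum.delta)
  finally show ?thesis
    using card_roots_of_constant_derivative[OF _ assms, of "add_poly f"] degree_add_poly[OF f0]
    by (simp add: poly_add_poly)
qed

lemma twisted_act_degree_le:
  fixes f :: "('k :: {finite, field}) alg_closure poly"
  assumes "Polynomial.degree f \<le> N"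
  shows "twisted_act f v = (\<Sum>i\<le>N. Polynomial.coeff f i * v ^ (CARD('k) ^ i))"
  unfolding twisted_act_def
  by (rule sum.mono_neutral_left) (use assms in \<open>auto simp: coeff_eq_0\<close>)

lemma twisted_act_monom:
  fixes v :: "('k :: {finite, field}) alg_closure"
  shows "twisted_act (Polynomial.monom a i) v = a * v ^ (CARD('k) ^ i)"
proof -
  have "twisted_act (Polynomial.monom a i) v =
    (\<Sum>j\<le>i. (if i = j then a * v ^ (CARD('k) ^ j) else 0))"
    unfolding twisted_act_degree_le[OF degree_monom_le] by (rule sum.cong) auto
  then show ?thesis by simp
qed

lemma twisted_act_zero_poly [simp]: "twisted_act 0 v = 0"
  by (simp add: twisted_act_def)

lemma twisted_act_add_poly: "twisted_act (f + g) v = twisted_act f v + twisted_act g v"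
proof -
  define N where "N = max (Polynomial.degree f) (Polynomial.degree g)"
  have "Polynomial.degree f \<le> N" "Polynomial.degree g \<le> N" "Polynomial.degree (f + g) \<le> N"
    unfolding N_def by (auto intro: degree_add_le)
  then show ?thesis by (simp add: twisted_act_degree_le sum.distrib algebra_simps)
qed

lemma twisted_act_sum_poly: "twisted_act (sum f A) v = (\<Sum>x\<in>A. twisted_act (f x) v)"
  by (induction A rule: infinite_finite_induct) (auto simp: twisted_act_add_poly)

lemma twisted_act_minus_poly: "twisted_act (- f) v = - twisted_act f v"
  using twisted_act_add_poly[of f "- f" v] by (simp add: eq_neg_iff_add_eq_0 add.commute)

lemma twisted_act_add: "twisted_act f (v + w) = twisted_act f v + twisted_act f w"
  unfolding twisted_act_def by (simp add: frob_add algebra_simps sum.distrib)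

lemma twisted_act_0 [simp]: "twisted_act (f :: ('k :: {finite, field}) alg_closure poly) 0 = 0"
  unfolding twisted_act_def by (simp add: power_0_left)

lemma twisted_act_minus: "twisted_act f (- v) = - twisted_act f v"
  using twisted_act_add[of f v "- v"] by (simp add: eq_neg_iff_add_eq_0 add.commute)

lemma twisted_act_mult:
  "twisted_act (twisted_mult f g) v = twisted_act f (twisted_act g v)"
  unfolding twisted_mult_def twisted_act_sum_poly twisted_act_monom
  unfolding twisted_act_def[of f] twisted_act_def[of g]
  by (simp add: frob_sum sum_distrib_left power_mult_distrib mult.assoc
      frob_mult_exp[symmetric] add.commute)

lemma twisted_act_const: "twisted_act [:a:] v = a * v"
  by (simp add: twisted_act_def)

lemma twisted_act_1 [simp]: "twisted_act 1 v = v"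
  by (simp add: twisted_act_def)

lemma twisted_act_tau: "twisted_act twisted_tau (v :: ('k :: {finite, field}) alg_closure) = v ^ CARD('k)"
  using twisted_act_monom[of 1 1 v] unfolding twisted_tau_def by (simp add: monom_altdef)

section \<open>Finite subfields of the algebraic closure\<close>

lemma card_subfield_GF:
  assumes "k > 0"
  shows "card (subfield_GF k :: ('k :: {finite, field}) alg_closure set) = CARD('k) ^ k"
proof -
  define f :: "'k alg_closure poly" where "f = Polynomial.monom 1 k - 1"
  have c: "Polynomial.coeff f i = (if i = 0 then -1 else if i = k then 1 else 0)" for i
    using assms unfolding f_def by (auto simp: coeff_pCons split: nat.splits)
  have "Polynomial.degree f = k"
    by (rule antisym[OF degree_le le_degree]) (use assms c in auto)
  moreover have "{v. twisted_act f v = 0} = subfield_GF k"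
  proof -
    have "twisted_act f v = v ^ (CARD('k) ^ k) - v" for v
      using twisted_act_add_poly[of "Polynomial.monom 1 k" "- 1" v]
      by (simp add: f_def twisted_act_monom twisted_act_minus_poly)
    then show ?thesis unfolding subfield_GF_def by simp
  qed
  ultimately show ?thesis using card_kernel_twisted[of f] c by simp
qed

lemma subfield_GF_finite:
  assumes "k > 0" shows "finite (subfield_GF k :: ('k :: {finite, field}) alg_closure set)"
  using card_subfield_GF[OF assms, where 'k = 'k] card_gt_1[where 'k = 'k]
  by (metis card.infinite less_nat_zero_code power_eq_0_iff zero_less_card_finite)

text \<open>
  The ordinary polynomial of \<open>f - g\<close> would have more roots than its degree, because the closure
  contains finite fields of any size \<open>q^k\<close>.
\<close>

lemma twisted_act_inject:
  fixes f g :: "('k :: {finite, field}) alg_closure poly"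
  assumes "\<And>v. twisted_act f v = twisted_act g v"
  shows "f = g"
proof (rule ccontr)
  assume "f \<noteq> g"
  define h where "h = f - g"
  have h0: "h \<noteq> 0" unfolding h_def using \<open>f \<noteq> g\<close> by simp
  have "twisted_act h v = 0" for v
    using twisted_act_add_poly[of f "- g" v] assms[of v] unfolding h_def
    by (simp add: twisted_act_minus_poly)
  then have all: "{v. poly (add_poly h) v = 0} = UNIV" by (simp add: poly_add_poly)
  have ah: "add_poly h \<noteq> 0"
    using coeff_add_poly[of h "Polynomial.degree h"] h0 by auto
  let ?k = "Suc (Polynomial.degree h)"
  have "card (subfield_GF ?k :: 'k alg_closure set) \<le> card {v. poly (add_poly h) v = 0}"
    by (rule card_mono[OF poly_roots_finite[OF ah]]) (simp add: all)
  also have "\<dots> \<le> Polynomial.degree (add_poly h)" by (rule card_poly_roots_bound[OF ah])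
  also have "\<dots> = CARD('k) ^ Polynomial.degree h" by (rule degree_add_poly[OF h0])
  finally show False using card_subfield_GF[of ?k, where 'k = 'k] card_gt_1[where 'k = 'k] by simp
qed

lemma subfield_GF_power_mult:
  assumes "(z :: ('k :: {finite, field}) alg_closure) \<in> subfield_GF k"
  shows "z ^ (CARD('k) ^ (k * j)) = z"
proof (induction j)
  case (Suc j)
  have "z ^ (CARD('k) ^ (k * Suc j)) = (z ^ (CARD('k) ^ (k * j))) ^ (CARD('k) ^ k)"
    using frob_mult_exp[of z "k * j" k] by (simp add: add.commute)
  then show ?case using Suc assms unfolding subfield_GF_def by simp
qed simp

lemma subfield_GF_mod:
  assumes "(z :: ('k :: {finite, field}) alg_closure) \<in> subfield_GF k"
  shows "z ^ (CARD('k) ^ i) = z ^ (CARD('k) ^ (i mod k))"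
proof -
  have "z ^ (CARD('k) ^ i) = z ^ (CARD('k) ^ (k * (i div k) + i mod k))" by simp
  also have "\<dots> = z ^ (CARD('k) ^ (i mod k))"
    unfolding frob_mult_exp subfield_GF_power_mult[OF assms] ..
  finally show ?thesis .
qed

lemma subfield_GF_dvd:
  assumes "(z :: ('k :: {finite, field}) alg_closure) \<in> subfield_GF m" "m dvd n"
  shows "z \<in> subfield_GF n"
  using assms subfield_GF_power_mult[OF assms(1)] unfolding subfield_GF_def by auto

text \<open>
  If \<open>a * x = b * y + gcd a b\<close>, then both the \<open>a * x\<close>-fold and the \<open>b * y\<close>-fold Frobenius fix \<open>z\<close>.
\<close>

lemma subfield_GF_gcd:
  assumes a: "(z :: ('k :: {finite, field}) alg_closure) \<in> subfield_GF a"
    and b: "z \<in> subfield_GF b" and "a > 0"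
  shows "z \<in> subfield_GF (gcd a b)"
proof -
  obtain x y where xy: "a * x = b * y + gcd a b" using bezout_nat[of a b] \<open>a > 0\<close> by blast
  have "z = z ^ (CARD('k) ^ (b * y + gcd a b))"
    using subfield_GF_power_mult[OF a, of x] unfolding xy by simp
  also have "\<dots> = z ^ (CARD('k) ^ gcd a b)"
    unfolding frob_mult_exp subfield_GF_power_mult[OF b] ..
  finally show ?thesis unfolding subfield_GF_def by simp
qed

lemma subfield_GF_closed:
  fixes x y :: "('k :: {finite, field}) alg_closure"
  assumes "x \<in> subfield_GF m" "y \<in> subfield_GF m"
  shows "x + y \<in> subfield_GF m" "x * y \<in> subfield_GF m" "- x \<in> subfield_GF m"
  using assms unfolding subfield_GF_def by (auto simp: frob_add frob_minus power_mult_distrib)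

lemma to_ac_in_subfield_GF: "to_ac c \<in> subfield_GF m"
  unfolding subfield_GF_def by (simp add: to_ac_frob)

lemma subfield_GF_sum:
  fixes f :: "'b \<Rightarrow> ('k :: {finite, field}) alg_closure"
  assumes "\<And>x. x \<in> A \<Longrightarrow> f x \<in> subfield_GF m"
  shows "sum f A \<in> subfield_GF m"
  using assms
  by (induction A rule: infinite_finite_induct)
    (use to_ac_in_subfield_GF[of 0] in \<open>auto intro: subfield_GF_closed\<close>)

text \<open>
  On the field with \<open>q^k\<close> elements the exponents \<open>r * i\<close> matter modulo \<open>k\<close> only, and they are distinct
  there.  So the relation says that a polynomial of degree less than \<open>q^k\<close> has \<open>q^k\<close> roots.
\<close>

lemma independence_of_frobenius_powers:
  fixes y :: "nat \<Rightarrow> ('k :: {finite, field}) alg_closure"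
  assumes k: "k > 0" and cop: "coprime r k"
    and rel: "\<And>z. z \<in> subfield_GF k \<Longrightarrow> (\<Sum>i<k. y i * z ^ (CARD('k) ^ (r * i))) = 0"
    and i: "i < k"
  shows "y i = 0"
proof -
  define P where "P = (\<Sum>i<k. Polynomial.monom (y i) (CARD('k) ^ ((r * i) mod k)))"
  have "subfield_GF k \<subseteq> {z. poly P z = 0}"
  proof
    fix z :: "'k alg_closure" assume z: "z \<in> subfield_GF k"
    have "poly P z = (\<Sum>i<k. y i * z ^ (CARD('k) ^ ((r * i) mod k)))"
      unfolding P_def by (simp add: poly_sum poly_monom)
    also have "\<dots> = 0" using rel[OF z] subfield_GF_mod[OF z] by simp
    finally show "z \<in> {z. poly P z = 0}" by simp
  qed
  moreover have "Polynomial.degree P \<le> CARD('k) ^ (k - 1)"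
    unfolding P_def
  proof (rule degree_sum_le)
    fix i assume "i \<in> {..<k}"
    have "(r * i) mod k \<le> k - 1" using k by (metis Suc_pred' less_Suc_eq_le mod_less_divisor)
    then have "CARD('k) ^ ((r * i) mod k) \<le> CARD('k) ^ (k - 1)" by (intro power_increasing) auto
    then show "Polynomial.degree (Polynomial.monom (y i) (CARD('k) ^ ((r * i) mod k))) \<le> CARD('k) ^ (k - 1)"
      using degree_monom_le order_trans by blast
  qed simp
  moreover have "CARD('k) ^ (k - 1) < CARD('k) ^ k" using k card_gt_1[where 'k = 'k] by simp
  ultimately have "P = 0"
    using card_poly_roots_bound[of P] card_mono[OF poly_roots_finite[of P], of "subfield_GF k"]
      card_subfield_GF[OF k, where 'k = 'k] by fastforce
  have inj_le: "b = a" if "a \<le> b" "b < k" "(r * b) mod k = (r * a) mod k" for a b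
  proof -
    have "k dvd r * b - r * a" using that mod_eq_dvd_iff_nat[of "r * a" "r * b" k] by simp
    then have "k dvd r * (b - a)" by (simp add: right_diff_distrib')
    then have "k dvd b - a" using cop by (simp add: coprime_dvd_mult_right_iff coprime_commute)
    then show ?thesis using that by (auto dest: dvd_imp_le)
  qed
  have inj: "(r * j) mod k = (r * i) mod k \<longleftrightarrow> j = i" if "j < k" for j
    using inj_le[of i j] inj_le[of j i] that i by (metis nle_le)
  have "Polynomial.coeff P (CARD('k) ^ ((r * i) mod k)) = (\<Sum>j<k. if j = i then y j else 0)"
    unfolding P_def coeff_sum coeff_monom
    by (rule sum.cong) (use inj card_gt_1[where 'k = 'k] in \<open>auto simp: power_inject_exp\<close>)
  also have "\<dots> = y i" using i by simp
  finally show ?thesis using \<open>P = 0\<close> by simp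
qed

text \<open>
  By induction on \<open>J\<close>.  After division by \<open>z a\<close>, the Frobenius transform of the \<open>i\<close>-th relation and the
  relation for \<open>i + 1\<close> contain the same power of \<open>y a\<close>.  Their difference is a relation between the
  \<open>y j^(q^r)\<close> for \<open>j \<in> J\<close> with coefficients \<open>w j = u j^(q^r) - u j\<close>.  The coefficients remain
  independent: if \<open>\<Sum>j. c j * w j = 0\<close>, then \<open>\<Sum>j. c j * u j\<close> is fixed by the \<open>r\<close>-fold Frobenius and by
  the \<open>m\<close>-fold one, hence is a scalar, which is a relation between the \<open>z j\<close> and \<open>z a\<close>.
\<close>

lemma independence_over_frobenius_orbit:
  fixes z y :: "'b \<Rightarrow> ('k :: {finite, field}) alg_closure"
  assumes "finite J" and m: "m > 0" "coprime r m"
    and "\<And>j. j \<in> J \<Longrightarrow> z j \<in> subfield_GF m"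
    and "\<And>c. (\<Sum>j\<in>J. to_ac (c j) * z j) = 0 \<Longrightarrow> \<forall>j\<in>J. c j = 0"
    and "\<And>i. (\<Sum>j\<in>J. z j * y j ^ (CARD('k) ^ (r * i))) = 0"
  shows "\<forall>j\<in>J. y j = 0"
  using assms(1,4-6)
proof (induction J arbitrary: z y)
  case (insert a J)
  let ?q = "CARD('k) ^ r"
  have za: "z a \<noteq> 0"
  proof
    assume "z a = 0"
    then have "(\<Sum>j\<in>insert a J. to_ac (if j = a then 1 else 0) * z j) = 0"
      by (intro sum.neutral) (use insert.hyps in auto)
    from insert.prems(2)[OF this] show False by auto
  qed
  define u where "u j = z j / z a" for j
  define w where "w j = u j ^ ?q - u j" for j
  have uGF: "u j \<in> subfield_GF m" if "j \<in> J" for j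
    using insert.prems(1)[of j] insert.prems(1)[of a] that
    unfolding u_def subfield_GF_def by (simp add: power_divide)
  have u_rel: "(\<Sum>j\<in>J. u j * y j ^ (CARD('k) ^ (r * i))) = - (y a ^ (CARD('k) ^ (r * i)))" for i
  proof -
    have "(\<Sum>j\<in>insert a J. z j * y j ^ (CARD('k) ^ (r * i))) =
        z a * (y a ^ (CARD('k) ^ (r * i)) + (\<Sum>j\<in>J. u j * y j ^ (CARD('k) ^ (r * i))))"
      using insert.hyps za by (simp add: u_def sum_distrib_left distrib_left)
    then show ?thesis using insert.prems(3)[of i] za by (simp add: add_eq_0_iff)
  qed
  have rel: "(\<Sum>j\<in>J. w j * (y j ^ ?q) ^ (CARD('k) ^ (r * i))) = 0" for i
  proof -
    have Suc: "v ^ (CARD('k) ^ (r * Suc i)) = (v ^ (CARD('k) ^ (r * i))) ^ ?q" for v :: "'k alg_closure"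
      using frob_mult_exp[of v "r * i" r] by (simp add: add.commute)
    have "(\<Sum>j\<in>J. u j ^ ?q * y j ^ (CARD('k) ^ (r * Suc i))) = (\<Sum>j\<in>J. u j * y j ^ (CARD('k) ^ (r * i))) ^ ?q"
      unfolding frob_sum Suc power_mult_distrib ..
    also have "\<dots> = - (y a ^ (CARD('k) ^ (r * Suc i)))" unfolding u_rel Suc frob_minus ..
    also have "\<dots> = (\<Sum>j\<in>J. u j * y j ^ (CARD('k) ^ (r * Suc i)))" by (rule u_rel[symmetric])
    finally have "(\<Sum>j\<in>J. u j ^ ?q * y j ^ (CARD('k) ^ (r * Suc i))) = (\<Sum>j\<in>J. u j * y j ^ (CARD('k) ^ (r * Suc i)))" .
    then have "(\<Sum>j\<in>J. w j * y j ^ (CARD('k) ^ (r * Suc i))) = 0"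
      unfolding w_def by (simp add: left_diff_distrib sum_subtractf del: mult_Suc_right)
    then show ?thesis unfolding frob_mult_exp[symmetric] by (simp add: add.commute)
  qed
  have "\<forall>j\<in>J. c j = 0" if c: "(\<Sum>j\<in>J. to_ac (c j) * w j) = 0" for c
  proof -
    define x where "x = (\<Sum>j\<in>J. to_ac (c j) * u j)"
    have "x ^ ?q = (\<Sum>j\<in>J. to_ac (c j) * u j ^ ?q)"
      unfolding x_def frob_sum power_mult_distrib to_ac_frob ..
    also have "\<dots> = x" using c by (simp add: x_def w_def right_diff_distrib sum_subtractf)
    finally have "x \<in> subfield_GF r" unfolding subfield_GF_def by simp
    moreover have "x \<in> subfield_GF m" unfolding x_def
      by (intro subfield_GF_sum subfield_GF_closed(2) to_ac_in_subfield_GF uGF)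
    ultimately have "x \<in> subfield_GF 1" using subfield_GF_gcd[of x m r] m
      by (simp add: coprime_iff_gcd_eq_1 gcd.commute)
    then obtain c' where c': "x = to_ac c'" using frob_fixed_imp_to_ac unfolding subfield_GF_def by auto
    \<comment> \<open>since \<open>x = c'\<close>, subtracting \<open>c' * z a\<close> gives a relation on all of \<open>insert a J\<close>\<close>
    define d where "d j = (if j = a then - c' else c j)" for j
    have "(\<Sum>j\<in>J. to_ac (d j) * z j) = (\<Sum>j\<in>J. to_ac (c j) * z j)"
      by (rule sum.cong) (use insert.hyps in \<open>auto simp: d_def\<close>)
    also have "\<dots> = x * z a"
      unfolding x_def sum_distrib_right by (rule sum.cong) (use za in \<open>auto simp: u_def\<close>)
    finally have "(\<Sum>j\<in>insert a J. to_ac (d j) * z j) = 0" using c' insert.hyps by (simp add: d_def)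
    then have d0: "\<forall>j\<in>insert a J. d j = 0" by (rule insert.prems(2))
    show ?thesis
    proof
      fix j assume "j \<in> J"
      then have "d j = 0" "j \<noteq> a" using d0 insert.hyps by auto
      then show "c j = 0" by (simp add: d_def)
    qed
  qed
  moreover have "w j \<in> subfield_GF m" if "j \<in> J" for j
    using uGF[OF that] unfolding w_def subfield_GF_def
    by (simp add: frob_diff power_mult[symmetric] mult.commute) (simp add: power_mult)
  ultimately have "\<forall>j\<in>J. y j ^ ?q = 0" using insert.IH[of w "\<lambda>j. y j ^ ?q"] rel by blast
  then have "\<forall>j\<in>J. y j = 0" by simp
  then show ?case using u_rel[of 0] by simp
qed simp

text \<open>
  A maximal independent subset spans; it has \<open>m\<close> elements because it has \<open>q^m\<close> linear combinations.
\<close>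

lemma subfield_GF_basis:
  assumes m: "m > 0"
  obtains z :: "nat \<Rightarrow> ('k :: {finite, field}) alg_closure"
  where "\<And>j. j < m \<Longrightarrow> z j \<in> subfield_GF m"
    and "\<And>x. x \<in> subfield_GF m \<Longrightarrow> \<exists>c. x = (\<Sum>j<m. to_ac (c j) * z j)"
    and "\<And>c. (\<Sum>j<m. to_ac (c j) * z j) = 0 \<Longrightarrow> \<forall>j<m. c j = 0"
proof -
  interpret V: vector_space "\<lambda>(c :: 'k) x. to_ac c * x"
    by unfold_locales (auto simp: algebra_simps)
  obtain B where B: "B \<subseteq> subfield_GF m" "V.independent B" "subfield_GF m \<subseteq> V.span B"
    using V.maximal_independent_subset[of "subfield_GF m"] by blast
  have finB: "finite B" using finite_subset[OF B(1) subfield_GF_finite[OF m]] .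
  define N where "N = card B"
  obtain z where z: "bij_betw z {..<N} B"
    using ex_bij_betw_nat_finite[OF finB] unfolding N_def atLeast0LessThan by blast
  have zGF: "z j \<in> subfield_GF m" if "j < N" for j
    using B(1) bij_betwE[OF z] that by auto
  have reindex: "(\<Sum>b\<in>B. to_ac (u b) * b) = (\<Sum>j<N. to_ac (u (z j)) * z j)" for u
    using sum.reindex_bij_betw[OF z, of "\<lambda>b. to_ac (u b) * b"] by simp
  have span: "\<exists>c. x = (\<Sum>j<N. to_ac (c j) * z j)" if x: "x \<in> subfield_GF m" for x
  proof -
    have "x \<in> V.span B" using B(3) x by blast
    then obtain u where "x = (\<Sum>b\<in>B. to_ac (u b) * b)" using V.span_finite[OF finB] by auto
    then show ?thesis unfolding reindex by (intro exI)
  qed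
  have indep: "\<forall>j<N. c j = 0" if c: "(\<Sum>j<N. to_ac (c j) * z j) = 0" for c
  proof -
    \<comment> \<open>the coefficients transported from indices to basis vectors\<close>
    define u where "u b = c (inv_into {..<N} z b)" for b
    have uz: "u (z j) = c j" if "j < N" for j
      unfolding u_def using bij_betw_inv_into_left[OF z, of j] that by simp
    have "(\<Sum>b\<in>B. to_ac (u b) * b) = 0" unfolding reindex using c uz by simp
    then have "\<forall>b\<in>B. u b = 0" using B(2) V.independentD[OF B(2) finB, of u] by blast
    then show ?thesis using uz bij_betwE[OF z] by (metis lessThan_iff)
  qed
  have "bij_betw (\<lambda>c. \<Sum>j<N. to_ac (c j) * z j) ({..<N} \<rightarrow>\<^sub>E (UNIV :: 'k set)) (subfield_GF m)"
  proof (rule bij_betw_imageI)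
    show "inj_on (\<lambda>c. \<Sum>j<N. to_ac (c j) * z j) ({..<N} \<rightarrow>\<^sub>E (UNIV :: 'k set))"
    proof (rule inj_onI)
      fix c d :: "nat \<Rightarrow> 'k" assume cd: "c \<in> {..<N} \<rightarrow>\<^sub>E UNIV" "d \<in> {..<N} \<rightarrow>\<^sub>E UNIV"
        and eq: "(\<Sum>j<N. to_ac (c j) * z j) = (\<Sum>j<N. to_ac (d j) * z j)"
      have "(\<Sum>j<N. to_ac (c j - d j) * z j) = 0"
        using eq by (simp add: left_diff_distrib sum_subtractf)
      from indep[OF this] show "c = d" using cd by (intro PiE_ext[OF cd]) auto
    qed
    show "(\<lambda>c. \<Sum>j<N. to_ac (c j) * z j) ` ({..<N} \<rightarrow>\<^sub>E (UNIV :: 'k set)) = subfield_GF m"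
    proof
      show "(\<lambda>c. \<Sum>j<N. to_ac (c j) * z j) ` ({..<N} \<rightarrow>\<^sub>E (UNIV :: 'k set)) \<subseteq> subfield_GF m"
        by (auto intro!: subfield_GF_sum subfield_GF_closed(2) to_ac_in_subfield_GF zGF)
      show "subfield_GF m \<subseteq> (\<lambda>c. \<Sum>j<N. to_ac (c j) * z j) ` ({..<N} \<rightarrow>\<^sub>E (UNIV :: 'k set))"
      proof
        fix x :: "'k alg_closure" assume "x \<in> subfield_GF m"
        then obtain c where "x = (\<Sum>j<N. to_ac (c j) * z j)" using span by blast
        then have "x = (\<Sum>j<N. to_ac (restrict c {..<N} j) * z j)" by simp
        then show "x \<in> (\<lambda>c. \<Sum>j<N. to_ac (c j) * z j) ` ({..<N} \<rightarrow>\<^sub>E (UNIV :: 'k set))"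
          by (intro image_eqI[of _ _ "restrict c {..<N}"]) auto
      qed
    qed
  qed
  then have "card ({..<N} \<rightarrow>\<^sub>E (UNIV :: 'k set)) = card (subfield_GF m :: 'k alg_closure set)"
    by (rule bij_betw_same_card)
  then have "CARD('k) ^ N = CARD('k) ^ m" using card_subfield_GF[OF m, where 'k = 'k] by (simp add: card_PiE)
  then have "N = m" using card_gt_1[where 'k = 'k] by (simp add: power_inject_exp)
  then show ?thesis using that zGF span indep by blast
qed

section \<open>Centralizers and modules over rings of operators\<close>

lemma (in ring) centralizer_subring:
  assumes H: "H \<subseteq> carrier R"
  shows "subring (centralizer R H) R"
proof (rule subringI)
  show "centralizer R H \<subseteq> carrier R" unfolding centralizer_def by blast
  show "\<one> \<in> centralizer R H" unfolding centralizer_def using H by auto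
  show "\<ominus> x \<in> centralizer R H" if "x \<in> centralizer R H" for x
    using that H unfolding centralizer_def by (auto simp: l_minus r_minus)
  fix x y assume x: "x \<in> centralizer R H" and y: "y \<in> centralizer R H"
  have c: "x \<in> carrier R" "y \<in> carrier R" using x y unfolding centralizer_def by auto
  have "(x \<otimes> y) \<otimes> h = h \<otimes> (x \<otimes> y)" if "h \<in> H" for h
  proof -
    have h: "h \<in> carrier R" "x \<otimes> h = h \<otimes> x" "y \<otimes> h = h \<otimes> y"
      using that H x y unfolding centralizer_def by auto
    have "(x \<otimes> y) \<otimes> h = x \<otimes> (h \<otimes> y)" using c h by (simp add: m_assoc)
    also have "\<dots> = (x \<otimes> h) \<otimes> y" using c h(1) by (simp add: m_assoc)
    finally show ?thesis using c h by (simp add: m_assoc)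
  qed
  then show "x \<otimes> y \<in> centralizer R H" unfolding centralizer_def using c by simp
  have "(x \<oplus> y) \<otimes> h = h \<otimes> (x \<oplus> y)" if "h \<in> H" for h
    using that H x y c unfolding centralizer_def by (auto simp: l_distr r_distr)
  then show "x \<oplus> y \<in> centralizer R H" unfolding centralizer_def using c by simp
qed

text \<open>
  Centralizers are subrings, so commutation extends from generators first on one side, then on the other.
\<close>

lemma (in ring) generate_ring_commute:
  assumes H: "H \<subseteq> carrier R" and G: "G \<subseteq> carrier R"
    and comm: "\<And>x y. x \<in> H \<Longrightarrow> y \<in> G \<Longrightarrow> x \<otimes> y = y \<otimes> x"
    and x: "x \<in> generate_ring R H" and y: "y \<in> generate_ring R G"
  shows "x \<otimes> y = y \<otimes> x"
proof -
  have "H \<subseteq> centralizer R G" unfolding centralizer_def using H comm by auto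
  then have "generate_ring R H \<subseteq> centralizer R G"
    by (rule generate_ring_min_subring1[OF H centralizer_subring[OF G]])
  then have "G \<subseteq> centralizer R (generate_ring R H)"
    unfolding centralizer_def using G by auto
  then have "generate_ring R G \<subseteq> centralizer R (generate_ring R H)"
    by (rule generate_ring_min_subring1[OF G centralizer_subring[OF generate_ring_incl[OF H]]])
  then show ?thesis using x y unfolding centralizer_def by auto
qed

lemma (in module) evaluation_module_is_module:
  assumes T: "subring T \<E>" and comm: "\<And>f g. f \<in> T \<Longrightarrow> g \<in> T \<Longrightarrow> f \<otimes>\<^bsub>\<E>\<^esub> g = g \<otimes>\<^bsub>\<E>\<^esub> f"
  shows "module (\<E>\<lparr>carrier := T\<rparr>) (evaluation_module M)"
proof -
  interpret E: ring \<E> by (rule End_ring_is_ring)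
  note TE = subsetD[OF subringE(1)[OF T]]
  show ?thesis
  proof (rule moduleI)
    have "subcring T \<E>" using E.subcringI[OF T] comm by blast
    then show "cring (\<E>\<lparr>carrier := T\<rparr>)" using E.subcring_iff[OF subringE(1)[OF T]] by blast
    show "abelian_group (evaluation_module M)"
    proof (rule abelian_groupI)
      fix x assume "x \<in> carrier (evaluation_module M)"
      then show "\<exists>y\<in>carrier (evaluation_module M). y \<oplus>\<^bsub>evaluation_module M\<^esub> x = \<zero>\<^bsub>evaluation_module M\<^esub>"
        by (intro bexI[of _ "\<ominus>\<^bsub>M\<^esub> x"]) (auto simp: evaluation_module_def M.l_neg)
    qed (auto simp: evaluation_module_def M.a_ac)
  qed (use TE in \<open>auto simp: evaluation_module_def End_memD End_apply\<close>)
qed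

section \<open>The ring of twisted polynomials\<close>

lemma twisted_ring_simps [simp]:
  "carrier twisted_ring = UNIV" "f \<otimes>\<^bsub>twisted_ring\<^esub> g = twisted_mult f g" "\<one>\<^bsub>twisted_ring\<^esub> = 1"
  "\<zero>\<^bsub>twisted_ring\<^esub> = 0" "f \<oplus>\<^bsub>twisted_ring\<^esub> g = f + g"
  by (simp_all add: twisted_ring_def)

text \<open>
  The ring axioms hold for operators on the closure, and the action on the closure is faithful.
\<close>

lemma twisted_ring_is_ring: "ring (twisted_ring :: ('k :: {finite, field}) alg_closure poly ring)"
proof (rule ringI)
  show "abelian_group (twisted_ring :: 'k alg_closure poly ring)"
  proof (rule abelian_groupI)
    fix f :: "'k alg_closure poly"
    show "\<exists>g\<in>carrier twisted_ring. g \<oplus>\<^bsub>twisted_ring\<^esub> f = \<zero>\<^bsub>twisted_ring\<^esub>"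
      by (intro bexI[of _ "- f"]) auto
  qed (auto simp: algebra_simps)
  show "monoid (twisted_ring :: 'k alg_closure poly ring)"
    by (rule monoidI) (auto intro!: twisted_act_inject simp: twisted_act_mult)
qed (auto intro!: twisted_act_inject simp: twisted_act_mult twisted_act_add_poly twisted_act_add)

lemma twisted_a_inv: "\<ominus>\<^bsub>twisted_ring\<^esub> f = - f"
proof -
  interpret ring "twisted_ring :: 'a alg_closure poly ring" by (rule twisted_ring_is_ring)
  show ?thesis by (rule minus_equality) auto
qed

lemma twisted_act_pow_tau:
  fixes v :: "('k :: {finite, field}) alg_closure"
  shows "twisted_act (twisted_tau [^]\<^bsub>twisted_ring\<^esub> (i::nat)) v = v ^ (CARD('k) ^ i)"
proof (induction i arbitrary: v)
  case (Suc i)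
  then show ?case
    by (simp add: nat_pow_def twisted_act_mult twisted_act_tau power_mult)
qed (simp add: nat_pow_def)

lemma twisted_act_pow_tau_pow:
  fixes v :: "('k :: {finite, field}) alg_closure"
  shows "twisted_act ((twisted_tau [^]\<^bsub>twisted_ring\<^esub> (r::nat)) [^]\<^bsub>twisted_ring\<^esub> (j::nat)) v = v ^ (CARD('k) ^ (r * j))"
proof (induction j arbitrary: v)
  case (Suc j)
  have "twisted_act ((twisted_tau [^]\<^bsub>twisted_ring\<^esub> r) [^]\<^bsub>twisted_ring\<^esub> Suc j) v =
     twisted_act ((twisted_tau [^]\<^bsub>twisted_ring\<^esub> r) [^]\<^bsub>twisted_ring\<^esub> j)
       (twisted_act (twisted_tau [^]\<^bsub>twisted_ring\<^esub> r) v)"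
    by (simp add: nat_pow_def[of twisted_ring _ "Suc j"] nat_pow_def[of twisted_ring _ j] twisted_act_mult)
  then show ?case unfolding Suc twisted_act_pow_tau frob_mult_exp[symmetric] by simp
qed (simp add: nat_pow_def)

lemma coeff_twisted_linear_mult:
  fixes t :: "('k :: {finite, field}) alg_closure"
  shows "Polynomial.coeff (twisted_mult ([:t:] + Polynomial.monom 1 n) f) i =
    t * Polynomial.coeff f i + (if n \<le> i then Polynomial.coeff f (i - n) ^ (CARD('k) ^ n) else 0)"
proof -
  define g where "g = (\<Sum>j\<le>Polynomial.degree f.
    Polynomial.monom (t * Polynomial.coeff f j) j + Polynomial.monom (Polynomial.coeff f j ^ (CARD('k) ^ n)) (n + j))"
  have "twisted_mult ([:t:] + Polynomial.monom 1 n) f = g"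
  proof (rule twisted_act_inject)
    fix v :: "'k alg_closure"
    have "twisted_act g v = (\<Sum>j\<le>Polynomial.degree f. t * (Polynomial.coeff f j * v ^ (CARD('k) ^ j))
        + (Polynomial.coeff f j * v ^ (CARD('k) ^ j)) ^ (CARD('k) ^ n))"
      unfolding g_def twisted_act_sum_poly twisted_act_add_poly twisted_act_monom
      by (rule sum.cong[OF refl])
        (simp add: power_mult_distrib frob_mult_exp[symmetric] add.commute mult.assoc)
    also have "\<dots> = t * twisted_act f v + twisted_act f v ^ (CARD('k) ^ n)"
      unfolding twisted_act_def frob_sum by (simp add: sum.distrib sum_distrib_left)
    finally show "twisted_act (twisted_mult ([:t:] + Polynomial.monom 1 n) f) v = twisted_act g v"
      by (simp add: twisted_act_mult twisted_act_add_poly twisted_act_const twisted_act_monom)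
  qed
  moreover have "Polynomial.coeff g i = t * Polynomial.coeff f i +
    (if n \<le> i then Polynomial.coeff f (i - n) ^ (CARD('k) ^ n) else 0)"
  proof -
    have "(\<Sum>j\<le>Polynomial.degree f. if j = i then t * Polynomial.coeff f j else 0) = t * Polynomial.coeff f i"
      by (simp add: coeff_eq_0)
    moreover have "(\<Sum>j\<le>Polynomial.degree f. if n + j = i then Polynomial.coeff f j ^ (CARD('k) ^ n) else 0)
      = (if n \<le> i then Polynomial.coeff f (i - n) ^ (CARD('k) ^ n) else 0)"
    proof (cases "n \<le> i")
      case True
      then have "(n + j = i) = (j = i - n)" for j by auto
      then show ?thesis using True by (simp add: coeff_eq_0 power_0_left)
    next
      case False
      then show ?thesis by (auto intro: sum.neutral)
    qed
    ultimately show ?thesis unfolding g_def coeff_sum coeff_add coeff_monom sum.distrib by simp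
  qed
  ultimately show ?thesis by simp
qed

section \<open>Irreducible polynomials over a field\<close>

text \<open>
  A nonzero combination \<open>a * x + p * y\<close> of least degree divides all combinations, in particular \<open>a\<close>
  and \<open>p\<close>.  Since \<open>p\<close> is irreducible and does not divide \<open>a\<close>, it is a unit.
\<close>

lemma irreducible_poly_bezout:
  fixes p a :: "'k :: field poly"
  assumes p: "Factorial_Ring.irreducible p" and a: "\<not> p dvd a"
  shows "\<exists>x y. a * x + p * y = 1"
proof -
  define J where "J = {f. f \<noteq> 0 \<and> (\<exists>x y. f = a * x + p * y)}"
  have "p = a * 0 + p * 1" "p \<noteq> 0" using p by auto
  then have "p \<in> J" unfolding J_def by blast
  then obtain f where f: "f \<in> J" "\<And>g. g \<in> J \<Longrightarrow> Polynomial.degree f \<le> Polynomial.degree g"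
    using ex_has_least_nat[of "\<lambda>f. f \<in> J" p Polynomial.degree] by blast
  obtain x y where xy: "f = a * x + p * y" and f0: "f \<noteq> 0" using f(1) unfolding J_def by blast
  have dvd: "f dvd g" if g: "g = a * u + p * w" for g u w
  proof (rule ccontr)
    assume "\<not> f dvd g"
    then have "g mod f \<noteq> 0" by (simp add: mod_eq_0_iff_dvd)
    moreover have "g mod f = a * (u - (g div f) * x) + p * (w - (g div f) * y)"
    proof -
      have "g mod f = g - (g div f) * f" by (simp add: minus_div_mult_eq_mod)
      then show ?thesis unfolding g xy by (simp add: algebra_simps)
    qed
    ultimately have "g mod f \<in> J" unfolding J_def by blast
    moreover have "Polynomial.degree (g mod f) < Polynomial.degree f"
      using degree_mod_less'[OF f0 \<open>g mod f \<noteq> 0\<close>] .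
    ultimately show False using f(2) by fastforce
  qed
  have fa: "f dvd a" using dvd[of a 1 0] by simp
  have "f dvd p" using dvd[of p 0 1] by simp
  then obtain h where h: "p = f * h" by (elim dvdE)
  have "is_unit f"
  proof (rule ccontr)
    assume "\<not> is_unit f"
    then have "is_unit h" using Factorial_Ring.irreducibleD[OF p h] by blast
    then have "p dvd f" using h by (metis dvd_refl mult_unit_dvd_iff)
    then show False using fa a dvd_trans by blast
  qed
  then obtain g where "1 = f * g" by (elim dvdE)
  then have "a * (x * g) + p * (y * g) = 1" unfolding xy by (simp add: algebra_simps)
  then show ?thesis by blast
qed

lemma monic_irreducible_dvd_imp_eq:
  fixes p p' :: "'k :: field poly"
  assumes "Factorial_Ring.irreducible p'" "\<not> is_unit p" "lead_coeff p = 1" "lead_coeff p' = 1" "p dvd p'"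
  shows "p = p'"
proof -
  obtain u where u: "p' = p * u" using assms(5) by (elim dvdE)
  then have "is_unit u" using Factorial_Ring.irreducibleD[OF assms(1) u] assms(2) by blast
  then obtain c where c: "u = [:c:]" by (metis is_unit_poly_iff)
  have "lead_coeff p' = lead_coeff p * lead_coeff u" unfolding u by (rule lead_coeff_mult)
  then have "c = 1" using assms(3,4) c by simp
  then show ?thesis using u c by simp
qed

lemma coeff_sum_monom:
  "Polynomial.coeff (\<Sum>i<d. Polynomial.monom (c i) i) j = (if j < d then c j else (0 :: 'a :: comm_monoid_add))"
  by (simp add: coeff_sum)

section \<open>Torsion of the Drinfeld module\<close>

text \<open>
  The condition \<open>pt\<close> says that \<open>p\<close> is not the characteristic of \<open>\<phi>\<close>; it makes the \<open>p\<close>-torsion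
  separable.
\<close>

locale drinfeld_torsion =
  fixes n r :: nat
    and p :: "('k :: {finite, field}) poly"
    and t :: "'k alg_closure"
    and \<phi> :: "'k poly \<Rightarrow> 'k alg_closure poly"
  assumes n: "n \<ge> 1" and cop: "coprime r n"
    and t: "t \<in> subfield_GF r"
    and \<phi>_hom: "\<phi> \<in> ring_hom poly_A twisted_ring" and \<phi>_const: "\<And>c. \<phi> [:c:] = twisted_const (to_ac c)"
    and \<phi>_T: "\<phi> [:0, 1:] = twisted_const t \<oplus>\<^bsub>twisted_ring\<^esub> twisted_tau [^]\<^bsub>twisted_ring\<^esub> n"
    and p: "Factorial_Ring.irreducible p" and pt: "poly (map_poly to_ac p) t \<noteq> 0"
begin

lemma \<phi>_add: "\<phi> (a + b) = \<phi> a + \<phi> b"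
  using ring_hom_add[OF \<phi>_hom, of a b] by (simp add: ring_of_type_algebra_def)

lemma \<phi>_mult: "\<phi> (a * b) = twisted_mult (\<phi> a) (\<phi> b)"
  using ring_hom_mult[OF \<phi>_hom, of a b] by (simp add: ring_of_type_algebra_def)

lemma \<phi>_0 [simp]: "\<phi> 0 = 0"
proof -
  have "\<phi> 0 = \<phi> 0 + \<phi> 0" using \<phi>_add[of 0 0] by (simp only: add_0)
  then show ?thesis by (metis add_cancel_left_right)
qed

lemma \<phi>_minus: "\<phi> (- a) = - \<phi> a"
  using \<phi>_add[of a "- a"] by (simp add: eq_neg_iff_add_eq_0 add.commute)

lemma tau_pow: "twisted_tau [^]\<^bsub>twisted_ring\<^esub> i = (Polynomial.monom 1 i :: 'k alg_closure poly)"
  by (rule twisted_act_inject) (simp add: twisted_act_pow_tau twisted_act_monom)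

lemma \<phi>_pCons: "\<phi> (pCons c a) = [:to_ac c:] + twisted_mult ([:t:] + Polynomial.monom 1 n) (\<phi> a)"
proof -
  have "pCons c a = [:c:] + [:0, 1:] * a" by simp
  then have "\<phi> (pCons c a) = \<phi> [:c:] + twisted_mult (\<phi> [:0, 1:]) (\<phi> a)"
    using \<phi>_add \<phi>_mult by metis
  then show ?thesis unfolding \<phi>_const \<phi>_T tau_pow by (simp add: twisted_const_def)
qed

lemma coeff_\<phi>_pCons: "Polynomial.coeff (\<phi> (pCons c a)) i = (if i = 0 then to_ac c else 0) +
  (t * Polynomial.coeff (\<phi> a) i + (if n \<le> i then Polynomial.coeff (\<phi> a) (i - n) ^ (CARD('k) ^ n) else 0))"
  unfolding \<phi>_pCons coeff_add coeff_twisted_linear_mult by (simp add: coeff_pCons split: nat.splits)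

text \<open>
  The constant coefficient is multiplicative, and \<open>\<phi> T\<close> has constant coefficient \<open>t\<close>.
\<close>

lemma coeff_\<phi>_0: "Polynomial.coeff (\<phi> a) 0 = poly (map_poly to_ac a) t"
proof (induction a)
  case (pCons c a)
  have "map_poly to_ac (pCons c a) = pCons (to_ac c) (map_poly to_ac a)" by (simp add: map_poly_pCons)
  then show ?case using pCons n by (simp add: coeff_\<phi>_pCons)
qed simp

lemma degree_\<phi>:
  assumes "a \<noteq> 0"
  shows "Polynomial.degree (\<phi> a) = n * Polynomial.degree a" "Polynomial.coeff (\<phi> a) (n * Polynomial.degree a) \<noteq> 0"
proof -
  have "(\<forall>i > n * Polynomial.degree a. Polynomial.coeff (\<phi> a) i = 0) \<and>
    Polynomial.coeff (\<phi> a) (n * Polynomial.degree a) \<noteq> 0"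
    using assms
  proof (induction a)
    case (pCons c a)
    show ?case
    proof (cases "a = 0")
      case True
      then show ?thesis using pCons.hyps pCons.prems n by (auto simp: coeff_\<phi>_pCons power_0_left)
    next
      case False
      then have IH: "\<And>i. i > n * Polynomial.degree a \<Longrightarrow> Polynomial.coeff (\<phi> a) i = 0"
        "Polynomial.coeff (\<phi> a) (n * Polynomial.degree a) \<noteq> 0" using pCons.IH by auto
      have d: "n * Polynomial.degree (pCons c a) = n * Polynomial.degree a + n" using False by simp
      show ?thesis unfolding d
      proof (intro conjI allI impI)
        fix i assume i: "n * Polynomial.degree a + n < i"
        then have "i - n > n * Polynomial.degree a" "i > n * Polynomial.degree a" "i \<noteq> 0" by auto
        then show "Polynomial.coeff (\<phi> (pCons c a)) i = 0"
          using IH(1) by (simp add: coeff_\<phi>_pCons power_0_left)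
      next
        show "Polynomial.coeff (\<phi> (pCons c a)) (n * Polynomial.degree a + n) \<noteq> 0"
          using IH n by (simp add: coeff_\<phi>_pCons)
      qed
    qed
  qed simp
  then have 1: "\<And>i. i > n * Polynomial.degree a \<Longrightarrow> Polynomial.coeff (\<phi> a) i = 0"
    and 2: "Polynomial.coeff (\<phi> a) (n * Polynomial.degree a) \<noteq> 0" by auto
  show "Polynomial.coeff (\<phi> a) (n * Polynomial.degree a) \<noteq> 0" by (rule 2)
  show "Polynomial.degree (\<phi> a) = n * Polynomial.degree a"
    by (rule antisym[OF degree_le le_degree[OF 2]]) (use 1 in auto)
qed

definition act :: "'k poly \<Rightarrow> 'k alg_closure \<Rightarrow> 'k alg_closure" where "act a v = twisted_act (\<phi> a) v"

lemma act_add_left: "act (a + b) v = act a v + act b v"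
  unfolding act_def \<phi>_add twisted_act_add_poly ..

lemma act_minus_left: "act (- a) v = - act a v"
  unfolding act_def \<phi>_minus twisted_act_minus_poly ..

lemma act_diff_left: "act (a - b) v = act a v - act b v"
  using act_add_left[of a "- b"] act_minus_left by simp

lemma act_mult: "act (a * b) v = act a (act b v)"
  unfolding act_def \<phi>_mult twisted_act_mult ..

lemma act_add: "act a (v + w) = act a v + act a w"
  unfolding act_def twisted_act_add ..

lemma act_minus: "act a (- v) = - act a v"
  unfolding act_def twisted_act_minus ..

lemma act_zero [simp]: "act a 0 = 0" unfolding act_def by simp

lemma act_zero_left [simp]: "act 0 v = 0" unfolding act_def by simp

lemma act_const: "act [:c:] v = to_ac c * v"
  unfolding act_def \<phi>_const twisted_const_def twisted_act_const ..

lemma act_1 [simp]: "act 1 v = v"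
  using act_const[of 1 v] by (simp add: one_pCons)

lemma act_T: "act [:0, 1:] v = t * v + v ^ (CARD('k) ^ n)"
  unfolding act_def \<phi>_T
  by (simp add: twisted_act_add_poly twisted_const_def twisted_act_const twisted_act_pow_tau)

lemma act_pCons: "act (pCons c a) v = to_ac c * v + act [:0, 1:] (act a v)"
proof -
  have "pCons c a = [:c:] + [:0, 1:] * a" by simp
  then show ?thesis using act_add_left act_mult act_const by metis
qed

lemma act_commute: "act a (act b v) = act b (act a v)"
  using act_mult[of a b v] act_mult[of b a v] by (simp add: mult.commute)

lemma act_GF:
  assumes z: "z \<in> subfield_GF n"
  shows "act a (z * v) = z * act a v"
proof (induction a arbitrary: v)
  case (pCons c a)
  have T: "act [:0, 1:] (z * w) = z * act [:0, 1:] w" for w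
    using z unfolding act_T subfield_GF_def by (simp add: power_mult_distrib algebra_simps)
  show ?case unfolding act_pCons[of c a] pCons T by (simp add: algebra_simps)
qed simp

lemma act_frob: "act a (v ^ (CARD('k) ^ (r * i))) = act a v ^ (CARD('k) ^ (r * i))"
proof (induction a arbitrary: v)
  case (pCons c a)
  have T: "act [:0, 1:] (w ^ (CARD('k) ^ (r * i))) = act [:0, 1:] w ^ (CARD('k) ^ (r * i))" for w
  proof -
    have "(t * w + w ^ (CARD('k) ^ n)) ^ (CARD('k) ^ (r * i)) =
        t * w ^ (CARD('k) ^ (r * i)) + (w ^ (CARD('k) ^ n)) ^ (CARD('k) ^ (r * i))"
      unfolding frob_add power_mult_distrib subfield_GF_power_mult[OF t] ..
    also have "(w ^ (CARD('k) ^ n)) ^ (CARD('k) ^ (r * i)) = (w ^ (CARD('k) ^ (r * i))) ^ (CARD('k) ^ n)"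
      by (simp add: power_mult[symmetric] mult.commute)
    finally show ?thesis unfolding act_T by simp
  qed
  show ?case unfolding act_pCons[of c a] frob_add power_mult_distrib to_ac_frob pCons T ..
qed (simp add: power_0_left)

definition V :: "'k alg_closure set" where "V = {v. act p v = 0}"

lemma card_V: "card V = CARD('k) ^ (n * Polynomial.degree p)"
proof -
  have "Polynomial.coeff (\<phi> p) 0 \<noteq> 0" unfolding coeff_\<phi>_0 by (rule pt)
  moreover have "p \<noteq> 0" using p by auto
  ultimately show ?thesis using card_kernel_twisted[of "\<phi> p"] degree_\<phi>(1)[of p]
    unfolding V_def act_def by simp
qed

lemma degree_p: "Polynomial.degree p > 0"
  using p by (metis Factorial_Ring.irreducible_def is_unit_iff_degree not_gr0)

lemma finite_V: "finite V"
  using card_V by (metis card.infinite less_nat_zero_code power_eq_0_iff zero_less_card_finite)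

lemma V_zero: "0 \<in> V" unfolding V_def by simp
lemma V_add: "v \<in> V \<Longrightarrow> w \<in> V \<Longrightarrow> v + w \<in> V" unfolding V_def by (simp add: act_add)
lemma V_minus: "v \<in> V \<Longrightarrow> - v \<in> V" unfolding V_def by (simp add: act_minus)
lemma V_act: "v \<in> V \<Longrightarrow> act a v \<in> V" unfolding V_def by (simp add: act_commute[of p])
lemma V_GF: "v \<in> V \<Longrightarrow> z \<in> subfield_GF n \<Longrightarrow> z * v \<in> V" unfolding V_def by (simp add: act_GF)
lemma V_frob: "v \<in> V \<Longrightarrow> v ^ (CARD('k) ^ (r * i)) \<in> V" unfolding V_def by (simp add: act_frob power_0_left)

text \<open>
  The Frobenius is injective on the field and maps the finite set \<open>V\<close> to itself.
\<close>

lemma frob_bij: "bij_betw (\<lambda>v. v ^ (CARD('k) ^ (r * i))) V V"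
proof -
  have inj: "inj_on (\<lambda>v. v ^ (CARD('k) ^ (r * i))) V"
    by (rule inj_onI) (rule frob_inj)
  have "(\<lambda>v. v ^ (CARD('k) ^ (r * i))) ` V \<subseteq> V" using V_frob by auto
  then have "(\<lambda>v. v ^ (CARD('k) ^ (r * i))) ` V = V" by (rule endo_inj_surj[OF finite_V _ inj])
  then show ?thesis using inj unfolding bij_betw_def by blast
qed

lemma V_nontrivial: "\<exists>v\<in>V. v \<noteq> 0"
proof (rule ccontr)
  assume "\<not> (\<exists>v\<in>V. v \<noteq> 0)"
  then have "V \<subseteq> {0}" by blast
  then have "card V \<le> 1" using card_mono[of "{0}" V] by simp
  moreover have "card V > 1" unfolding card_V using n degree_p card_gt_1[where 'k = 'k]
    by (intro one_less_power) auto
  ultimately show False by simp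
qed

definition M :: "('k poly set, 'k alg_closure) module" where "M = torsion_module \<phi> p"
definition \<kappa> :: "'k poly set ring" where "\<kappa> = residue_field p"
definition E :: "('k alg_closure \<Rightarrow> 'k alg_closure) ring" where "E = module_End \<kappa> M"
definition residue_class :: "'k poly \<Rightarrow> 'k poly set" where
  "residue_class a = (PIdl\<^bsub>poly_A\<^esub> p) +>\<^bsub>poly_A\<^esub> a"

lemma M_simps [simp]: "carrier M = V" "\<zero>\<^bsub>M\<^esub> = 0" "v \<oplus>\<^bsub>M\<^esub> w = v + w"
  by (auto simp: M_def torsion_module_def V_def act_def)

lemma poly_A_simps [simp]: "carrier (poly_A :: 'k poly ring) = UNIV" "a \<otimes>\<^bsub>poly_A\<^esub> b = a * b"
  "a \<oplus>\<^bsub>poly_A\<^esub> b = a + b" "\<one>\<^bsub>poly_A\<^esub> = (1 :: 'k poly)" "\<zero>\<^bsub>poly_A\<^esub> = (0 :: 'k poly)" for a b :: "'k poly"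
  by (simp_all add: ring_of_type_algebra_def)

lemma poly_A_cring: "cring (poly_A :: 'k poly ring)" by (rule cring_from_type_algebra)

lemma p_ideal: "ideal (PIdl\<^bsub>poly_A\<^esub> p) poly_A"
  by (rule cring.cgenideal_ideal[OF poly_A_cring]) simp

lemma \<kappa>_cring: "cring \<kappa>"
  unfolding \<kappa>_def residue_field_def by (rule ideal.quotient_is_cring[OF p_ideal poly_A_cring])

lemma residue_class_hom: "residue_class \<in> ring_hom poly_A \<kappa>"
  using ideal.rcos_ring_hom[OF p_ideal] unfolding residue_class_def[abs_def] \<kappa>_def residue_field_def .

lemma carrier_\<kappa>: "carrier \<kappa> = range residue_class"
  unfolding \<kappa>_def residue_field_def FactRing_def A_RCOSETS_def RCOSETS_def residue_class_def[abs_def]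
    a_r_coset_def by auto

lemma mem_residue_class: "b \<in> residue_class a \<longleftrightarrow> (\<exists>y. b = y * p + a)"
  unfolding residue_class_def a_r_coset_def r_coset_def cgenideal_def by auto

lemma smult_residue_class:
  assumes v: "v \<in> V" shows "residue_class a \<odot>\<^bsub>M\<^esub> v = act a v"
proof -
  have "twisted_act (\<phi> b) v = act a v" if b: "b \<in> residue_class a" for b
  proof -
    obtain y where "b = y * p + a" using b unfolding mem_residue_class by blast
    then have "act b v = act a v" using v by (simp add: act_add_left act_mult V_def)
    then show ?thesis unfolding act_def .
  qed
  moreover have "a \<in> residue_class a" unfolding mem_residue_class by (rule exI[of _ 0]) simp
  ultimately have "(\<lambda>b. twisted_act (\<phi> b) v) ` residue_class a = {act a v}"
    by (intro antisym image_subsetI) (auto intro!: image_eqI[of _ _ a])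
  then show ?thesis by (simp add: M_def torsion_module_def)
qed

lemma M_module: "module \<kappa> M"
proof (rule moduleI[OF \<kappa>_cring])
  show "abelian_group M"
  proof (rule abelian_groupI)
    fix v assume "v \<in> carrier M"
    then show "\<exists>w\<in>carrier M. w \<oplus>\<^bsub>M\<^esub> v = \<zero>\<^bsub>M\<^esub>" by (intro bexI[of _ "- v"]) (auto simp: V_minus)
  qed (auto simp: V_zero V_add algebra_simps)
  fix C v assume "C \<in> carrier \<kappa>" "v \<in> carrier M"
  then obtain a where a: "C = residue_class a" "v \<in> V" unfolding carrier_\<kappa> by auto
  show "C \<odot>\<^bsub>M\<^esub> v \<in> carrier M" using a smult_residue_class V_act by simp
  show "C \<odot>\<^bsub>M\<^esub> (v \<oplus>\<^bsub>M\<^esub> w) = C \<odot>\<^bsub>M\<^esub> v \<oplus>\<^bsub>M\<^esub> C \<odot>\<^bsub>M\<^esub> w" if "w \<in> carrier M" for w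
    using a that by (simp add: smult_residue_class V_add act_add)
  fix D assume "D \<in> carrier \<kappa>"
  then obtain b where b: "D = residue_class b" unfolding carrier_\<kappa> by auto
  have "C \<oplus>\<^bsub>\<kappa>\<^esub> D = residue_class (a + b)" using ring_hom_add[OF residue_class_hom, of a b] a b by simp
  then show "(C \<oplus>\<^bsub>\<kappa>\<^esub> D) \<odot>\<^bsub>M\<^esub> v = C \<odot>\<^bsub>M\<^esub> v \<oplus>\<^bsub>M\<^esub> D \<odot>\<^bsub>M\<^esub> v"
    using a b by (simp add: smult_residue_class act_add_left)
  have "C \<otimes>\<^bsub>\<kappa>\<^esub> D = residue_class (a * b)" using ring_hom_mult[OF residue_class_hom, of a b] a b by simp
  then show "(C \<otimes>\<^bsub>\<kappa>\<^esub> D) \<odot>\<^bsub>M\<^esub> v = C \<odot>\<^bsub>M\<^esub> (D \<odot>\<^bsub>M\<^esub> v)"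
    using a b by (simp add: smult_residue_class act_mult V_act)
next
  fix v assume "v \<in> carrier M"
  moreover have "\<one>\<^bsub>\<kappa>\<^esub> = residue_class 1" using ring_hom_one[OF residue_class_hom] by simp
  ultimately show "\<one>\<^bsub>\<kappa>\<^esub> \<odot>\<^bsub>M\<^esub> v = v" by (simp add: smult_residue_class)
qed

sublocale kM: module \<kappa> M by (rule M_module)
sublocale E: ring E unfolding E_def by (rule kM.End_ring_is_ring)

lemma E_mem: "f \<in> carrier E \<longleftrightarrow> f \<in> V \<rightarrow>\<^sub>E V \<and> (\<forall>v\<in>V. \<forall>w\<in>V. f (v + w) = f v + f w) \<and>
    (\<forall>a. \<forall>v\<in>V. f (act a v) = act a (f v))"
proof -
  have "(\<forall>c\<in>carrier \<kappa>. \<forall>x\<in>V. f (c \<odot>\<^bsub>M\<^esub> x) = c \<odot>\<^bsub>M\<^esub> f x) \<longleftrightarrow> (\<forall>a. \<forall>v\<in>V. f (act a v) = act a (f v))"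
    if "f \<in> V \<rightarrow>\<^sub>E V"
    by (simp add: carrier_\<kappa> smult_residue_class PiE_mem[OF that])
  then show ?thesis unfolding E_def module_End_def by auto
qed

lemma E_closed: "f \<in> carrier E \<Longrightarrow> v \<in> V \<Longrightarrow> f v \<in> V"
  and E_act: "f \<in> carrier E \<Longrightarrow> v \<in> V \<Longrightarrow> f (act a v) = act a (f v)"
  unfolding E_mem by auto

lemma E_apply: "v \<in> V \<Longrightarrow> (f \<otimes>\<^bsub>E\<^esub> g) v = f (g v)" "v \<in> V \<Longrightarrow> (f \<oplus>\<^bsub>E\<^esub> g) v = f v + g v"
  "v \<in> V \<Longrightarrow> \<one>\<^bsub>E\<^esub> v = v" "v \<in> V \<Longrightarrow> \<zero>\<^bsub>E\<^esub> v = 0"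
  unfolding E_def using kM.End_apply by auto

lemma E_eqI: "f \<in> carrier E \<Longrightarrow> g \<in> carrier E \<Longrightarrow> (\<And>v. v \<in> V \<Longrightarrow> f v = g v) \<Longrightarrow> f = g"
  unfolding E_def using kM.End_eqI by simp

lemma E_minus: "f \<in> carrier E \<Longrightarrow> v \<in> V \<Longrightarrow> (\<ominus>\<^bsub>E\<^esub> f) v = - f v"
proof -
  assume f: "f \<in> carrier E" and v: "v \<in> V"
  have "(\<ominus>\<^bsub>E\<^esub> f \<oplus>\<^bsub>E\<^esub> f) v = 0" using f v E.l_neg E_apply by simp
  then show ?thesis using v by (simp add: E_apply eq_neg_iff_add_eq_0)
qed

lemma E_finsum:
  assumes "finite A" "f \<in> A \<rightarrow> carrier E" "v \<in> V"
  shows "(\<Oplus>\<^bsub>E\<^esub>j\<in>A. f j) v = (\<Sum>j\<in>A. f j v)"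
  using assms(1,2)
proof (induction A)
  case (insert j A)
  have "(\<Oplus>\<^bsub>E\<^esub>j\<in>insert j A. f j) = f j \<oplus>\<^bsub>E\<^esub> (\<Oplus>\<^bsub>E\<^esub>j\<in>A. f j)"
    by (rule E.finsum_insert) (use insert in auto)
  then show ?case using insert assms(3) by (simp add: E_apply)
qed (use assms(3) in \<open>simp add: E_apply\<close>)

lemma E_zero_def: "\<zero>\<^bsub>E\<^esub> = (\<lambda>v\<in>V. 0)"
  unfolding E_def module_End_def by simp

text \<open>
  The operators by which the residue field acts.
\<close>

definition sop :: "'k poly \<Rightarrow> 'k alg_closure \<Rightarrow> 'k alg_closure" where "sop a = (\<lambda>v\<in>V. act a v)"
text \<open>
  The operator of \<open>\<pi>^i\<close>.
\<close>

definition fr :: "nat \<Rightarrow> 'k alg_closure \<Rightarrow> 'k alg_closure" where "fr i = (\<lambda>v\<in>V. v ^ (CARD('k) ^ (r * i)))"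

lemma scalar_ops_eq: "scalar_ops \<kappa> M = range sop"
  unfolding scalar_ops_def carrier_\<kappa> sop_def[abs_def] image_image
  by (rule image_cong[OF refl]) (auto simp: smult_residue_class)

lemma const_op_eq: "const_op M z = (\<lambda>v\<in>V. z * v)" unfolding const_op_def by simp

lemma op_apply: "v \<in> V \<Longrightarrow> sop a v = act a v" "v \<in> V \<Longrightarrow> fr i v = v ^ (CARD('k) ^ (r * i))"
  "v \<in> V \<Longrightarrow> const_op M z v = z * v"
  by (simp_all add: sop_def fr_def const_op_eq)

lemma sop_in_E: "sop a \<in> carrier E"
  unfolding E_mem by (auto simp: sop_def V_act V_add act_add act_commute)

lemma fr_in_E: "fr i \<in> carrier E"
  unfolding E_mem by (auto simp: fr_def V_frob V_add V_act frob_add act_frob)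

lemma const_in_E: "z \<in> subfield_GF n \<Longrightarrow> const_op M z \<in> carrier E"
  unfolding E_mem const_op_eq by (auto simp: V_GF V_add V_act distrib_left act_GF)

lemma fr_power: "fr i [^]\<^bsub>E\<^esub> (j::nat) = fr (i * j)"
proof (induction j)
  case 0
  show ?case by (rule E_eqI) (auto simp: fr_in_E E_apply op_apply)
next
  case (Suc j)
  show ?case
    by (rule E_eqI)
      (auto simp: Suc fr_in_E E_apply op_apply V_frob frob_mult_exp[symmetric] add_mult_distrib2[symmetric] add.commute)
qed

lemma sop_ops: "sop (a + b) = sop a \<oplus>\<^bsub>E\<^esub> sop b" "sop (a * b) = sop a \<otimes>\<^bsub>E\<^esub> sop b"
  "sop (- a) = \<ominus>\<^bsub>E\<^esub> sop a" "sop 1 = \<one>\<^bsub>E\<^esub>" "sop 0 = \<zero>\<^bsub>E\<^esub>"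
  by (rule E_eqI; auto simp: sop_in_E E_apply op_apply V_act act_add_left act_mult act_minus_left E_minus)+

lemma sop_subring: "subring (range sop) E"
proof (rule E.subringI)
  show "range sop \<subseteq> carrier E" using sop_in_E by blast
  show "\<one>\<^bsub>E\<^esub> \<in> range sop" using sop_ops(4) by (metis rangeI)
  show "\<ominus>\<^bsub>E\<^esub> h \<in> range sop" if "h \<in> range sop" for h using that by (auto simp: sop_ops(3)[symmetric])
  fix h g assume "h \<in> range sop" "g \<in> range sop"
  then show "h \<otimes>\<^bsub>E\<^esub> g \<in> range sop" "h \<oplus>\<^bsub>E\<^esub> g \<in> range sop"
    by (auto simp: sop_ops(1,2)[symmetric])
qed

lemma sop_multiple: assumes "p dvd a" shows "sop a = \<zero>\<^bsub>E\<^esub>"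
proof (rule E_eqI)
  obtain b where b: "a = b * p" using assms by (metis dvdE mult.commute)
  fix v assume v: "v \<in> V"
  then have "act a v = 0" unfolding b act_mult by (simp add: V_def)
  then show "sop a v = \<zero>\<^bsub>E\<^esub> v" using v by (simp add: op_apply E_apply)
qed (auto simp: sop_in_E)

text \<open>
  The operator of \<open>p\<close> is zero, so a Bezout relation modulo \<open>p\<close> gives an inverse.
\<close>

lemma sop_inverse:
  assumes "\<not> p dvd a" shows "\<exists>b. sop b \<otimes>\<^bsub>E\<^esub> sop a = \<one>\<^bsub>E\<^esub>"
proof -
  obtain x y where xy: "a * x + p * y = 1" using irreducible_poly_bezout[OF p assms] by blast
  have "sop x \<otimes>\<^bsub>E\<^esub> sop a = sop (a * x + p * y)"
    using sop_multiple[of "p * y"] sop_in_E sop_ops(1)[of "a * x" "p * y"] sop_ops(2)[of x a]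
    by (simp add: mult.commute)
  then show ?thesis using xy sop_ops by auto
qed

lemma finite_E: "finite (carrier E)"
proof (rule finite_subset)
  show "carrier E \<subseteq> V \<rightarrow>\<^sub>E V" by (auto simp: E_mem)
  show "finite (V \<rightarrow>\<^sub>E V)" using finite_V by (intro finite_PiE) auto
qed

lemma finite_sop: "finite (range sop)"
  by (rule finite_subset[OF _ finite_E]) (use sop_in_E in auto)

text \<open>
  Different polynomials of degree below that of \<open>p\<close> act differently: the difference of two of them
  that act equally is not invertible on the nonzero module \<open>V\<close>, so it is divisible by \<open>p\<close>.
\<close>

lemma card_sop: "CARD('k) ^ Polynomial.degree p \<le> card (range sop)"
proof -
  define F :: "(nat \<Rightarrow> 'k) \<Rightarrow> 'k poly" where "F c = (\<Sum>i<Polynomial.degree p. Polynomial.monom (c i) i)" for c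
  have co: "Polynomial.coeff (F c) i = (if i < Polynomial.degree p then c i else 0)" for c i
    unfolding F_def by (rule coeff_sum_monom)
  have "inj_on (sop \<circ> F) ({..<Polynomial.degree p} \<rightarrow>\<^sub>E UNIV)"
  proof (rule inj_onI)
    fix c e assume c: "c \<in> {..<Polynomial.degree p} \<rightarrow>\<^sub>E (UNIV :: 'k set)"
      and e: "e \<in> {..<Polynomial.degree p} \<rightarrow>\<^sub>E (UNIV :: 'k set)" and eq: "(sop \<circ> F) c = (sop \<circ> F) e"
    have "p dvd F c - F e"
    proof (rule ccontr)
      assume "\<not> p dvd F c - F e"
      then obtain b where b: "sop b \<otimes>\<^bsub>E\<^esub> sop (F c - F e) = \<one>\<^bsub>E\<^esub>" using sop_inverse by blast
      obtain v where v: "v \<in> V" "v \<noteq> 0" using V_nontrivial by blast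
      have "sop (F c) v = sop (F e) v" using eq by simp
      then have "act (F c - F e) v = 0" using v by (simp add: op_apply act_diff_left)
      then have "(sop b \<otimes>\<^bsub>E\<^esub> sop (F c - F e)) v = 0" using v by (simp add: E_apply op_apply V_zero)
      then show False using b v by (simp add: E_apply)
    qed
    moreover have "Polynomial.degree (F c - F e) \<le> Polynomial.degree p - 1"
      by (rule degree_le) (auto simp: co)
    ultimately have "F c - F e = 0" using dvd_imp_degree_le[of p "F c - F e"] degree_p by fastforce
    then have "F c = F e" by simp
    show "c = e"
    proof (rule PiE_ext[OF c e])
      fix i assume "i \<in> {..<Polynomial.degree p}"
      then show "c i = e i" using co[of c i] co[of e i] \<open>F c = F e\<close> by simp
    qed
  qed
  then have "card ({..<Polynomial.degree p} \<rightarrow>\<^sub>E (UNIV :: 'k set)) \<le> card (range sop)"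
    by (rule card_inj_on_le) (auto simp: finite_sop)
  then show ?thesis by (simp add: card_PiE)
qed

end

section \<open>Operators generated by a power of the Frobenius\<close>

context drinfeld_torsion
begin

text \<open>
  The ring generated by \<open>\<pi>^i\<close> over the scalars.  The ring \<open>S\<close> of the theorem is \<open>Sgen 1\<close>, and \<open>R0\<close> is
  \<open>Sgen m\<close>.
\<close>

definition Sgen :: "nat \<Rightarrow> ('k alg_closure \<Rightarrow> 'k alg_closure) set" where
  "Sgen i = generate_ring E (insert (fr i) (range sop))"

lemma gens_in_E: "insert (fr i) (range sop) \<subseteq> carrier E" using fr_in_E sop_in_E by auto

lemma Sgen_subring: "subring (Sgen i) E"
  unfolding Sgen_def by (rule E.generate_ring_is_subring[OF gens_in_E])

lemma Sgen_in_E: "x \<in> Sgen i \<Longrightarrow> x \<in> carrier E"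
  by (rule subsetD[OF subringE(1)[OF Sgen_subring]])

lemma sop_in_Sgen: "sop a \<in> Sgen i" and fr_in_Sgen: "fr i \<in> Sgen i"
  unfolding Sgen_def by (auto intro: generate_ring.incl)

lemma sop_sop_commute: "sop a \<otimes>\<^bsub>E\<^esub> sop b = sop b \<otimes>\<^bsub>E\<^esub> sop a"
  unfolding sop_ops(2)[symmetric] by (simp add: mult.commute)

lemma sop_fr_commute: "sop a \<otimes>\<^bsub>E\<^esub> fr i = fr i \<otimes>\<^bsub>E\<^esub> sop a"
  by (rule E_eqI) (simp_all add: sop_in_E fr_in_E E_apply op_apply V_frob V_act act_frob)

lemma fr_fr_commute: "fr i \<otimes>\<^bsub>E\<^esub> fr j = fr j \<otimes>\<^bsub>E\<^esub> fr i"
  by (rule E_eqI)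
    (simp_all add: fr_in_E E_apply op_apply V_frob frob_mult_exp[symmetric] add.commute)

lemma Sgen_commute:
  assumes "x \<in> Sgen i" "y \<in> Sgen j"
  shows "x \<otimes>\<^bsub>E\<^esub> y = y \<otimes>\<^bsub>E\<^esub> x"
proof (rule E.generate_ring_commute[OF gens_in_E gens_in_E])
  show "x \<in> generate_ring E (insert (fr i) (range sop))" using assms(1) unfolding Sgen_def .
  show "y \<in> generate_ring E (insert (fr j) (range sop))" using assms(2) unfolding Sgen_def .
  fix g h assume "g \<in> insert (fr i) (range sop)" "h \<in> insert (fr j) (range sop)"
  then show "g \<otimes>\<^bsub>E\<^esub> h = h \<otimes>\<^bsub>E\<^esub> g"
    by (elim insertE imageE) (simp_all only: fr_fr_commute sop_fr_commute sop_sop_commute)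
qed

lemma fr_mult_in_Sgen: "fr (i * j) \<in> Sgen i"
proof -
  have "fr i [^]\<^bsub>E\<^esub> j \<in> Sgen i" for j :: nat
  proof (induction j)
    case 0
    show ?case using subringE(3)[OF Sgen_subring] by simp
  next
    case (Suc j)
    then show ?case using subringE(6)[OF Sgen_subring Suc fr_in_Sgen] by simp
  qed
  then show ?thesis unfolding fr_power .
qed

lemma Sgen_subset: "Sgen i \<subseteq> Sgen 1"
proof -
  have "insert (fr i) (range sop) \<subseteq> Sgen 1" using fr_mult_in_Sgen[of 1 i] sop_in_Sgen by auto
  then show ?thesis unfolding Sgen_def[of i] by (rule E.generate_ring_min_subring1[OF gens_in_E Sgen_subring])
qed

text \<open>
  Moving \<open>z\<close> past \<open>\<pi>^i\<close> raises it to the power \<open>q^(r * i)\<close>, which fixes the field with \<open>q^i\<close> elements.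
\<close>

lemma const_commute:
  assumes i: "i dvd n" and z: "z \<in> subfield_GF i" and x: "x \<in> Sgen i"
  shows "x \<otimes>\<^bsub>E\<^esub> const_op M z = const_op M z \<otimes>\<^bsub>E\<^esub> x"
proof (rule E.generate_ring_commute[OF gens_in_E])
  have zn: "z \<in> subfield_GF n" by (rule subfield_GF_dvd[OF z i])
  show sub: "{const_op M z} \<subseteq> carrier E" using const_in_E[OF zn] by simp
  show "x \<in> generate_ring E (insert (fr i) (range sop))" using x unfolding Sgen_def .
  show "const_op M z \<in> generate_ring E {const_op M z}" by (rule generate_ring.incl) simp
  have "z ^ (CARD('k) ^ (r * i)) = z" using subfield_GF_power_mult[OF z, of r] by (simp add: mult.commute)
  then have "fr i \<otimes>\<^bsub>E\<^esub> const_op M z = const_op M z \<otimes>\<^bsub>E\<^esub> fr i"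
    by (intro E_eqI) (simp_all add: fr_in_E const_in_E[OF zn] E_apply op_apply V_frob V_GF[OF _ zn] power_mult_distrib)
  moreover have "sop a \<otimes>\<^bsub>E\<^esub> const_op M z = const_op M z \<otimes>\<^bsub>E\<^esub> sop a" for a
    by (intro E_eqI) (simp_all add: sop_in_E const_in_E[OF zn] E_apply op_apply V_act V_GF[OF _ zn] act_GF[OF zn])
  moreover fix g h assume "g \<in> insert (fr i) (range sop)" "h \<in> {const_op M z}"
  ultimately show "g \<otimes>\<^bsub>E\<^esub> h = h \<otimes>\<^bsub>E\<^esub> g" by (elim insertE imageE) auto
qed

lemma Sgen_GF:
  assumes i: "i dvd n" and z: "z \<in> subfield_GF i" and x: "x \<in> Sgen i" and v: "v \<in> V"
  shows "x (z * v) = z * x v"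
proof -
  have zn: "z \<in> subfield_GF n" by (rule subfield_GF_dvd[OF z i])
  have "(x \<otimes>\<^bsub>E\<^esub> const_op M z) v = (const_op M z \<otimes>\<^bsub>E\<^esub> x) v" using const_commute[OF i z x] by simp
  then show ?thesis using v E_closed[OF Sgen_in_E[OF x] v] by (simp add: E_apply op_apply)
qed

lemma Sgen_fr:
  assumes x: "x \<in> Sgen i" and v: "v \<in> V"
  shows "x (v ^ (CARD('k) ^ (r * j))) = x v ^ (CARD('k) ^ (r * j))"
proof -
  have "(x \<otimes>\<^bsub>E\<^esub> fr j) v = (fr j \<otimes>\<^bsub>E\<^esub> x) v" using Sgen_commute[OF x fr_in_Sgen[of j]] by simp
  then show ?thesis using v E_closed[OF Sgen_in_E[OF x] v] by (simp add: E_apply op_apply)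
qed

text \<open>
  The operator \<open>\<Sum>i<k. x i * \<pi>^i\<close>.
\<close>

definition lin :: "nat \<Rightarrow> (nat \<Rightarrow> 'k alg_closure \<Rightarrow> 'k alg_closure) \<Rightarrow> 'k alg_closure \<Rightarrow> 'k alg_closure" where
  "lin k x = (\<lambda>v\<in>V. \<Sum>i<k. x i (v ^ (CARD('k) ^ (r * i))))"

lemma lin_Suc:
  assumes "lin k x \<in> carrier E" "x k \<in> carrier E"
  shows "lin (Suc k) x = lin k x \<oplus>\<^bsub>E\<^esub> x k \<otimes>\<^bsub>E\<^esub> fr k"
proof
  fix v show "lin (Suc k) x v = (lin k x \<oplus>\<^bsub>E\<^esub> x k \<otimes>\<^bsub>E\<^esub> fr k) v"
  proof (cases "v \<in> V")
    case True
    then show ?thesis by (simp add: E_apply op_apply lin_def)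
  next
    case False
    have "lin k x \<oplus>\<^bsub>E\<^esub> x k \<otimes>\<^bsub>E\<^esub> fr k \<in> carrier E" using assms fr_in_E by simp
    then have "lin k x \<oplus>\<^bsub>E\<^esub> x k \<otimes>\<^bsub>E\<^esub> fr k \<in> V \<rightarrow>\<^sub>E V" unfolding E_mem by blast
    from PiE_arb[OF this False] show ?thesis using False by (simp add: lin_def)
  qed
qed

lemma lin_in_Sgen:
  assumes "\<And>i. i < k \<Longrightarrow> x i \<in> Sgen 1"
  shows "lin k x \<in> Sgen 1"
  using assms
proof (induction k)
  case 0
  have "lin 0 x = \<zero>\<^bsub>E\<^esub>" unfolding lin_def E_zero_def by simp
  then show ?case using subringE(2)[OF Sgen_subring] by simp
next
  case (Suc k)
  have l: "lin k x \<in> Sgen 1" using Suc by simp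
  have xk: "x k \<in> Sgen 1" using Suc by simp
  have "fr k \<in> Sgen 1" using fr_mult_in_Sgen[of 1 k] by simp
  then show ?case unfolding lin_Suc[OF Sgen_in_E[OF l] Sgen_in_E[OF xk]]
    using subringE(6,7)[OF Sgen_subring] l xk by blast
qed

text \<open>
  The coefficients commute with constants from the field with \<open>q^k\<close> elements, so evaluation at \<open>z * v\<close>
  multiplies the \<open>i\<close>-th term by \<open>z^(q^(r * i))\<close>, and the terms can be separated.  The \<open>i\<close>-th
  coefficient is only seen on the image of \<open>\<pi>^i\<close>, which is all of \<open>V\<close>.
\<close>

lemma lin_inj:
  assumes k: "k dvd n" and x: "x \<in> {..<k} \<rightarrow>\<^sub>E Sgen k" and y: "y \<in> {..<k} \<rightarrow>\<^sub>E Sgen k"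
    and eq: "lin k x = lin k y"
  shows "x = y"
proof (rule PiE_ext[OF x y])
  fix i assume i: "i \<in> {..<k}"
  have k0: "k > 0" using i by auto
  have copk: "coprime r k" using cop k by (meson coprime_divisors dvd_refl)
  have xE: "x j \<in> Sgen k" "y j \<in> Sgen k" if "j < k" for j using x y that by auto
  have xi: "x i \<in> Sgen k" "y i \<in> Sgen k" using xE i by auto
  have pt: "x i (v ^ (CARD('k) ^ (r * i))) = y i (v ^ (CARD('k) ^ (r * i)))" if v: "v \<in> V" for v
  proof -
    \<comment> \<open>the coefficients of a polynomial in \<open>z\<close> that vanishes on the field with \<open>q^k\<close> elements\<close>
    define d where "d j = x j (v ^ (CARD('k) ^ (r * j))) - y j (v ^ (CARD('k) ^ (r * j)))" for j
    have "d i = 0"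
    proof (rule independence_of_frobenius_powers[OF k0 copk])
      fix z :: "'k alg_closure" assume z: "z \<in> subfield_GF k"
      have zv: "z * v \<in> V" by (rule V_GF[OF v subfield_GF_dvd[OF z k]])
      have zp: "z ^ (CARD('k) ^ (r * j)) \<in> subfield_GF k" for j
        using z unfolding subfield_GF_def by (simp add: power_mult[symmetric] mult.commute)
          (simp add: power_mult)
      have "(\<Sum>j<k. x j ((z * v) ^ (CARD('k) ^ (r * j)))) = (\<Sum>j<k. y j ((z * v) ^ (CARD('k) ^ (r * j))))"
        using fun_cong[OF eq, of "z * v"] zv unfolding lin_def by simp
      moreover have "x j ((z * v) ^ (CARD('k) ^ (r * j))) = z ^ (CARD('k) ^ (r * j)) * x j (v ^ (CARD('k) ^ (r * j)))"
        "y j ((z * v) ^ (CARD('k) ^ (r * j))) = z ^ (CARD('k) ^ (r * j)) * y j (v ^ (CARD('k) ^ (r * j)))"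
        if "j < k" for j
        unfolding power_mult_distrib
        using Sgen_GF[OF k zp _ V_frob[OF v]] xE[OF that] by blast+
      ultimately have "(\<Sum>j<k. z ^ (CARD('k) ^ (r * j)) * x j (v ^ (CARD('k) ^ (r * j)))) =
          (\<Sum>j<k. z ^ (CARD('k) ^ (r * j)) * y j (v ^ (CARD('k) ^ (r * j))))" by simp
      then show "(\<Sum>j<k. d j * z ^ (CARD('k) ^ (r * j))) = 0"
        unfolding d_def by (simp add: algebra_simps sum_subtractf)
    qed (use i in simp)
    then show ?thesis unfolding d_def by simp
  qed
  show "x i = y i"
  proof (rule E_eqI[OF Sgen_in_E[OF xi(1)] Sgen_in_E[OF xi(2)]])
    fix w assume "w \<in> V"
    then obtain v where "v \<in> V" "w = v ^ (CARD('k) ^ (r * i))"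
      using bij_betw_imp_surj_on[OF frob_bij[of i]] by auto
    then show "x i w = y i w" using pt by simp
  qed
qed

lemma finite_Sgen: "finite (Sgen i)"
  by (rule finite_subset[OF subringE(1)[OF Sgen_subring] finite_E])

text \<open>
  The expressions of degree below \<open>n\<close> in \<open>\<pi>\<close> with scalar coefficients are different operators.
\<close>

lemma card_Sgen_ge: "card V \<le> card (Sgen 1)"
proof -
  have sub: "{..<n} \<rightarrow>\<^sub>E range sop \<subseteq> {..<n} \<rightarrow>\<^sub>E Sgen n" by (rule PiE_mono) (use sop_in_Sgen in auto)
  have "inj_on (lin n) ({..<n} \<rightarrow>\<^sub>E range sop)"
    by (rule inj_onI) (use lin_inj[OF dvd_refl] sub in blast)
  then have "card ({..<n} \<rightarrow>\<^sub>E range sop) = card (lin n ` ({..<n} \<rightarrow>\<^sub>E range sop))" by (simp add: card_image)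
  also have "\<dots> \<le> card (Sgen 1)"
  proof (rule card_mono[OF finite_Sgen], rule image_subsetI)
    fix x assume "x \<in> {..<n} \<rightarrow>\<^sub>E range sop"
    then show "lin n x \<in> Sgen 1" by (intro lin_in_Sgen) (use sop_in_Sgen in \<open>auto simp: PiE_def Pi_def\<close>)
  qed
  finally have "card (range sop) ^ n \<le> card (Sgen 1)" by (simp add: card_PiE)
  moreover have "(CARD('k) ^ Polynomial.degree p) ^ n \<le> card (range sop) ^ n"
    by (rule power_mono[OF card_sop]) simp
  ultimately show ?thesis unfolding card_V by (simp add: power_mult[symmetric] mult.commute)
qed

lemma Sgen_cring: "cring (E\<lparr>carrier := Sgen i\<rparr>)"
proof -
  have "subcring (Sgen i) E" using E.subcringI[OF Sgen_subring] Sgen_commute by blast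
  then show ?thesis using E.subcring_iff[OF subringE(1)[OF Sgen_subring]] by blast
qed

lemma Sgen_module: "module (E\<lparr>carrier := Sgen i\<rparr>) (evaluation_module M)"
  using kM.evaluation_module_is_module[of "Sgen i"] Sgen_subring Sgen_commute unfolding E_def by blast

lemma Sgen_as_generated: "Sgen i = generate_ring (E\<lparr>carrier := Sgen i\<rparr>) (insert (fr i) (range sop))"
proof -
  have "insert (fr i) (range sop) \<subseteq> Sgen i" using fr_in_Sgen sop_in_Sgen by auto
  from E.subring_gen_equality[OF Sgen_subring this] show ?thesis unfolding Sgen_def[symmetric] .
qed

lemma sop_subring_Sgen: "subring (range sop) (E\<lparr>carrier := Sgen i\<rparr>)"
proof -
  have "range sop \<subseteq> Sgen i" using sop_in_Sgen by auto
  then show ?thesis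
    using ring.ring_incl_imp_subring[OF cring.axioms(1)[OF Sgen_cring[of i]], of "range sop"]
      E.subring_is_ring[OF sop_subring] by simp
qed

lemma eval_simps [simp]: "carrier (evaluation_module M) = V" "f \<odot>\<^bsub>evaluation_module M\<^esub> v = f v"
  "\<zero>\<^bsub>evaluation_module M\<^esub> = 0" "v \<oplus>\<^bsub>evaluation_module M\<^esub> w = v + w"
  by (simp_all add: evaluation_module_def)

text \<open>
  A vector whose annihilator in \<open>S\<close> is trivial exists because \<open>S\<close> is a principal ideal ring, and it is
  cyclic because \<open>S\<close> has at least as many elements as \<open>V\<close>.
\<close>

lemma ex_cyclic_vector: "\<exists>v\<in>V. bij_betw (\<lambda>s. s v) (Sgen 1) V"
proof -
  interpret S: cring "E\<lparr>carrier := Sgen 1\<rparr>" by (rule Sgen_cring)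
  interpret SM: module "E\<lparr>carrier := Sgen 1\<rparr>" "evaluation_module M" by (rule Sgen_module)
  have inv: "\<exists>d\<in>range sop. d \<otimes>\<^bsub>E\<lparr>carrier := Sgen 1\<rparr>\<^esub> c = \<one>\<^bsub>E\<lparr>carrier := Sgen 1\<rparr>\<^esub>"
    if "c \<in> range sop" "c \<noteq> \<zero>\<^bsub>E\<lparr>carrier := Sgen 1\<rparr>\<^esub>" for c
    using that sop_multiple sop_inverse by auto
  have "\<exists>v\<in>carrier (evaluation_module M). \<forall>s\<in>carrier (E\<lparr>carrier := Sgen 1\<rparr>).
    s \<odot>\<^bsub>evaluation_module M\<^esub> v = \<zero>\<^bsub>evaluation_module M\<^esub> \<longrightarrow> s = \<zero>\<^bsub>E\<lparr>carrier := Sgen 1\<rparr>\<^esub>"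
  proof (rule SM.ex_faithful_vector)
    show "finite (carrier (E\<lparr>carrier := Sgen 1\<rparr>))" using finite_Sgen by simp
    show "\<exists>a\<in>I. I = PIdl\<^bsub>E\<lparr>carrier := Sgen 1\<rparr>\<^esub> a" if "ideal I (E\<lparr>carrier := Sgen 1\<rparr>)" for I
    proof (rule S.generated_by_one_element_principal[OF sop_subring_Sgen inv _ _ that])
      show "fr 1 \<in> carrier (E\<lparr>carrier := Sgen 1\<rparr>)" using fr_in_Sgen by simp
      show "carrier (E\<lparr>carrier := Sgen 1\<rparr>) = generate_ring (E\<lparr>carrier := Sgen 1\<rparr>) (insert (fr 1) (range sop))"
        using Sgen_as_generated[of 1] by simp
    qed
    show "s = \<zero>\<^bsub>E\<lparr>carrier := Sgen 1\<rparr>\<^esub>" if "s \<in> carrier (E\<lparr>carrier := Sgen 1\<rparr>)"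
      "\<forall>v\<in>carrier (evaluation_module M). s \<odot>\<^bsub>evaluation_module M\<^esub> v = \<zero>\<^bsub>evaluation_module M\<^esub>" for s
    proof -
      have "s = \<zero>\<^bsub>E\<^esub>" by (rule E_eqI) (use that Sgen_in_E in \<open>auto simp: E_apply\<close>)
      then show ?thesis by simp
    qed
  qed
  then obtain v where v: "v \<in> V" "\<And>s. s \<in> Sgen 1 \<Longrightarrow> s v = 0 \<Longrightarrow> s = \<zero>\<^bsub>E\<^esub>" by auto
  have inj: "inj_on (\<lambda>s. s v) (Sgen 1)"
  proof (rule inj_onI)
    fix s u assume su: "s \<in> Sgen 1" "u \<in> Sgen 1" "s v = u v"
    have c: "s \<in> carrier E" "u \<in> carrier E" using su Sgen_in_E by auto
    have "s \<ominus>\<^bsub>E\<^esub> u \<in> Sgen 1" unfolding a_minus_def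
      using su subringE(5,7)[OF Sgen_subring] by blast
    moreover have "(s \<ominus>\<^bsub>E\<^esub> u) v = 0" unfolding a_minus_def using su(3) v(1) c by (simp add: E_apply E_minus)
    ultimately have "s \<ominus>\<^bsub>E\<^esub> u = \<zero>\<^bsub>E\<^esub>" by (rule v(2))
    then show "s = u" using c by simp
  qed
  have sub: "(\<lambda>s. s v) ` Sgen 1 \<subseteq> V" using E_closed[OF Sgen_in_E v(1)] by auto
  have "card ((\<lambda>s. s v) ` Sgen 1) = card (Sgen 1)" by (rule card_image[OF inj])
  then have "(\<lambda>s. s v) ` Sgen 1 = V"
    using card_seteq[OF finite_V sub] card_Sgen_ge by simp
  then show ?thesis using v(1) inj unfolding bij_betw_def by blast
qed

text \<open>
  Writing an exponent as \<open>m * (k div m) + k mod m\<close> absorbs powers of \<open>\<pi>^m\<close> into the coefficients, so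
  every polynomial in \<open>\<pi>\<close> becomes an expression of degree below \<open>m\<close> over \<open>Sgen m\<close>.
\<close>

lemma Sgen_eq_lin:
  assumes m: "m > 0"
  shows "lin m ` ({..<m} \<rightarrow>\<^sub>E Sgen m) = Sgen 1"
proof
  show "lin m ` ({..<m} \<rightarrow>\<^sub>E Sgen m) \<subseteq> Sgen 1"
  proof (rule image_subsetI)
    fix x assume "x \<in> {..<m} \<rightarrow>\<^sub>E Sgen m"
    then show "lin m x \<in> Sgen 1" by (intro lin_in_Sgen) (use Sgen_subset in blast)
  qed
  interpret S: cring "E\<lparr>carrier := Sgen 1\<rparr>" by (rule Sgen_cring)
  have step: "w \<in> lin m ` ({..<m} \<rightarrow>\<^sub>E Sgen m)" if "w \<in> poly_exprs (E\<lparr>carrier := Sgen 1\<rparr>) (range sop) (fr 1) k" for w k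
    using that
  proof (induction k arbitrary: w)
    case 0
    have z: "\<zero>\<^bsub>E\<^esub> \<in> Sgen m" by (rule subringE(2)[OF Sgen_subring])
    have "w = \<zero>\<^bsub>E\<^esub>" using 0 by simp
    also have "\<dots> = lin m (\<lambda>i\<in>{..<m}. \<zero>\<^bsub>E\<^esub>)"
      unfolding lin_def by (subst E_zero_def, rule restrict_ext) (simp add: E_apply V_frob)
    finally show ?case by (rule image_eqI[where f = "lin m"]) (use z in auto)
  next
    case (Suc k)
    then obtain u c where u: "u \<in> poly_exprs (E\<lparr>carrier := Sgen 1\<rparr>) (range sop) (fr 1) k"
      "c \<in> range sop" "w = u \<oplus>\<^bsub>E\<^esub> c \<otimes>\<^bsub>E\<^esub> (fr 1 [^]\<^bsub>E\<lparr>carrier := Sgen 1\<rparr>\<^esub> k)" by auto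
    obtain x where x: "x \<in> {..<m} \<rightarrow>\<^sub>E Sgen m" "u = lin m x" using Suc.IH[OF u(1)] by auto
    have pw: "fr 1 [^]\<^bsub>E\<lparr>carrier := Sgen 1\<rparr>\<^esub> k = fr k"
      using fr_power[of 1 k] by (simp add: nat_pow_def)
    define j where "j = k mod m"
    define h where "h = c \<otimes>\<^bsub>E\<^esub> fr (m * (k div m))"
    have j: "j < m" unfolding j_def using m by simp
    have cS: "c \<in> Sgen m" using u(2) sop_in_Sgen by auto
    have hS: "h \<in> Sgen m" unfolding h_def by (rule subringE(6)[OF Sgen_subring cS fr_mult_in_Sgen])
    \<comment> \<open>the new term \<open>c * \<pi>^k = h * \<pi>^j\<close> is added to the \<open>j\<close>-th coefficient\<close>
    define y where "y = (\<lambda>i\<in>{..<m}. if i = j then x i \<oplus>\<^bsub>E\<^esub> h else x i)"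
    have xi: "x i \<in> Sgen m" if "i < m" for i using x(1) that by auto
    have y: "y \<in> {..<m} \<rightarrow>\<^sub>E Sgen m"
      unfolding y_def using xi hS subringE(7)[OF Sgen_subring] by auto
    have "w = lin m y"
    proof
      fix v
      have wE: "w \<in> carrier E" unfolding u(3) pw x(2)
        by (intro E.a_closed E.m_closed fr_in_E Sgen_in_E[OF lin_in_Sgen] Sgen_in_E[OF cS])
          (use xi Sgen_subset in blast)
      show "w v = lin m y v"
      proof (cases "v \<in> V")
        case True
        have hv: "h (v ^ (CARD('k) ^ (r * j))) = c (v ^ (CARD('k) ^ (r * k)))"
        proof -
          have "r * k = r * j + r * (m * (k div m))"
            unfolding j_def distrib_left[symmetric] by simp
          then show ?thesis unfolding h_def using True
            by (simp add: E_apply op_apply V_frob frob_mult_exp[symmetric])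
        qed
        have "lin m y v = (\<Sum>i<m. x i (v ^ (CARD('k) ^ (r * i))) + (if i = j then h (v ^ (CARD('k) ^ (r * i))) else 0))"
          unfolding lin_def y_def using True by (simp add: E_apply V_frob cong: sum.cong)
            (rule sum.cong, auto simp: E_apply V_frob)
        also have "\<dots> = lin m x v + h (v ^ (CARD('k) ^ (r * j)))"
          using True j by (simp add: lin_def sum.distrib)
        also have "\<dots> = w v" unfolding hv u(3) pw x(2) using True by (simp add: E_apply op_apply)
        finally show ?thesis by simp
      next
        case False
        have "w \<in> V \<rightarrow>\<^sub>E V" using wE unfolding E_mem by blast
        from PiE_arb[OF this False] show ?thesis using False by (simp add: lin_def)
      qed
    qed
    then show ?case using y by blast
  qed
  show "Sgen 1 \<subseteq> lin m ` ({..<m} \<rightarrow>\<^sub>E Sgen m)"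
  proof
    fix w assume "w \<in> Sgen 1"
    then have w: "w \<in> generate_ring (E\<lparr>carrier := Sgen 1\<rparr>) (insert (fr 1) (range sop))"
      using Sgen_as_generated[of 1] by simp
    have "fr 1 \<in> carrier (E\<lparr>carrier := Sgen 1\<rparr>)" using fr_in_Sgen[of 1] by simp
    from S.generate_ring_imp_poly_exprs[OF sop_subring_Sgen this w]
    obtain k where "w \<in> poly_exprs (E\<lparr>carrier := Sgen 1\<rparr>) (range sop) (fr 1) k" by blast
    then show "w \<in> lin m ` ({..<m} \<rightarrow>\<^sub>E Sgen m)" by (rule step)
  qed
qed

end

section \<open>The centralizer of a power of the Frobenius\<close>

locale drinfeld_torsion_divisor = drinfeld_torsion n r p t \<phi>
  for n r and p :: "('k :: {finite, field}) poly" and t \<phi> +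
  fixes m :: nat
  assumes m: "m dvd n"
begin

lemma m_pos: "m > 0" using m n by (auto elim!: dvdE)

lemma GF_m_n: "z \<in> subfield_GF m \<Longrightarrow> z \<in> subfield_GF n" by (rule subfield_GF_dvd[OF _ m])

lemma coprime_r_m: "coprime r m" using cop m by (meson coprime_divisors dvd_refl)

definition R0 :: "('k alg_closure \<Rightarrow> 'k alg_closure) set" where "R0 = Sgen m"
definition S :: "('k alg_closure \<Rightarrow> 'k alg_closure) set" where "S = Sgen 1"
definition R :: "('k alg_closure \<Rightarrow> 'k alg_closure) set" where "R = centralizer E R0"
definition L :: "('k alg_closure \<Rightarrow> 'k alg_closure) set" where "L = const_op M ` subfield_GF m"

abbreviation "R0_ring \<equiv> E\<lparr>carrier := R0\<rparr>"
abbreviation "V_mod \<equiv> evaluation_module M"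

lemma R0_module: "module R0_ring V_mod" unfolding R0_def by (rule Sgen_module)

sublocale RV: module R0_ring V_mod by (rule R0_module)

lemma finsum_V: "finite A \<Longrightarrow> f \<in> A \<rightarrow> V \<Longrightarrow> (\<Oplus>\<^bsub>V_mod\<^esub>j\<in>A. f j) = sum f A"
proof (induction A rule: finite_induct)
  case (insert j A)
  have "(\<Oplus>\<^bsub>V_mod\<^esub>j\<in>insert j A. f j) = f j \<oplus>\<^bsub>V_mod\<^esub> (\<Oplus>\<^bsub>V_mod\<^esub>j\<in>A. f j)"
    by (rule RV.M.finsum_insert) (use insert in auto)
  then show ?case using insert by simp
qed (use RV.M.finsum_empty in simp)

text \<open>
  A cyclic vector \<open>v\<close> identifies \<open>V\<close> with \<open>S\<close>, which has the basis \<open>\<pi>^j\<close> for \<open>j < m\<close> over \<open>R0\<close>.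
\<close>

lemma ex_R0_basis: "\<exists>w. free_module R0_ring V_mod m w"
proof -
  obtain v where v: "v \<in> V" "bij_betw (\<lambda>s. s v) (Sgen 1) V" using ex_cyclic_vector by blast
  define w where "w j = v ^ (CARD('k) ^ (r * j))" for j
  have "inj_on (lin m) ({..<m} \<rightarrow>\<^sub>E R0)"
    unfolding R0_def by (rule inj_onI) (rule lin_inj[OF m])
  then have "bij_betw (lin m) ({..<m} \<rightarrow>\<^sub>E R0) (Sgen 1)"
    unfolding bij_betw_def R0_def Sgen_eq_lin[OF m_pos] by simp
  from bij_betw_trans[OF this v(2)]
  have bij: "bij_betw ((\<lambda>s. s v) \<circ> lin m) ({..<m} \<rightarrow>\<^sub>E R0) V" .
  have "bij_betw (\<lambda>a. \<Oplus>\<^bsub>V_mod\<^esub>j\<in>{..<m}. a j \<odot>\<^bsub>V_mod\<^esub> w j) ({..<m} \<rightarrow>\<^sub>E R0) V"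
  proof (rule bij_betw_cong[THEN iffD1, OF _ bij])
    fix a assume a: "a \<in> {..<m} \<rightarrow>\<^sub>E R0"
    have "a j (w j) \<in> V" if "j < m" for j
    proof -
      have "a j \<in> Sgen m" using a that unfolding R0_def by auto
      from E_closed[OF Sgen_in_E[OF this] V_frob[OF v(1)]] show ?thesis unfolding w_def .
    qed
    then have "(\<Oplus>\<^bsub>V_mod\<^esub>j\<in>{..<m}. a j \<odot>\<^bsub>V_mod\<^esub> w j) = (\<Sum>j<m. a j (w j))"
      unfolding eval_simps by (intro finsum_V) auto
    then show "((\<lambda>s. s v) \<circ> lin m) a = (\<Oplus>\<^bsub>V_mod\<^esub>j\<in>{..<m}. a j \<odot>\<^bsub>V_mod\<^esub> w j)"
      using v(1) by (simp add: lin_def w_def)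
  qed
  then have "free_module R0_ring V_mod m w"
    by (intro free_module.intro R0_module free_module_axioms.intro)
      (simp_all add: w_def V_frob[OF v(1)])
  then show ?thesis by (rule exI[of _ w])
qed

lemma R0_in_E: "x \<in> R0 \<Longrightarrow> x \<in> carrier E" unfolding R0_def by (rule Sgen_in_E)

text \<open>
  Linearity over the residue field is part of linearity over \<open>R0\<close>, which contains the scalars.
\<close>

lemma R_eq_End: "R = carrier (module_End R0_ring V_mod)"
proof (rule Set.set_eqI)
  fix f
  have "f \<in> carrier (module_End R0_ring V_mod) \<longleftrightarrow> f \<in> V \<rightarrow>\<^sub>E V \<and>
    (\<forall>v\<in>V. \<forall>w\<in>V. f (v + w) = f v + f w) \<and> (\<forall>c\<in>R0. \<forall>v\<in>V. f (c v) = c (f v))"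
    unfolding module_End_def by simp
  also have "\<dots> \<longleftrightarrow> f \<in> R"
  proof
    assume f: "f \<in> V \<rightarrow>\<^sub>E V \<and> (\<forall>v\<in>V. \<forall>w\<in>V. f (v + w) = f v + f w) \<and> (\<forall>c\<in>R0. \<forall>v\<in>V. f (c v) = c (f v))"
    have "f (act a v) = act a (f v)" if "v \<in> V" for a v
    proof -
      have "f (sop a v) = sop a (f v)" using f that sop_in_Sgen[of a m] unfolding R0_def by blast
      moreover have "f v \<in> V" using f that by (auto simp: PiE_mem)
      ultimately show ?thesis using that by (simp add: op_apply)
    qed
    then have fE: "f \<in> carrier E" unfolding E_mem using f by blast
    have "f \<otimes>\<^bsub>E\<^esub> c = c \<otimes>\<^bsub>E\<^esub> f" if c: "c \<in> R0" for c
      by (rule E_eqI) (use f c fE R0_in_E[OF c] in \<open>simp_all add: E_apply\<close>)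
    then show "f \<in> R" unfolding R_def centralizer_def using fE by blast
  next
    assume "f \<in> R"
    then have fE: "f \<in> carrier E" and comm: "\<And>c. c \<in> R0 \<Longrightarrow> f \<otimes>\<^bsub>E\<^esub> c = c \<otimes>\<^bsub>E\<^esub> f"
      unfolding R_def centralizer_def by auto
    have "f (c v) = c (f v)" if "c \<in> R0" "v \<in> V" for c v
      using fun_cong[OF comm[OF that(1)], of v] that(2) by (simp add: E_apply)
    then show "f \<in> V \<rightarrow>\<^sub>E V \<and> (\<forall>v\<in>V. \<forall>w\<in>V. f (v + w) = f v + f w) \<and> (\<forall>c\<in>R0. \<forall>v\<in>V. f (c v) = c (f v))"
      using fE unfolding E_mem by blast
  qed
  finally show "f \<in> R \<longleftrightarrow> f \<in> carrier (module_End R0_ring V_mod)" by simp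
qed

lemma R_ring_eq: "E\<lparr>carrier := R\<rparr> = module_End R0_ring V_mod"
  unfolding R_eq_End by (simp add: E_def module_End_def evaluation_module_def)

lemma R_matrix: "\<exists>h \<in> ring_iso (E\<lparr>carrier := R\<rparr>) (mat_ring m R0_ring). \<forall>c\<in>R0. h c = scalar_mat m R0_ring c"
proof -
  obtain w where "free_module R0_ring V_mod m w" using ex_R0_basis by blast
  then interpret F: free_module R0_ring V_mod m w .
  have "F.matrix_of c = scalar_mat m R0_ring c" if c: "c \<in> R0" for c
  proof -
    have cE: "c \<in> V \<rightarrow>\<^sub>E V" using R0_in_E[OF c] unfolding E_mem by blast
    have "(\<lambda>v\<in>carrier V_mod. c \<odot>\<^bsub>V_mod\<^esub> v) = c"
    proof
      fix v show "(\<lambda>v\<in>carrier V_mod. c \<odot>\<^bsub>V_mod\<^esub> v) v = c v"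
        by (cases "v \<in> V") (simp_all add: PiE_arb[OF cE])
    qed
    moreover have "F.matrix_of (\<lambda>v\<in>carrier V_mod. c \<odot>\<^bsub>V_mod\<^esub> v) = scalar_mat m R0_ring c"
      by (rule F.matrix_of_scalar) (simp add: c)
    ultimately show ?thesis by (simp only:)
  qed
  then show ?thesis unfolding R_ring_eq by (intro bexI[OF _ F.matrix_of_iso] ballI)
qed

lemma card_R: "card R = card R0 ^ (m * m)"
proof -
  obtain w where "free_module R0_ring V_mod m w" using ex_R0_basis by blast
  then interpret F: free_module R0_ring V_mod m w .
  have "card R = card (carrier R0_ring) ^ (m * m)" unfolding R_eq_End by (rule F.card_End)
  then show ?thesis by simp
qed

lemma S_subset_R: "S \<subseteq> R"
proof
  fix s assume "s \<in> S"
  then have s: "s \<in> Sgen 1" unfolding S_def .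
  then show "s \<in> R" unfolding R_def R0_def centralizer_def using Sgen_in_E[OF s] Sgen_commute[OF s] by simp
qed

lemma R0_subset_R: "R0 \<subseteq> R"
  using subset_trans[OF Sgen_subset[of m] S_subset_R[unfolded S_def]] unfolding R0_def .

lemma R_subring: "subring R E"
  unfolding R_def by (rule E.centralizer_subring) (use R0_in_E in blast)

lemma R_in_E: "x \<in> R \<Longrightarrow> x \<in> carrier E" unfolding R_def centralizer_def by blast

text \<open>
  An operator that centralizes \<open>R\<close> centralizes \<open>R0\<close>, hence lies in \<open>R\<close> itself.  It is thus central in
  the endomorphism ring of a free \<open>R0\<close>-module, that is, a scalar.
\<close>

lemma double_centralizer: "centralizer E R = R0"
proof
  show "R0 \<subseteq> centralizer E R"
  proof
    fix c assume c: "c \<in> R0"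
    have "c \<otimes>\<^bsub>E\<^esub> f = f \<otimes>\<^bsub>E\<^esub> c" if "f \<in> R" for f
      using that c unfolding R_def centralizer_def by simp
    then show "c \<in> centralizer E R" using R0_in_E[OF c] unfolding centralizer_def[of E R] by simp
  qed
  show "centralizer E R \<subseteq> R0"
  proof
    fix x assume "x \<in> centralizer E R"
    then have xE: "x \<in> carrier E" and comm: "\<And>f. f \<in> R \<Longrightarrow> x \<otimes>\<^bsub>E\<^esub> f = f \<otimes>\<^bsub>E\<^esub> x"
      unfolding centralizer_def by auto
    have "x \<otimes>\<^bsub>E\<^esub> c = c \<otimes>\<^bsub>E\<^esub> x" if "c \<in> R0" for c
      by (rule comm[OF subsetD[OF R0_subset_R that]])
    then have xR: "x \<in> R" using xE unfolding R_def centralizer_def by simp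
    obtain w where "free_module R0_ring V_mod m w" using ex_R0_basis by blast
    then interpret F: free_module R0_ring V_mod m w .
    have mult: "f \<otimes>\<^bsub>module_End R0_ring V_mod\<^esub> g = f \<otimes>\<^bsub>E\<^esub> g" for f g
      unfolding R_ring_eq[symmetric] by simp
    have "\<exists>c\<in>carrier R0_ring. \<forall>u\<in>carrier V_mod. x u = c \<odot>\<^bsub>V_mod\<^esub> u"
    proof (rule F.centralizer_of_End[OF m_pos])
      show "x \<in> carrier (module_End R0_ring V_mod)" using xR unfolding R_eq_End .
      fix f assume "f \<in> carrier (module_End R0_ring V_mod)"
      then show "x \<otimes>\<^bsub>module_End R0_ring V_mod\<^esub> f = f \<otimes>\<^bsub>module_End R0_ring V_mod\<^esub> x"
        unfolding mult R_eq_End[symmetric] by (rule comm)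
    qed
    then obtain c where c: "c \<in> R0" "\<And>v. v \<in> V \<Longrightarrow> x v = c v" by auto
    have "x = c" by (rule E_eqI[OF xE R0_in_E[OF c(1)] c(2)])
    then show "x \<in> R0" using c(1) by simp
  qed
qed

text \<open>
  Multiplication by \<open>z\<close> commutes with \<open>\<pi>^m\<close> if and only if \<open>z\<close> is fixed by the \<open>r * m\<close>-fold Frobenius;
  and \<open>gcd n (r * m) = m\<close>.
\<close>

lemma const_in_R_iff:
  assumes z: "z \<in> subfield_GF n"
  shows "const_op M z \<in> R \<longleftrightarrow> z \<in> subfield_GF m"
proof
  assume "z \<in> subfield_GF m"
  then have "const_op M z \<otimes>\<^bsub>E\<^esub> c = c \<otimes>\<^bsub>E\<^esub> const_op M z" if "c \<in> R0" for c
    using const_commute[OF m] that unfolding R0_def by simp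
  then show "const_op M z \<in> R" unfolding R_def centralizer_def using const_in_E[OF z] by blast
next
  assume "const_op M z \<in> R"
  then have comm: "const_op M z \<otimes>\<^bsub>E\<^esub> fr m = fr m \<otimes>\<^bsub>E\<^esub> const_op M z"
    using fr_in_Sgen[of m] unfolding R_def R0_def centralizer_def by blast
  obtain v where v: "v \<in> V" "v \<noteq> 0" using V_nontrivial by blast
  have "z * v ^ (CARD('k) ^ (r * m)) = (z * v) ^ (CARD('k) ^ (r * m))"
    using fun_cong[OF comm, of v] v by (simp add: E_apply op_apply V_frob V_GF[OF _ z])
  then have "z ^ (CARD('k) ^ (r * m)) = z" using v(2) by (simp add: power_mult_distrib)
  then have zrm: "z \<in> subfield_GF (r * m)" unfolding subfield_GF_def by simp
  have n0: "n > 0" using n by simp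
  have "gcd n (r * m) = m"
  proof -
    have "gcd n (r * m) = gcd n m" using cop by (intro gcd_mult_right_left_cancel) (simp add: coprime_commute)
    then show ?thesis using m by (simp add: gcd_nat.absorb2)
  qed
  then show "z \<in> subfield_GF m" using subfield_GF_gcd[OF z zrm n0] by simp
qed

lemma L_eq: "L = R \<inter> const_op M ` subfield_GF n"
proof
  show "L \<subseteq> R \<inter> const_op M ` subfield_GF n"
    unfolding L_def using const_in_R_iff[OF GF_m_n] GF_m_n by auto
  show "R \<inter> const_op M ` subfield_GF n \<subseteq> L"
    unfolding L_def using const_in_R_iff by auto
qed

lemma L_subset_R: "L \<subseteq> R" using L_eq by blast

text \<open>
  The operators \<open>s j\<close> commute with \<open>\<pi>\<close>.  Evaluating the relation at \<open>\<pi>^i v\<close> for all \<open>i\<close> therefore gives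
  relations between the conjugates of the values \<open>s j v\<close> with the same coefficients \<open>z j\<close>.
\<close>

lemma L_S_independence:
  assumes zGF: "\<And>j. j < m \<Longrightarrow> z j \<in> subfield_GF m"
    and indep: "\<And>c. (\<Sum>j<m. to_ac (c j) * z j) = 0 \<Longrightarrow> \<forall>j<m. c j = 0"
    and s: "s \<in> {..<m} \<rightarrow> S"
    and rel: "(\<Oplus>\<^bsub>E\<^esub>j\<in>{..<m}. const_op M (z j) \<otimes>\<^bsub>E\<^esub> s j) = \<zero>\<^bsub>E\<^esub>"
  shows "\<forall>j<m. s j = \<zero>\<^bsub>E\<^esub>"
proof (intro allI impI)
  fix j assume j: "j < m"
  have sS: "s i \<in> Sgen 1" if "i < m" for i using s that unfolding S_def by auto
  have pt: "(\<Sum>i<m. z i * s i v) = 0" if v: "v \<in> V" for v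
  proof -
    have "(\<Oplus>\<^bsub>E\<^esub>i\<in>{..<m}. const_op M (z i) \<otimes>\<^bsub>E\<^esub> s i) v = (\<Sum>i<m. (const_op M (z i) \<otimes>\<^bsub>E\<^esub> s i) v)"
      by (rule E_finsum) (use v const_in_E[OF GF_m_n[OF zGF]] Sgen_in_E[OF sS] in auto)
    then have "(\<Sum>i<m. (const_op M (z i) \<otimes>\<^bsub>E\<^esub> s i) v) = 0" using rel v by (simp add: E_apply)
    moreover have "(const_op M (z i) \<otimes>\<^bsub>E\<^esub> s i) v = z i * s i v" if "i < m" for i
      using v E_closed[OF Sgen_in_E[OF sS[OF that]] v] by (simp add: E_apply op_apply)
    ultimately show ?thesis by simp
  qed
  show "s j = \<zero>\<^bsub>E\<^esub>"
  proof (rule E_eqI[OF Sgen_in_E[OF sS[OF j]]])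
    fix v assume v: "v \<in> V"
    have "(\<Sum>i<m. z i * s i v ^ (CARD('k) ^ (r * l))) = 0" for l
      using pt[OF V_frob[OF v, of l]] Sgen_fr[OF sS v] by simp
    note rel_v = this
    have "\<forall>i\<in>{..<m}. s i v = 0"
      by (rule independence_over_frobenius_orbit[where z = z, OF finite_lessThan m_pos coprime_r_m _ _ rel_v])
        (use zGF indep in simp_all)
    then show "s j v = \<zero>\<^bsub>E\<^esub> v" using j v by (simp add: E_apply)
  qed simp
qed

definition LS :: "(nat \<Rightarrow> 'k alg_closure) \<Rightarrow> (nat \<Rightarrow> 'k alg_closure \<Rightarrow> 'k alg_closure) \<Rightarrow> 'k alg_closure \<Rightarrow> 'k alg_closure" where
  "LS z s = (\<Oplus>\<^bsub>E\<^esub>j\<in>{..<m}. const_op M (z j) \<otimes>\<^bsub>E\<^esub> s j)"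

lemma subring_finsum:
  assumes "subring T E" "finite A" "f \<in> A \<rightarrow> T"
  shows "(\<Oplus>\<^bsub>E\<^esub>j\<in>A. f j) \<in> T"
  using assms(2,3)
proof (induction A rule: finite_induct)
  case empty
  then show ?case using subringE(2)[OF assms(1)] by simp
next
  case (insert j A)
  have T: "T \<subseteq> carrier E" by (rule subringE(1)[OF assms(1)])
  have "(\<Oplus>\<^bsub>E\<^esub>j\<in>insert j A. f j) = f j \<oplus>\<^bsub>E\<^esub> (\<Oplus>\<^bsub>E\<^esub>j\<in>A. f j)"
    by (rule E.finsum_insert) (use insert T in auto)
  then show ?case using insert subringE(7)[OF assms(1)] by auto
qed

lemma LS_in_subring:
  assumes T: "subring T E" "L \<subseteq> T" "S \<subseteq> T"
    and zGF: "\<And>j. j < m \<Longrightarrow> z j \<in> subfield_GF m" and s: "s \<in> {..<m} \<rightarrow> S"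
  shows "LS z s \<in> T"
  unfolding LS_def
proof (rule subring_finsum[OF T(1) finite_lessThan], rule Pi_I)
  fix j assume j: "j \<in> {..<m}"
  have "const_op M (z j) \<in> T" using T(2) zGF j unfolding L_def by auto
  moreover have "s j \<in> T" using s T(3) j by auto
  ultimately show "const_op M (z j) \<otimes>\<^bsub>E\<^esub> s j \<in> T" by (rule subringE(6)[OF T(1)])
qed

text \<open>
  Both sides have \<open>|S|^m\<close> elements, since \<open>|S| = |R0|^m\<close> and \<open>|R| = |R0|^(m * m)\<close>.
\<close>

lemma R_eq_LS:
  assumes zGF: "\<And>j. j < m \<Longrightarrow> z j \<in> subfield_GF m"
    and indep: "\<And>c. (\<Sum>j<m. to_ac (c j) * z j) = 0 \<Longrightarrow> \<forall>j<m. c j = 0"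
  shows "LS z ` ({..<m} \<rightarrow> S) = R"
proof -
  have SE: "s \<in> S \<Longrightarrow> s \<in> carrier E" for s unfolding S_def by (rule Sgen_in_E)
  have S_sub: "subring S E" unfolding S_def by (rule Sgen_subring)
  have LS_mem: "LS z s \<in> R" if s: "s \<in> {..<m} \<rightarrow> S" for s
    by (rule LS_in_subring[where z = z, OF R_subring L_subset_R S_subset_R _ s]) (fact zGF)
  have inj: "inj_on (LS z) ({..<m} \<rightarrow>\<^sub>E S)"
  proof (rule inj_onI)
    fix s u assume s: "s \<in> {..<m} \<rightarrow>\<^sub>E S" and u: "u \<in> {..<m} \<rightarrow>\<^sub>E S" and eq: "LS z s = LS z u"
    have sE: "s j \<in> carrier E" "u j \<in> carrier E" if "j < m" for j using s u that SE by auto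
    have zE: "const_op M (z j) \<in> carrier E" if "j < m" for j using const_in_E[OF GF_m_n[OF zGF[OF that]]] .
    define d where "d j = s j \<ominus>\<^bsub>E\<^esub> u j" for j
    have dS: "d \<in> {..<m} \<rightarrow> S"
    proof
      fix j assume "j \<in> {..<m}"
      then have "s j \<in> S" "u j \<in> S" using s u by auto
      then show "d j \<in> S" unfolding d_def a_minus_def
        by (intro subringE(7)[OF S_sub] subringE(5)[OF S_sub])
    qed
    have dE: "d j \<in> carrier E" if "j < m" for j using dS SE that by auto
    have "LS z d \<oplus>\<^bsub>E\<^esub> LS z u = (\<Oplus>\<^bsub>E\<^esub>j\<in>{..<m}. const_op M (z j) \<otimes>\<^bsub>E\<^esub> d j \<oplus>\<^bsub>E\<^esub> const_op M (z j) \<otimes>\<^bsub>E\<^esub> u j)"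
      unfolding LS_def by (rule E.finsum_addf[symmetric]) (use zE dE sE in auto)
    also have "\<dots> = LS z s"
      unfolding LS_def
    proof (rule E.finsum_cong'[OF refl])
      fix j assume "j \<in> {..<m}"
      then have j: "j < m" by simp
      have "d j \<oplus>\<^bsub>E\<^esub> u j = s j" unfolding d_def a_minus_def
        using sE[OF j] by (simp add: E.a_assoc E.l_neg)
      then show "const_op M (z j) \<otimes>\<^bsub>E\<^esub> d j \<oplus>\<^bsub>E\<^esub> const_op M (z j) \<otimes>\<^bsub>E\<^esub> u j = const_op M (z j) \<otimes>\<^bsub>E\<^esub> s j"
        using E.r_distr[OF dE[OF j] sE(2)[OF j] zE[OF j]] by simp
    qed (use zE sE in auto)
    finally have sum: "LS z d \<oplus>\<^bsub>E\<^esub> LS z u = LS z u" using eq by simp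
    have "u \<in> {..<m} \<rightarrow> S" using u by blast
    then have "LS z d \<in> carrier E" "LS z u \<in> carrier E"
      using LS_mem[OF dS] LS_mem[of u] R_in_E by simp_all
    then have "LS z d = \<zero>\<^bsub>E\<^esub>" using sum by simp
    then have rel: "(\<Oplus>\<^bsub>E\<^esub>j\<in>{..<m}. const_op M (z j) \<otimes>\<^bsub>E\<^esub> d j) = \<zero>\<^bsub>E\<^esub>" unfolding LS_def .
    have d0: "\<forall>j<m. d j = \<zero>\<^bsub>E\<^esub>"
      by (rule L_S_independence[where z = z, OF _ _ dS rel]) (fact zGF indep)+
    show "s = u"
    proof (rule PiE_ext[OF s u])
      fix j assume "j \<in> {..<m}"
      then have "s j \<ominus>\<^bsub>E\<^esub> u j = \<zero>\<^bsub>E\<^esub>" "s j \<in> carrier E" "u j \<in> carrier E" using d0 sE unfolding d_def by auto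
      then show "s j = u j" by simp
    qed
  qed
  have finR: "finite R" by (rule finite_subset[OF _ finite_E]) (use R_in_E in auto)
  have sub: "LS z ` ({..<m} \<rightarrow> S) \<subseteq> R" by (rule image_subsetI) (rule LS_mem)
  have "card S = card R0 ^ m"
  proof -
    have "inj_on (lin m) ({..<m} \<rightarrow>\<^sub>E R0)"
      unfolding R0_def by (rule inj_onI) (rule lin_inj[OF m])
    then have "card (lin m ` ({..<m} \<rightarrow>\<^sub>E R0)) = card ({..<m} \<rightarrow>\<^sub>E R0)" by (rule card_image)
    then show ?thesis unfolding R0_def S_def Sgen_eq_lin[OF m_pos] by (simp add: card_PiE)
  qed
  then have "card R = card S ^ m" unfolding card_R by (simp add: power_mult)
  also have "\<dots> = card ({..<m} \<rightarrow>\<^sub>E S)" by (simp add: card_PiE)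
  also have "\<dots> = card (LS z ` ({..<m} \<rightarrow>\<^sub>E S))" by (rule card_image[OF inj, symmetric])
  finally have "card R \<le> card (LS z ` ({..<m} \<rightarrow>\<^sub>E S))" by simp
  moreover have sub2: "LS z ` ({..<m} \<rightarrow>\<^sub>E S) \<subseteq> LS z ` ({..<m} \<rightarrow> S)"
    by (intro image_mono) (simp add: PiE_def)
  ultimately have "LS z ` ({..<m} \<rightarrow>\<^sub>E S) = R"
    using card_seteq[OF finR subset_trans[OF sub2 sub]] by simp
  then show ?thesis using antisym[OF sub] sub2 by simp
qed

end

section \<open>The tensor product of the constants with the Frobenius ring\<close>

context drinfeld_torsion_divisor
begin

abbreviation Fq :: "'k ring" where "Fq \<equiv> ring_of_type_algebra"

lemma Fq_simps [simp]: "carrier Fq = UNIV" "a \<otimes>\<^bsub>Fq\<^esub> b = a * b" "a \<oplus>\<^bsub>Fq\<^esub> b = a + b" "\<one>\<^bsub>Fq\<^esub> = 1"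
  by (simp_all add: ring_of_type_algebra_def)

lemma ops_simps: "carrier (ops_module M U) = U" "\<zero>\<^bsub>ops_module M U\<^esub> = \<zero>\<^bsub>E\<^esub>"
  "f \<oplus>\<^bsub>ops_module M U\<^esub> g = f \<oplus>\<^bsub>E\<^esub> g"
  by (simp_all add: ops_module_def E_def module_End_def)

text \<open>
  Scalars of the ground field act like the constant polynomials of \<open>A\<close>.
\<close>

lemma ops_smult:
  assumes "f \<in> carrier E"
  shows "c \<odot>\<^bsub>ops_module M U\<^esub> f = sop [:c:] \<otimes>\<^bsub>E\<^esub> f"
proof
  have prod: "sop [:c:] \<otimes>\<^bsub>E\<^esub> f \<in> V \<rightarrow>\<^sub>E V" using E.m_closed[OF sop_in_E assms] unfolding E_mem by blast
  fix v show "(c \<odot>\<^bsub>ops_module M U\<^esub> f) v = (sop [:c:] \<otimes>\<^bsub>E\<^esub> f) v"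
    using PiE_arb[OF prod, of v] E_closed[OF assms, of v]
    by (cases "v \<in> V") (simp_all add: ops_module_def E_apply op_apply act_const)
qed

lemma ops_module_is_module:
  assumes U: "U \<subseteq> carrier E" and zero: "\<zero>\<^bsub>E\<^esub> \<in> U"
    and add: "\<And>f g. f \<in> U \<Longrightarrow> g \<in> U \<Longrightarrow> f \<oplus>\<^bsub>E\<^esub> g \<in> U"
    and minus: "\<And>f. f \<in> U \<Longrightarrow> \<ominus>\<^bsub>E\<^esub> f \<in> U"
    and smult: "\<And>c f. f \<in> U \<Longrightarrow> sop [:c:] \<otimes>\<^bsub>E\<^esub> f \<in> U"
  shows "module Fq (ops_module M U)"
proof (rule moduleI)
  note UE = subsetD[OF U]
  show "cring Fq" by (rule cring_from_type_algebra)
  show "abelian_group (ops_module M U)"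
  proof (rule abelian_groupI)
    fix f assume f: "f \<in> carrier (ops_module M U)"
    then show "\<exists>g\<in>carrier (ops_module M U). g \<oplus>\<^bsub>ops_module M U\<^esub> f = \<zero>\<^bsub>ops_module M U\<^esub>"
      using minus UE by (intro bexI[of _ "\<ominus>\<^bsub>E\<^esub> f"]) (simp_all add: ops_simps E.l_neg)
  qed (simp_all add: ops_simps zero add UE E.a_ac)
  fix c d f assume f: "f \<in> carrier (ops_module M U)"
  then have fU: "f \<in> U" and fE: "f \<in> carrier E" using UE by (auto simp: ops_simps)
  have const_add: "sop [:c + d:] = sop [:c:] \<oplus>\<^bsub>E\<^esub> sop [:d:]" and const_mult: "sop [:c * d:] = sop [:c:] \<otimes>\<^bsub>E\<^esub> sop [:d:]"
    using sop_ops(1)[of "[:c:]" "[:d:]"] sop_ops(2)[of "[:c:]" "[:d:]"] by (simp_all add: mult.commute)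
  show "c \<odot>\<^bsub>ops_module M U\<^esub> f \<in> carrier (ops_module M U)"
    unfolding ops_smult[OF fE] ops_simps by (rule smult[OF fU])
  show "(c \<oplus>\<^bsub>Fq\<^esub> d) \<odot>\<^bsub>ops_module M U\<^esub> f = c \<odot>\<^bsub>ops_module M U\<^esub> f \<oplus>\<^bsub>ops_module M U\<^esub> d \<odot>\<^bsub>ops_module M U\<^esub> f"
    unfolding ops_smult[OF fE] ops_simps Fq_simps const_add by (rule E.l_distr[OF sop_in_E sop_in_E fE])
  have "(c \<otimes>\<^bsub>Fq\<^esub> d) \<odot>\<^bsub>ops_module M U\<^esub> f = sop [:c:] \<otimes>\<^bsub>E\<^esub> (sop [:d:] \<otimes>\<^bsub>E\<^esub> f)"
    unfolding ops_smult[OF fE] Fq_simps const_mult by (rule E.m_assoc[OF sop_in_E sop_in_E fE])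
  then show "(c \<otimes>\<^bsub>Fq\<^esub> d) \<odot>\<^bsub>ops_module M U\<^esub> f = c \<odot>\<^bsub>ops_module M U\<^esub> (d \<odot>\<^bsub>ops_module M U\<^esub> f)"
    unfolding ops_smult[OF fE] ops_smult[OF E.m_closed[OF sop_in_E fE]] .
  have "sop [:1:] = \<one>\<^bsub>E\<^esub>" using sop_ops(4) by (simp add: one_pCons)
  then show "\<one>\<^bsub>Fq\<^esub> \<odot>\<^bsub>ops_module M U\<^esub> f = f" unfolding ops_smult[OF fE] Fq_simps using fE by simp
  fix g assume "g \<in> carrier (ops_module M U)"
  then have gE: "g \<in> carrier E" using UE by (auto simp: ops_simps)
  show "c \<odot>\<^bsub>ops_module M U\<^esub> (f \<oplus>\<^bsub>ops_module M U\<^esub> g) = c \<odot>\<^bsub>ops_module M U\<^esub> f \<oplus>\<^bsub>ops_module M U\<^esub> c \<odot>\<^bsub>ops_module M U\<^esub> g"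
    unfolding ops_simps ops_smult[OF fE] ops_smult[OF gE] ops_smult[OF E.a_closed[OF fE gE]]
    by (rule E.r_distr[OF fE gE sop_in_E])
qed

lemma const_op_arith:
  assumes x: "x \<in> subfield_GF n" and y: "y \<in> subfield_GF n"
  shows "const_op M x \<oplus>\<^bsub>E\<^esub> const_op M y = const_op M (x + y)" "\<ominus>\<^bsub>E\<^esub> const_op M x = const_op M (- x)"
    "sop [:c:] \<otimes>\<^bsub>E\<^esub> const_op M x = const_op M (to_ac c * x)"
proof -
  note cl = const_in_E[OF x] const_in_E[OF y] const_in_E[OF subfield_GF_closed(1)[OF x y]]
    const_in_E[OF subfield_GF_closed(3)[OF x y]]
    const_in_E[OF subfield_GF_closed(2)[OF to_ac_in_subfield_GF x]]
  show "const_op M x \<oplus>\<^bsub>E\<^esub> const_op M y = const_op M (x + y)"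
    by (rule E_eqI) (simp_all add: cl E_apply op_apply distrib_right)
  show "\<ominus>\<^bsub>E\<^esub> const_op M x = const_op M (- x)"
    by (rule E_eqI) (simp_all add: cl E_minus op_apply)
  show "sop [:c:] \<otimes>\<^bsub>E\<^esub> const_op M x = const_op M (to_ac c * x)"
    by (rule E_eqI) (simp_all add: cl sop_in_E E_apply op_apply V_GF[OF _ x] act_const mult.assoc)
qed

lemma const_in_L: "z \<in> subfield_GF m \<Longrightarrow> const_op M z \<in> L" unfolding L_def by (rule imageI)

lemma L_in_E: "l \<in> L \<Longrightarrow> l \<in> carrier E"
  by (rule R_in_E[OF subsetD[OF L_subset_R]])

lemma S_in_E: "s \<in> S \<Longrightarrow> s \<in> carrier E" unfolding S_def by (rule Sgen_in_E)

lemma S_subring: "subring S E" unfolding S_def by (rule Sgen_subring)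

lemma L_module: "module Fq (ops_module M L)"
proof (rule ops_module_is_module)
  show "L \<subseteq> carrier E" using L_in_E by auto
  have "\<zero>\<^bsub>E\<^esub> = const_op M 0" unfolding E_zero_def const_op_eq by (simp add: fun_eq_iff restrict_def)
  then show "\<zero>\<^bsub>E\<^esub> \<in> L" unfolding L_def using to_ac_in_subfield_GF[of 0] by auto
  fix f assume "f \<in> L"
  then obtain x where x: "x \<in> subfield_GF m" "f = const_op M x" unfolding L_def by auto
  show "\<ominus>\<^bsub>E\<^esub> f \<in> L" unfolding x(2) const_op_arith(2)[OF GF_m_n[OF x(1)] GF_m_n[OF x(1)]]
    unfolding L_def by (rule imageI) (rule subfield_GF_closed(3)[OF x(1) x(1)])
  show "sop [:c:] \<otimes>\<^bsub>E\<^esub> f \<in> L" for c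
    unfolding x(2) const_op_arith(3)[OF GF_m_n[OF x(1)] GF_m_n[OF x(1)]]
    unfolding L_def by (rule imageI) (rule subfield_GF_closed(2)[OF to_ac_in_subfield_GF x(1)])
  fix g assume "g \<in> L"
  then obtain y where y: "y \<in> subfield_GF m" "g = const_op M y" unfolding L_def by auto
  show "f \<oplus>\<^bsub>E\<^esub> g \<in> L" unfolding x(2) y(2) const_op_arith(1)[OF GF_m_n[OF x(1)] GF_m_n[OF y(1)]]
    unfolding L_def by (rule imageI) (rule subfield_GF_closed(1)[OF x(1) y(1)])
qed

lemma S_module: "module Fq (ops_module M S)"
proof (rule ops_module_is_module)
  show "S \<subseteq> carrier E" using S_in_E by auto
  show "\<zero>\<^bsub>E\<^esub> \<in> S" by (rule subringE(2)[OF S_subring])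
  fix f assume f: "f \<in> S"
  show "\<ominus>\<^bsub>E\<^esub> f \<in> S" by (rule subringE(5)[OF S_subring f])
  show "sop [:c:] \<otimes>\<^bsub>E\<^esub> f \<in> S" for c
    using subringE(6)[OF S_subring _ f] sop_in_Sgen unfolding S_def by simp
  show "f \<oplus>\<^bsub>E\<^esub> g \<in> S" if "g \<in> S" for g by (rule subringE(7)[OF S_subring f that])
qed

lemma sop_L_commute:
  assumes "l \<in> L" shows "sop a \<otimes>\<^bsub>E\<^esub> l = l \<otimes>\<^bsub>E\<^esub> sop a"
proof -
  obtain x where x: "x \<in> subfield_GF m" "l = const_op M x" using assms unfolding L_def by auto
  show ?thesis unfolding x(2) by (rule const_commute[OF m x(1) sop_in_Sgen])
qed

lemma finsum_ops:
  assumes "module Fq (ops_module M U)" "U \<subseteq> carrier E" "finite A" "f \<in> A \<rightarrow> U"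
  shows "(\<Oplus>\<^bsub>ops_module M U\<^esub>j\<in>A. f j) = (\<Oplus>\<^bsub>E\<^esub>j\<in>A. f j)"
  using assms(3,4)
proof (induction A rule: finite_induct)
  case empty
  interpret U: module Fq "ops_module M U" by (rule assms(1))
  show ?case using U.M.finsum_empty by (simp add: ops_simps)
next
  case (insert j A)
  interpret U: module Fq "ops_module M U" by (rule assms(1))
  have "(\<Oplus>\<^bsub>ops_module M U\<^esub>j\<in>insert j A. f j) = f j \<oplus>\<^bsub>ops_module M U\<^esub> (\<Oplus>\<^bsub>ops_module M U\<^esub>j\<in>A. f j)"
    by (rule U.M.finsum_insert) (use insert in \<open>auto simp: ops_simps\<close>)
  moreover have "(\<Oplus>\<^bsub>E\<^esub>j\<in>insert j A. f j) = f j \<oplus>\<^bsub>E\<^esub> (\<Oplus>\<^bsub>E\<^esub>j\<in>A. f j)"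
    by (rule E.finsum_insert) (use insert assms(2) in auto)
  ultimately show ?case using insert by (simp add: ops_simps)
qed

lemma tensor_bij:
  "bij_betw (tensor_lift E (\<lambda>l s. l \<otimes>\<^bsub>E\<^esub> s)) (carrier (tensor_product Fq (ops_module M L) (ops_module M S))) R"
proof -
  interpret balanced_map Fq "ops_module M L" "ops_module M S" E "\<lambda>l s. l \<otimes>\<^bsub>E\<^esub> s"
  proof (intro balanced_map.intro L_module S_module E.abelian_group_axioms balanced_map_axioms.intro)
    fix c l s assume c: "c \<in> carrier Fq" and "l \<in> carrier (ops_module M L)" "s \<in> carrier (ops_module M S)"
    then have l: "l \<in> L" "l \<in> carrier E" and s: "s \<in> carrier E" using L_in_E S_in_E by (auto simp: ops_simps)
    show "(c \<odot>\<^bsub>ops_module M L\<^esub> l) \<otimes>\<^bsub>E\<^esub> s = l \<otimes>\<^bsub>E\<^esub> (c \<odot>\<^bsub>ops_module M S\<^esub> s)"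
      unfolding ops_smult[OF l(2)] ops_smult[OF s] sop_L_commute[OF l(1)]
      by (rule E.m_assoc[OF l(2) sop_in_E s])
  qed (auto simp: ops_simps L_in_E S_in_E E.l_distr E.r_distr)
  obtain z :: "nat \<Rightarrow> 'k alg_closure" where
    zGF: "\<And>j. j < m \<Longrightarrow> z j \<in> subfield_GF m"
    and span: "\<And>x. x \<in> subfield_GF m \<Longrightarrow> \<exists>c. x = (\<Sum>j<m. to_ac (c j) * z j)"
    and indep: "\<And>c. (\<Sum>j<m. to_ac (c j) * z j) = 0 \<Longrightarrow> \<forall>j<m. c j = 0"
    by (rule subfield_GF_basis[OF m_pos, where 'k = 'k]) blast
  define b where "b j = const_op M (z j)" for j
  have bL: "b j \<in> L" if "j < m" for j unfolding b_def L_def using zGF[OF that] by blast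
  have L_E: "L \<subseteq> carrier E" using L_in_E by auto
  have "bij_betw (tensor_lift E (\<lambda>l s. l \<otimes>\<^bsub>E\<^esub> s)) (carrier (tensor_product Fq (ops_module M L) (ops_module M S)))
    ((\<lambda>s. \<Oplus>\<^bsub>E\<^esub>j\<in>{..<m}. b j \<otimes>\<^bsub>E\<^esub> s j) ` ({..<m} \<rightarrow> carrier (ops_module M S)))"
  proof (rule tensor_lift_bij)
    show "b \<in> {..<m} \<rightarrow> carrier (ops_module M L)" using bL by (auto simp: ops_simps)
  next
    fix l assume "l \<in> carrier (ops_module M L)"
    then obtain x where x: "x \<in> subfield_GF m" "l = const_op M x" unfolding ops_simps L_def by auto
    obtain c where c: "x = (\<Sum>j<m. to_ac (c j) * z j)" using span[OF x(1)] by blast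
    have term_eq: "c j \<odot>\<^bsub>ops_module M L\<^esub> b j = const_op M (to_ac (c j) * z j)" if "j < m" for j
      unfolding ops_smult[OF L_in_E[OF bL[OF that]]] unfolding b_def
      by (rule const_op_arith(3)[OF GF_m_n[OF zGF[OF that]] GF_m_n[OF zGF[OF that]]])
    have tGF: "to_ac (c j) * z j \<in> subfield_GF m" if "j < m" for j
      by (rule subfield_GF_closed(2)[OF to_ac_in_subfield_GF zGF[OF that]])
    have tL: "c j \<odot>\<^bsub>ops_module M L\<^esub> b j \<in> L" if "j < m" for j
      unfolding term_eq[OF that] by (rule const_in_L[OF tGF[OF that]])
    have "(\<Oplus>\<^bsub>ops_module M L\<^esub>j\<in>{..<m}. c j \<odot>\<^bsub>ops_module M L\<^esub> b j) =
        (\<Oplus>\<^bsub>E\<^esub>j\<in>{..<m}. c j \<odot>\<^bsub>ops_module M L\<^esub> b j)"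
      by (rule finsum_ops[OF L_module L_E finite_lessThan]) (use tL in auto)
    also have "\<dots> = l"
    proof (rule E_eqI)
      show "(\<Oplus>\<^bsub>E\<^esub>j\<in>{..<m}. c j \<odot>\<^bsub>ops_module M L\<^esub> b j) \<in> carrier E"
        by (rule E.finsum_closed) (use tL L_in_E in auto)
      show "l \<in> carrier E" unfolding x(2) by (rule const_in_E[OF GF_m_n[OF x(1)]])
      fix v assume v: "v \<in> V"
      have "(\<Oplus>\<^bsub>E\<^esub>j\<in>{..<m}. c j \<odot>\<^bsub>ops_module M L\<^esub> b j) v = (\<Sum>j<m. (c j \<odot>\<^bsub>ops_module M L\<^esub> b j) v)"
        by (rule E_finsum[OF finite_lessThan _ v]) (use tL L_in_E in auto)
      also have "\<dots> = (\<Sum>j<m. (to_ac (c j) * z j) * v)"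
        by (rule sum.cong[OF refl]) (simp add: term_eq op_apply v)
      also have "\<dots> = l v" unfolding x(2) op_apply(3)[OF v] c sum_distrib_right ..
      finally show "(\<Oplus>\<^bsub>E\<^esub>j\<in>{..<m}. c j \<odot>\<^bsub>ops_module M L\<^esub> b j) v = l v" .
    qed
    finally show "\<exists>a\<in>{..<m} \<rightarrow> carrier Fq. l = (\<Oplus>\<^bsub>ops_module M L\<^esub>j\<in>{..<m}. a j \<odot>\<^bsub>ops_module M L\<^esub> b j)"
      by (intro bexI[of _ c]) simp_all
  next
    fix s assume s: "s \<in> {..<m} \<rightarrow> carrier (ops_module M S)"
      and rel: "(\<Oplus>\<^bsub>E\<^esub>j\<in>{..<m}. b j \<otimes>\<^bsub>E\<^esub> s j) = \<zero>\<^bsub>E\<^esub>"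
    have s': "s \<in> {..<m} \<rightarrow> S" using s unfolding ops_simps .
    have rel': "(\<Oplus>\<^bsub>E\<^esub>j\<in>{..<m}. const_op M (z j) \<otimes>\<^bsub>E\<^esub> s j) = \<zero>\<^bsub>E\<^esub>" using rel unfolding b_def .
    show "\<forall>j<m. s j = \<zero>\<^bsub>ops_module M S\<^esub>"
      unfolding ops_simps by (rule L_S_independence[where z = z, OF _ _ s' rel']) (fact zGF indep)+
  qed
  also have "((\<lambda>s. \<Oplus>\<^bsub>E\<^esub>j\<in>{..<m}. b j \<otimes>\<^bsub>E\<^esub> s j) ` ({..<m} \<rightarrow> carrier (ops_module M S))) = LS z ` ({..<m} \<rightarrow> S)"
    unfolding ops_simps b_def LS_def[abs_def] ..
  also have "\<dots> = R" by (rule R_eq_LS[where z = z]) (fact zGF indep)+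
  finally show ?thesis .
qed

section \<open>Reduction of endomorphisms\<close>

definition \<pi> :: "'k alg_closure poly" where "\<pi> = twisted_tau [^]\<^bsub>twisted_ring\<^esub> r"
definition B :: "'k alg_closure poly set" where
  "B = generate_ring twisted_ring (twisted_const ` subfield_GF m \<union> {\<phi> [:0, 1:], \<pi>})"

lemma B_subring: "subring B twisted_ring"
  unfolding B_def by (rule ring.generate_ring_is_subring[OF twisted_ring_is_ring]) simp

text \<open>
  Commutation with \<open>\<phi> a\<close> is tested on the closure: there \<open>\<phi> a\<close> commutes with the \<open>r\<close>-fold Frobenius
  because \<open>t\<close> is fixed by it, and with the constants in question because they are fixed by \<open>\<tau>^n\<close>.
\<close>

lemma B_subset_End: "B \<subseteq> drinfeld_End \<phi>"
  unfolding B_def drinfeld_End_def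
proof (rule ring.generate_ring_min_subring1[OF twisted_ring_is_ring])
  show "subring (centralizer twisted_ring (range \<phi>)) twisted_ring"
    by (rule ring.centralizer_subring[OF twisted_ring_is_ring]) simp
  have mem: "f \<in> centralizer twisted_ring (range \<phi>)"
    if "\<And>a v. twisted_act f (act a v) = act a (twisted_act f v)" for f
    unfolding centralizer_def
    by (auto intro!: twisted_act_inject simp: twisted_act_mult that[unfolded act_def])
  have "twisted_const z \<in> centralizer twisted_ring (range \<phi>)" if "z \<in> subfield_GF m" for z
    by (rule mem) (simp add: twisted_const_def twisted_act_const act_GF[OF GF_m_n[OF that]])
  moreover have "\<phi> [:0, 1:] \<in> centralizer twisted_ring (range \<phi>)"
    by (rule mem) (simp add: act_def[symmetric] act_commute)
  moreover have "\<pi> \<in> centralizer twisted_ring (range \<phi>)"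
    using act_frob[of _ _ 1] by (intro mem) (simp add: \<pi>_def twisted_act_pow_tau)
  ultimately show "twisted_const ` subfield_GF m \<union> {\<phi> [:0, 1:], \<pi>} \<subseteq> centralizer twisted_ring (range \<phi>)"
    by blast
qed simp

lemma \<phi>_in_B: "\<phi> a \<in> B"
proof (induction a)
  case 0
  show ?case using subringE(2)[OF B_subring] by simp
next
  case (pCons c a)
  have "pCons c a = [:c:] + [:0, 1:] * a" by simp
  then have "\<phi> (pCons c a) = \<phi> [:c:] + twisted_mult (\<phi> [:0, 1:]) (\<phi> a)"
    using \<phi>_add \<phi>_mult by metis
  moreover have "\<phi> [:c:] \<in> B"
    unfolding \<phi>_const B_def by (rule generate_ring.incl) (use to_ac_in_subfield_GF in blast)
  moreover have "\<phi> [:0, 1:] \<in> B" unfolding B_def by (rule generate_ring.incl) blast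
  ultimately show ?case
    using pCons subringE(6,7)[OF B_subring, of "\<phi> [:0, 1:]" "\<phi> a"] subringE(7)[OF B_subring, of "\<phi> [:c:]"] by simp
qed

lemma reduction_eq: "reduction M f = (\<lambda>v\<in>V. twisted_act f v)" unfolding reduction_def by simp

lemma reduction_apply: "v \<in> V \<Longrightarrow> reduction M f v = twisted_act f v" by (simp add: reduction_eq)

lemma End_act:
  assumes "f \<in> drinfeld_End \<phi>"
  shows "twisted_act f (act a v) = act a (twisted_act f v)"
proof -
  have "twisted_mult f (\<phi> a) = twisted_mult (\<phi> a) f"
    using assms unfolding drinfeld_End_def centralizer_def by simp
  then show ?thesis unfolding act_def twisted_act_mult[symmetric] by simp
qed

lemma End_V: "f \<in> drinfeld_End \<phi> \<Longrightarrow> v \<in> V \<Longrightarrow> twisted_act f v \<in> V"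
  using End_act[of f p v] unfolding V_def by simp

lemma reduction_in_E:
  assumes f: "f \<in> drinfeld_End \<phi>" shows "reduction M f \<in> carrier E"
  unfolding E_mem reduction_eq by (auto simp: End_V[OF f] V_add V_act twisted_act_add End_act[OF f])

lemma reduction_generators:
  "reduction M (twisted_const z) = const_op M z" "reduction M (\<phi> a) = sop a"
  "reduction M \<pi> = fr 1" "reduction M (\<pi> [^]\<^bsub>twisted_ring\<^esub> (i::nat)) = fr i"
  unfolding reduction_eq const_op_eq sop_def fr_def \<pi>_def
  by (simp_all add: fun_eq_iff restrict_def twisted_const_def twisted_act_const act_def twisted_act_pow_tau
      twisted_act_pow_tau_pow)

lemma reduction_hom:
  assumes f: "f \<in> drinfeld_End \<phi>" and g: "g \<in> drinfeld_End \<phi>"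
  shows "reduction M (f + g) = reduction M f \<oplus>\<^bsub>E\<^esub> reduction M g"
    "reduction M (twisted_mult f g) = reduction M f \<otimes>\<^bsub>E\<^esub> reduction M g"
    "reduction M (- f) = \<ominus>\<^bsub>E\<^esub> reduction M f" "reduction M 1 = \<one>\<^bsub>E\<^esub>"
proof -
  have sr: "subring (drinfeld_End \<phi>) twisted_ring"
    unfolding drinfeld_End_def by (rule ring.centralizer_subring[OF twisted_ring_is_ring]) simp
  have cl: "f + g \<in> drinfeld_End \<phi>" "twisted_mult f g \<in> drinfeld_End \<phi>" "- f \<in> drinfeld_End \<phi>" "1 \<in> drinfeld_End \<phi>"
    using subringE(7)[OF sr f g] subringE(6)[OF sr f g] subringE(5)[OF sr f] subringE(3)[OF sr]
    by (simp_all add: twisted_a_inv)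
  note rE = reduction_in_E[OF f] reduction_in_E[OF g] cl[THEN reduction_in_E]
  show "reduction M (f + g) = reduction M f \<oplus>\<^bsub>E\<^esub> reduction M g"
    by (rule E_eqI) (simp_all add: rE E_apply reduction_apply twisted_act_add_poly)
  show "reduction M (twisted_mult f g) = reduction M f \<otimes>\<^bsub>E\<^esub> reduction M g"
    by (rule E_eqI) (simp_all add: rE E_apply reduction_apply End_V[OF g] twisted_act_mult)
  show "reduction M (- f) = \<ominus>\<^bsub>E\<^esub> reduction M f"
    by (rule E_eqI) (simp_all add: rE E_minus reduction_apply twisted_act_minus_poly)
  show "reduction M 1 = \<one>\<^bsub>E\<^esub>"
    by (rule E_eqI) (simp_all add: rE E_apply reduction_apply)
qed

lemma reduction_B_subring: "subring (reduction M ` B) E"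
proof (rule E.subringI)
  note BE = subsetD[OF B_subset_End]
  show "reduction M ` B \<subseteq> carrier E" using reduction_in_E BE by blast
  have 1: "1 \<in> B" using subringE(3)[OF B_subring] by simp
  show "\<one>\<^bsub>E\<^esub> \<in> reduction M ` B"
    using 1 reduction_hom(4)[OF BE[OF 1] BE[OF 1]] by (metis imageI)
  fix x assume "x \<in> reduction M ` B"
  then obtain f where f: "f \<in> B" "x = reduction M f" by blast
  have "- f \<in> B" using subringE(5)[OF B_subring f(1)] by (simp add: twisted_a_inv)
  then show "\<ominus>\<^bsub>E\<^esub> x \<in> reduction M ` B"
    unfolding f(2) reduction_hom(3)[OF BE[OF f(1)] BE[OF f(1)], symmetric] by (rule imageI)
  fix y assume "y \<in> reduction M ` B"
  then obtain g where g: "g \<in> B" "y = reduction M g" by blast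
  have fg: "twisted_mult f g \<in> B" "f + g \<in> B"
    using subringE(6)[OF B_subring f(1) g(1)] subringE(7)[OF B_subring f(1) g(1)] by simp_all
  show "x \<otimes>\<^bsub>E\<^esub> y \<in> reduction M ` B"
    unfolding f(2) g(2) reduction_hom(2)[OF BE[OF f(1)] BE[OF g(1)], symmetric] by (rule imageI[OF fg(1)])
  show "x \<oplus>\<^bsub>E\<^esub> y \<in> reduction M ` B"
    unfolding f(2) g(2) reduction_hom(1)[OF BE[OF f(1)] BE[OF g(1)], symmetric] by (rule imageI[OF fg(2)])
qed

text \<open>
  The reduction of \<open>B\<close> is a ring containing \<open>L\<close> and \<open>S\<close>, and these generate \<open>R\<close>.
\<close>

lemma reduction_B: "reduction M ` B = R"
proof
  note BE = subsetD[OF B_subset_End]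
  show "reduction M ` B \<subseteq> R"
  proof (rule image_subsetI)
    fix f assume "f \<in> B"
    then show "reduction M f \<in> R"
      unfolding B_def
    proof (induction rule: generate_ring.induct)
      case one
      have "1 \<in> B" using subringE(3)[OF B_subring] by simp
      then show ?case using reduction_hom(4)[OF BE BE] subringE(3)[OF R_subring] by simp
    next
      case (incl f)
      have "const_op M z \<in> R" if "z \<in> subfield_GF m" for z using const_in_R_iff[OF GF_m_n[OF that]] that by blast
      moreover have "sop a \<in> R" for a using S_subset_R sop_in_Sgen unfolding S_def by blast
      moreover have "fr 1 \<in> R" using S_subset_R fr_in_Sgen unfolding S_def by blast
      ultimately show ?case using incl by (auto simp: reduction_generators)
    next
      case (a_inv f)
      then have "f \<in> B" unfolding B_def by simp
      then show ?case using a_inv.IH subringE(5)[OF R_subring] reduction_hom(3)[OF BE BE, of f f]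
        by (simp add: twisted_a_inv)
    next
      case (eng_add f g)
      then have "f \<in> B" "g \<in> B" unfolding B_def by simp_all
      then show ?case using eng_add.IH subringE(7)[OF R_subring] reduction_hom(1)[OF BE BE, of f g] by simp
    next
      case (eng_mult f g)
      then have "f \<in> B" "g \<in> B" unfolding B_def by simp_all
      then show ?case using eng_mult.IH subringE(6)[OF R_subring] reduction_hom(2)[OF BE BE, of f g] by simp
    qed
  qed
  show "R \<subseteq> reduction M ` B"
  proof
    fix x assume x: "x \<in> R"
    obtain z :: "nat \<Rightarrow> 'k alg_closure" where
      zGF: "\<And>j. j < m \<Longrightarrow> z j \<in> subfield_GF m"
      and indep: "\<And>c. (\<Sum>j<m. to_ac (c j) * z j) = 0 \<Longrightarrow> \<forall>j<m. c j = 0"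
      by (rule subfield_GF_basis[OF m_pos, where 'k = 'k]) blast
    have "R = LS z ` ({..<m} \<rightarrow> S)" by (rule R_eq_LS[where z = z, symmetric]) (fact zGF indep)+
    then obtain s where s: "s \<in> {..<m} \<rightarrow> S" "x = LS z s" using x by blast
    have LB: "L \<subseteq> reduction M ` B"
    proof
      fix l assume "l \<in> L"
      then obtain y where y: "y \<in> subfield_GF m" "l = reduction M (twisted_const y)"
        unfolding L_def reduction_generators by blast
      have "twisted_const y \<in> B" unfolding B_def by (rule generate_ring.incl) (use y in blast)
      then show "l \<in> reduction M ` B" unfolding y(2) by (rule imageI)
    qed
    have SB: "S \<subseteq> reduction M ` B"
      unfolding S_def Sgen_def
    proof (rule E.generate_ring_min_subring1[OF gens_in_E reduction_B_subring])
      have "\<pi> \<in> B" unfolding B_def by (rule generate_ring.incl) blast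
      then have "fr 1 \<in> reduction M ` B" unfolding reduction_generators(3)[symmetric] by (rule imageI)
      moreover have "sop a \<in> reduction M ` B" for a
        unfolding reduction_generators(2)[symmetric] by (rule imageI[OF \<phi>_in_B])
      ultimately show "insert (fr 1) (range sop) \<subseteq> reduction M ` B" by auto
    qed
    show "x \<in> reduction M ` B"
      unfolding s(2) by (rule LS_in_subring[where z = z, OF reduction_B_subring LB SB _ s(1)]) (fact zGF)
  qed
qed

end

section \<open>The theorem\<close>

theorem proposition2p7:
  fixes n r m :: nat
    and p0 p :: "('k :: {finite, field}) poly"
    and t :: "'k alg_closure"
    and \<phi> :: "'k poly \<Rightarrow> 'k alg_closure poly"
    and \<pi> :: "'k alg_closure poly"
    and \<kappa> :: "'k poly set ring"
    and M :: "('k poly set, 'k alg_closure) module"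
    and E :: "('k alg_closure \<Rightarrow> 'k alg_closure) ring"
    and S R0 R L :: "('k alg_closure \<Rightarrow> 'k alg_closure) set"
    and B :: "'k alg_closure poly set"
  assumes n: "n \<ge> 1"
    and p0: "lead_coeff p0 = 1" "Factorial_Ring.irreducible p0" "Polynomial.degree p0 = r"
    and gcd: "gcd n r = 1"
    and t: "t \<in> subfield_GF r" "poly (map_poly to_ac p0) t = 0"
    and \<phi>_hom: "\<phi> \<in> ring_hom poly_A twisted_ring" "\<And>c. \<phi> [:c:] = twisted_const (to_ac c)"
    and \<phi>_T: "\<phi> [:0, 1:] = twisted_const t \<oplus>\<^bsub>twisted_ring\<^esub> twisted_tau [^]\<^bsub>twisted_ring\<^esub> n"
    and p: "lead_coeff p = 1" "Factorial_Ring.irreducible p" "p \<noteq> p0"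
    and \<kappa>: "\<kappa> = residue_field p"
    and M: "M = torsion_module \<phi> p"
    and E: "E = module_End \<kappa> M"
    and \<pi>: "\<pi> = twisted_tau [^]\<^bsub>twisted_ring\<^esub> r"
    and m: "m dvd n"
    and S: "S = generate_ring E (scalar_ops \<kappa> M \<union> {reduction M \<pi>})"
    and R0: "R0 = generate_ring E (scalar_ops \<kappa> M \<union> {reduction M (\<pi> [^]\<^bsub>twisted_ring\<^esub> m)})"
    and R: "R = centralizer E R0"
    and L: "L = const_op M ` subfield_GF m"
    and B: "B = generate_ring twisted_ring (twisted_const ` subfield_GF m \<union> {\<phi> [:0, 1:], \<pi>})"
  shows
    \<comment> \<open>(1), the isomorphism being one of algebras over \<open>R0\<close>\<close>
    "R = carrier (module_End (E\<lparr>carrier := R0\<rparr>) (evaluation_module M)) \<and>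
     (\<exists>h \<in> ring_iso (E\<lparr>carrier := R\<rparr>) (mat_ring m (E\<lparr>carrier := R0\<rparr>)).
        \<forall>c\<in>R0. h c = scalar_mat m (E\<lparr>carrier := R0\<rparr>) c) \<and>
    \<comment> \<open>(2)\<close>
     centralizer E R = R0 \<and>
    \<comment> \<open>(3)\<close>
     B \<subseteq> drinfeld_End \<phi> \<and> R = reduction M ` B \<and>
     L = R \<inter> const_op M ` subfield_GF n \<and>
     (\<forall>\<zeta>\<in>subfield_GF n. const_op M \<zeta> \<in> R \<longleftrightarrow> \<zeta> \<in> subfield_GF m) \<and>
    \<comment> \<open>(4)\<close>
     bij_betw (tensor_lift E (\<lambda>l s. l \<otimes>\<^bsub>E\<^esub> s))
       (carrier (tensor_product (ring_of_type_algebra :: 'k ring) (ops_module M L) (ops_module M S)))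
       R"
proof -
  \<comment> \<open>a Bezout relation between \<open>p0\<close> and \<open>p\<close>, evaluated at \<open>t\<close>, excludes a common root\<close>
  have pt: "poly (map_poly to_ac p) t \<noteq> 0"
  proof
    assume root: "poly (map_poly to_ac p) t = 0"
    have "\<not> p dvd p0"
      using monic_irreducible_dvd_imp_eq[OF p0(2) _ p(1) p0(1)] p(2,3) by (auto simp: Factorial_Ring.irreducible_def)
    then obtain x y where xy: "p0 * x + p * y = 1" using irreducible_poly_bezout[OF p(2)] by blast
    have "map_poly to_ac (p0 * x + p * y) =
        map_poly to_ac p0 * map_poly to_ac x + map_poly to_ac p * map_poly to_ac y"
      by (rule poly_eqI) (simp add: coeff_map_poly coeff_mult to_ac_sum)
    then have "poly (map_poly to_ac (p0 * x + p * y)) t = 0" using root t(2) by simp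
    then show False unfolding xy by simp
  qed
  interpret D: drinfeld_torsion_divisor n r p t \<phi> m
  proof
    show "coprime r n" using gcd by (simp add: coprime_iff_gcd_eq_1 gcd.commute)
  qed (use n t(1) \<phi>_hom \<phi>_T p(2) pt m in auto)
  have M': "M = D.M" unfolding M D.M_def ..
  have E': "E = D.E" unfolding E \<kappa> M' D.E_def D.\<kappa>_def ..
  have scal: "scalar_ops \<kappa> M = range D.sop"
    using D.scalar_ops_eq unfolding \<kappa> M' D.\<kappa>_def .
  have \<pi>': "\<pi> = D.\<pi>" unfolding \<pi> D.\<pi>_def ..
  have S': "S = D.S"
    unfolding S E' scal unfolding M' \<pi>' D.reduction_generators D.S_def D.Sgen_def by simp
  have R0': "R0 = D.R0"
    unfolding R0 E' scal unfolding M' \<pi>' D.reduction_generators D.R0_def D.Sgen_def by simp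
  have R': "R = D.R" unfolding R E' R0' D.R_def ..
  have L': "L = D.L" unfolding L M' D.L_def ..
  have B': "B = D.B" unfolding B \<pi>' D.B_def ..
  show ?thesis
    unfolding M' E' S' R0' R' L' B'
    using D.R_eq_End D.R_matrix D.double_centralizer D.B_subset_End D.reduction_B D.L_eq
      D.const_in_R_iff D.tensor_bij by blast
qed

end
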